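(* Let $f:\mathbb{R}\to\mathbb{R}$ be a $C^1$ function such that $f$ is odd, $f(\pm1)=0$, and $f$ is strictly concave in $(0,1)$. Let $\gamma\in(0,1)$, $0<\lambda\le\Lambda$, $m\ge1$. Let $\Omega\subset\mathcal{O}$ be an open set (not necessarily bounded) and let $K$ be a radially symmetric kernel on $\mathbb{R}^{2m}\setminus\{0\}$ such that $\tau\mapsto K(\sqrt{\tau})$ is strictly convex on $(0,+\infty)$ and such that $L_K\in\mathcal{L}_0(2m,\gamma,\lambda,\Lambda)$. Let $u$ be a saddle-shaped solution to $L_Ku=f(u)$ in $\mathbb{R}^{2m}$, and let $v\in L^1_\gamma(\mathbb{R}^{2m})$ be a doubly radial function which is $C^\alpha$ in $\Omega$ and continuous up to the boundary, for some $\alpha>2\gamma$. Assume that $v$ satisfies $$\begin{cases} L_Kv-f'(u)v-c(x)v\le0 & \text{in }\Omega,\\ v\le0 & \text{in }\mathcal{O}\setminus\Omega,\\ -v(x^\star)=v(x) & \text{in }\mathbb{R}^{2m},\\ \displaystyle\limsup_{x\in\Omega,\,|x|\to\infty}v(x)\le0,\end{cases}$$ with $c\le0$ in $\Omega$. Then $v\le0$ in $\Omega$.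
   Context: For a kernel $K$ on $\mathbb{R}^n\setminus\{0\}$, $L_K w(x)=\int_{\mathbb{R}^n}(w(x)-w(y))K(x-y)\,dy$ (principal value sense). For $\gamma\in(0,1)$ and $0<\lambda\le\Lambda$, $L_K\in\mathcal{L}_0(n,\gamma,\lambda,\Lambda)$ means $K(z)=K(-z)$ and $\lambda c_{n,\gamma}|z|^{-n-2\gamma}\le K(z)\le\Lambda c_{n,\gamma}|z|^{-n-2\gamma}$, where $c_{n,\gamma}=\gamma\,\frac{2^{2\gamma}\Gamma(\frac n2+\gamma)}{\pi^{n/2}\Gamma(1-\gamma)}$. If $K$ is radially symmetric, we write $K(z)=K(|z|)$. $L^1_\gamma(\mathbb{R}^n)$ is the space of measurable functions $w$ with $\int_{\mathbb{R}^n}\frac{|w(x)|}{1+|x|^{n+2\gamma}}\,dx<+\infty$. Write $x=(x',x'')\in\mathbb{R}^m\times\mathbb{R}^m=\mathbb{R}^{2m}$. The Simons cone is $\mathscr{C}=\{|x'|=|x''|\}$, and $\mathcal{O}=\{|x'|>|x''|\}$. Let $x^\star=(x'',x')$. A function $w:\mathbb{R}^{2m}\to\mathbb{R}$ is doubly radial if it depends only on $|x'|$ and $|x''|$; a doubly radial function is odd with respect to the Simons cone if $w(x)=-w(x^\star)$ for all $x$. A saddle-shaped solution to $L_Ku=f(u)$ in $\mathbb{R}^{2m}$ is a bounded solution $u$ which is doubly radial, odd with respect to the Simons cone, and satisfies $u>0$ in $\mathcal{O}$. Throughout, saddle-shaped solutions are considered with $|u|\le1$ in $\mathbb{R}^{2m}$.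 Solutions are understood in the classical (pointwise) sense. *)

theory Defs
  imports "HOL-Analysis.Analysis"
begin

definition strictly_convex_on :: "real set \<Rightarrow> (real \<Rightarrow> real) \<Rightarrow> bool" where
  "strictly_convex_on S g \<longleftrightarrow>
     convex S \<and>
     (\<forall>x\<in>S. \<forall>y\<in>S. \<forall>t. x \<noteq> y \<and> 0 < t \<and> t < 1 \<longrightarrow>
        g ((1 - t) * x + t * y) < (1 - t) * g x + t * g y)"

definition strictly_concave_on :: "real set \<Rightarrow> (real \<Rightarrow> real) \<Rightarrow> bool" where
  "strictly_concave_on S g \<longleftrightarrow> strictly_convex_on S (\<lambda>x. - g x)"


(* The class C^{k,beta} on an open set S, with locally uniform Hoelder bounds. *)

primrec Ck_holder :: "nat \<Rightarrow> real \<Rightarrow> 'a::euclidean_space set \<Rightarrow> ('a \<Rightarrow> real) \<Rightarrow> bool" where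
  "Ck_holder 0 \<beta> S w \<longleftrightarrow>
     (\<forall>C. compact C \<and> C \<subseteq> S \<longrightarrow>
        (\<exists>M. \<forall>x\<in>C. \<forall>y\<in>C. \<bar>w x - w y\<bar> \<le> M * norm (x - y) powr \<beta>))"
| "Ck_holder (Suc k) \<beta> S w \<longleftrightarrow>
     (\<exists>D. (\<forall>x\<in>S. (w has_derivative D x) (at x)) \<and>
          (\<forall>h. Ck_holder k \<beta> S (\<lambda>x. D x h)))"

(* C^alpha for real alpha > 0 means C^{k,beta} with alpha = k + beta and 0 < beta <= 1; so an
   integer alpha is read as C^{alpha-1,1}, which contains the usual C^alpha. *)

definition C_alpha_on :: "real \<Rightarrow> 'a::euclidean_space set \<Rightarrow> ('a \<Rightarrow> real) \<Rightarrow> bool" where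
  "C_alpha_on \<alpha> S w \<longleftrightarrow>
     (\<exists>k \<beta>. \<alpha> = real k + \<beta> \<and> 0 < \<beta> \<and> \<beta> \<le> 1 \<and> Ck_holder k \<beta> S w)"


definition c_const :: "nat \<Rightarrow> real \<Rightarrow> real" where
  "c_const n \<gamma> =
     \<gamma> * (2 powr (2 * \<gamma>) * Gamma (real n / 2 + \<gamma>)) / (pi powr (real n / 2) * Gamma (1 - \<gamma>))"

(* Kernels live on the complement of the origin: the value of K at 0 is never constrained. *)

definition L0_class :: "real \<Rightarrow> real \<Rightarrow> real \<Rightarrow> ('a::euclidean_space \<Rightarrow> real) \<Rightarrow> bool" where
  "L0_class \<gamma> lam Lam K \<longleftrightarrow>
     (\<forall>z. z \<noteq> 0 \<longrightarrow>
        K z = K (- z) \<and>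
        lam * c_const DIM('a) \<gamma> * norm z powr (- real DIM('a) - 2 * \<gamma>) \<le> K z \<and>
        K z \<le> Lam * c_const DIM('a) \<gamma> * norm z powr (- real DIM('a) - 2 * \<gamma>))"

(* has_LK K w x l: the principal value defining (L_K w)(x) exists and equals l. *)

definition has_LK :: "('a::euclidean_space \<Rightarrow> real) \<Rightarrow> ('a \<Rightarrow> real) \<Rightarrow> 'a \<Rightarrow> real \<Rightarrow> bool" where
  "has_LK K w x l \<longleftrightarrow>
     (\<forall>\<epsilon>>0. set_integrable lebesgue {y. norm (x - y) > \<epsilon>} (\<lambda>y. (w x - w y) * K (x - y))) \<and>
     ((\<lambda>\<epsilon>. LINT y:{y. norm (x - y) > \<epsilon>}|lebesgue. (w x - w y) * K (x - y)) \<longlongrightarrow> l)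
        (at_right 0)"

definition L1_gamma :: "real \<Rightarrow> ('a::euclidean_space \<Rightarrow> real) set" where
  "L1_gamma \<gamma> =
     {w. w \<in> borel_measurable lebesgue \<and>
         integrable lebesgue (\<lambda>x. \<bar>w x\<bar> / (1 + norm x powr (real DIM('a) + 2 * \<gamma>)))}"


(* R^{2m} = R^m x R^m is the product type with its Euclidean norm; x' = fst x, x'' = snd x, and
   the reflection (x'', x') of x is prod.swap x. *)

definition cone_side :: "((real^'m) \<times> (real^'m)) set" where
  "cone_side = {x. norm (fst x) > norm (snd x)}"

definition doubly_radial :: "((real^'m) \<times> (real^'m) \<Rightarrow> real) \<Rightarrow> bool" where
  "doubly_radial w \<longleftrightarrow>
     (\<forall>x y. norm (fst x) = norm (fst y) \<and> norm (snd x) = norm (snd y) \<longrightarrow> w x = w y)"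

definition cone_odd :: "((real^'m) \<times> (real^'m) \<Rightarrow> real) \<Rightarrow> bool" where
  "cone_odd w \<longleftrightarrow> (\<forall>x. w x = - w (prod.swap x))"

(* Classical solution: u is continuous and the equation holds at every point, the principal
   value existing there. *)

definition saddle_shaped_solution ::
  "((real^'m) \<times> (real^'m) \<Rightarrow> real) \<Rightarrow> (real \<Rightarrow> real) \<Rightarrow> ((real^'m) \<times> (real^'m) \<Rightarrow> real) \<Rightarrow> bool" where
  "saddle_shaped_solution K f u \<longleftrightarrow>
     bounded (range u) \<and> continuous_on UNIV u \<and>
     (\<forall>x. has_LK K u x (f (u x))) \<and>
     doubly_radial u \<and> cone_odd u \<and> (\<forall>x\<in>cone_side. u x > 0)"

end

theory Submission
  imports Defs
begin

text \<open>Let \<open>s\<close> be the sign of \<open>|x'| - |x''|\<close>. Strict concavity of \<open>f\<close> makes \<open>u\<close> a strict supersolution of the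
  linearised equation in \<open>cone_side\<close>, and so is \<open>u + \<delta>s\<close> for small \<open>\<delta> > 0\<close>: near the cone the zero-order term
  \<open>2\<delta> \<integral> K(x - y) dy\<close>, taken over the other side of the cone, absorbs \<open>\<delta> f'(u)\<close>, and away from the cone this needs
  only a positive lower bound for \<open>u\<close>. Since \<open>u + \<delta>s \<ge> \<delta>\<close> while \<open>v\<close> is asymptotically nonpositive, a positive
  supremum of \<open>v / (u + \<delta>s)\<close> over \<open>\<Omega>\<close> is attained at some \<open>x\<close>, where a multiple of \<open>u + \<delta>s\<close> touches \<open>v\<close> from
  above. This contradicts the equations at \<open>x\<close> because the operator has the sign of a maximum principle on odd,
  doubly radial functions: for such functions, averaging over sign changes and over the exchange of the
  directions of \<open>y'\<close> and \<open>y''\<close> reduces \<open>K(x - y) \<ge> K(x - y\<^sup>\<star>)\<close> to convexity of \<open>\<tau> \<mapsto> K(\<surd>\<tau>)\<close>.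

  The lower bound for \<open>u\<close> away from the cone comes from sliding barriers under \<open>u\<close>: wide bumps far from the
  cone, where \<open>f(t) \<ge> \<mu>t\<close> beats the scaling of the operator, and then small bumps that carry the bound
  towards the cone by a fixed proportion of the distance at each step.\<close>

section \<open>Measure-preserving maps and polar coordinates\<close>

text \<open>The pointwise inequality between the kernel at y and at its reflection is false for some
  y in \<open>cone_side\<close>: if y' is opposite to x' and y'' = 0, the reflected point is the
  nearer one. It holds only after averaging, and a finite average suffices: eight images of y, all
  with the same |y'| and |y''|. One generator, the exchange of directions, is not linear; polar
  coordinates are built in order to show that it preserves Lebesgue measure. The quotient v / u is
  not controlled near the cone, where u vanishes; this is why a jump is added across the cone
  instead of comparing with u itself. Because the resulting supersolution is strict, a merely
  nonnegative limit at the touching point is already contradictory. The set where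
  \<open>cone_gap\<close> is at least a given \<epsilon> > 0 is unbounded, so continuity and
  positivity of u give no uniform lower bound on it; hence the barriers, which see f only through
  its sign and its linear growth near 0.\<close>

definition measure_preserving_map :: "('a::euclidean_space \<Rightarrow> 'a) \<Rightarrow> bool" where
  "measure_preserving_map S \<longleftrightarrow> S \<in> borel_measurable borel \<and> distr lborel borel S = lborel"

lemma measure_preserving_mapI:
  fixes S :: "'a::euclidean_space \<Rightarrow> 'a"
  assumes [measurable]: "S \<in> borel_measurable borel"
    and eq: "\<And>A. A \<in> sets borel \<Longrightarrow> (\<integral>\<^sup>+y. indicator A (S y) \<partial>lborel) = emeasure lborel A"
  shows "measure_preserving_map S"
  unfolding measure_preserving_map_def
proof
  show "distr lborel borel S = lborel"
  proof (rule measure_eqI)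
    fix A :: "'a set" assume "A \<in> sets (distr lborel borel S)"
    then have A[measurable]: "A \<in> sets borel" by simp
    have "emeasure (distr lborel borel S) A = (\<integral>\<^sup>+y. indicator A y \<partial>distr lborel borel S)"
      by simp
    also have "\<dots> = emeasure lborel A"
      by (subst nn_integral_distr) (auto simp: eq)
    finally show "emeasure (distr lborel borel S) A = emeasure lborel A" .
  qed simp
qed fact

lemma measure_preserving_map_measurable:
  "measure_preserving_map S \<Longrightarrow> S \<in> borel_measurable borel"
  by (simp add: measure_preserving_map_def)

lemma nn_integral_measure_preserving_map:
  assumes "measure_preserving_map S" and [measurable]: "h \<in> borel_measurable borel"
  shows "(\<integral>\<^sup>+y. h (S y) \<partial>lborel) = (\<integral>\<^sup>+y. h y \<partial>lborel)"
proof -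
  from assms have [measurable]: "S \<in> borel_measurable borel" and "distr lborel borel S = lborel"
    by (auto simp: measure_preserving_map_def)
  then show ?thesis
    using nn_integral_distr[of S lborel borel h] by simp
qed

lemma measure_preserving_map_compose:
  assumes "measure_preserving_map S" "measure_preserving_map T"
  shows "measure_preserving_map (\<lambda>y. S (T y))"
proof (rule measure_preserving_mapI)
  note [measurable] = assms[THEN measure_preserving_map_measurable]
  show "(\<lambda>y. S (T y)) \<in> borel_measurable borel" by measurable
  fix A :: "'a set" assume [measurable]: "A \<in> sets borel"
  show "(\<integral>\<^sup>+y. indicator A (S (T y)) \<partial>lborel) = emeasure lborel A"
    using nn_integral_measure_preserving_map[OF assms(2), of "\<lambda>y. indicator A (S y)"]
      nn_integral_measure_preserving_map[OF assms(1), of "indicator A"] by simp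
qed

lemma AE_measure_preserving_map:
  assumes "measure_preserving_map S" "AE y in lborel. P y"
  shows "AE y in lborel. P (S y)"
proof -
  from assms have [measurable]: "S \<in> borel_measurable borel" and d: "distr lborel borel S = lborel"
    by (auto simp: measure_preserving_map_def)
  from assms(2) have "AE y in distr lborel borel S. P y" unfolding d .
  then show ?thesis
    by (rule AE_distrD[rotated]) simp
qed

text \<open>\<open>W\<close> is only Lebesgue measurable, so it is replaced by a Borel function off
  a null set, and that null set is pulled back along \<open>S\<close>. Invariance is asked for
  almost everywhere because exchanging directions changes the norms of the components when exactly
  one of them vanishes.\<close>

lemma nn_integral_weight_invariant:
  fixes S :: "'a::euclidean_space \<Rightarrow> 'a"
  assumes S: "measure_preserving_map S"
    and W: "W \<in> borel_measurable lebesgue" and inv: "AE y in lborel. W (S y) = W y"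
    and [measurable]: "h \<in> borel_measurable borel"
  shows "(\<integral>\<^sup>+y. W y * h (S y) \<partial>lebesgue) = (\<integral>\<^sup>+y. W y * h y \<partial>lebesgue)"
proof -
  obtain W0 where [measurable]: "W0 \<in> borel_measurable lborel" and W0: "AE y in lborel. W y = W0 y"
    using completion_ex_borel_measurable[OF W] by blast
  have "AE y in lborel. W (S y) = W0 (S y)"
    by (rule AE_measure_preserving_map[OF S W0])
  then have "AE y in lborel. W y * h (S y) = W0 (S y) * h (S y)"
    using inv by eventually_elim auto
  then have "(\<integral>\<^sup>+y. W y * h (S y) \<partial>lborel) = (\<integral>\<^sup>+y. W0 (S y) * h (S y) \<partial>lborel)"
    by (rule nn_integral_cong_AE)
  also have "\<dots> = (\<integral>\<^sup>+y. W0 y * h y \<partial>lborel)"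
    by (rule nn_integral_measure_preserving_map[OF S, of "\<lambda>y. W0 y * h y"]) measurable
  also have "\<dots> = (\<integral>\<^sup>+y. W y * h y \<partial>lborel)"
    using W0 by (intro nn_integral_cong_AE) auto
  finally show ?thesis by (simp add: nn_integral_completion)
qed

lemma nn_integral_lborel_translate:
  fixes t :: "'a::euclidean_space"
  assumes [measurable]: "h \<in> borel_measurable borel"
  shows "(\<integral>\<^sup>+y. h (t + y) \<partial>lborel) = (\<integral>\<^sup>+y. h y \<partial>lborel)"
  using nn_integral_distr[of "\<lambda>y. t + y" lborel borel h] lborel_distr_plus[of t] by simp

lemma nn_integral_lborel_scaleR:
  fixes h :: "'a::euclidean_space \<Rightarrow> ennreal"
  assumes [measurable]: "h \<in> borel_measurable borel" and c: "c \<noteq> 0"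
  shows "(\<integral>\<^sup>+y. h y \<partial>lborel) = ennreal (\<bar>c\<bar> ^ DIM('a)) * (\<integral>\<^sup>+y. h (c *\<^sub>R y) \<partial>lborel)"
proof -
  have "(\<integral>\<^sup>+y. h y \<partial>lborel)
      = (\<integral>\<^sup>+y. h y \<partial>(density (distr lborel borel (\<lambda>x. 0 + c *\<^sub>R x)) (\<lambda>_. ennreal (\<bar>c\<bar>^DIM('a)))))"
    using lborel_affine[OF c, of "0::'a"] by simp
  also have "\<dots> = ennreal (\<bar>c\<bar> ^ DIM('a)) * (\<integral>\<^sup>+y. h (c *\<^sub>R y) \<partial>lborel)"
    by (simp add: nn_integral_density nn_integral_distr nn_integral_cmult)
  finally show ?thesis .
qed

lemma nn_integral_lborel_reflect:
  fixes t :: "'a::euclidean_space"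
  assumes [measurable]: "h \<in> borel_measurable borel"
  shows "(\<integral>\<^sup>+y. h (t - y) \<partial>lborel) = (\<integral>\<^sup>+y. h y \<partial>lborel)"
  using nn_integral_lborel_scaleR[of "\<lambda>y. h (t + y)" "-1"] nn_integral_lborel_translate[of h t]
  by simp

text \<open>Uniqueness of Haar measure: the image of Lebesgue measure under a linear isometry is again
  translation invariant, and it gives the unit ball the right mass.\<close>

lemma measure_preserving_map_orthogonal:
  fixes f :: "'a::euclidean_space \<Rightarrow> 'a"
  assumes f: "orthogonal_transformation f"
  shows "measure_preserving_map f"
proof -
  have lin: "linear f" using f by (rule orthogonal_transformation_linear)
  then have [measurable]: "f \<in> borel_measurable borel"
    by (intro borel_measurable_continuous_onI linear_continuous_on linear_conv_bounded_linear[THEN iffD1])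
  define B :: "'a set" where "B = ball 0 1"
  have [measurable]: "B \<in> sets borel" by (simp add: B_def)
  have B: "indicator B (f y) = (indicator B y :: ennreal)" for y
    using f by (simp add: B_def orthogonal_transformation_norm indicator_def)
  show ?thesis
  proof (rule measure_preserving_mapI)
    show "f \<in> borel_measurable borel" by measurable
    fix A :: "'a set" assume [measurable]: "A \<in> sets borel"
    have "(\<integral>\<^sup>+x. indicator A (f x) \<partial>lborel) * emeasure lborel B
        = (\<integral>\<^sup>+x. indicator A (f x) * (\<integral>\<^sup>+y. indicator B (f x - y) \<partial>lborel) \<partial>lborel)"
      by (simp add: nn_integral_lborel_reflect nn_integral_multc)
    also have "\<dots> = (\<integral>\<^sup>+x. \<integral>\<^sup>+y. indicator A (f x) * indicator B (f x - y) \<partial>lborel \<partial>lborel)"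
      by (simp add: nn_integral_cmult)
    also have "\<dots> = (\<integral>\<^sup>+y. \<integral>\<^sup>+x. indicator A (f x) * indicator B (f x - y) \<partial>lborel \<partial>lborel)"
      by (rule lborel_pair.Fubini'[symmetric]) measurable
    also have "\<dots> = (\<integral>\<^sup>+y. \<integral>\<^sup>+x. indicator A (f x + y) * indicator B (f x) \<partial>lborel \<partial>lborel)"
    proof (rule nn_integral_cong)
      fix y :: 'a
      \<comment> \<open>Shifting x by the preimage z of y moves y from the indicator of the ball
        into that of \<open>A\<close>; the integral in y then gives the mass of \<open>A\<close> by
        translation invariance.\<close>
      obtain z where z: "y = f z"
        using orthogonal_transformation_surj[OF f] by (metis surj_def)
      show "(\<integral>\<^sup>+x. indicator A (f x) * indicator B (f x - y) \<partial>lborel)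
          = (\<integral>\<^sup>+x. indicator A (f x + y) * indicator B (f x) \<partial>lborel)"
        using nn_integral_lborel_translate[of "\<lambda>x. indicator A (f x) * indicator B (f x - y)" z]
        by (simp add: z linear_add[OF lin] linear_diff[OF lin] add.commute)
    qed
    also have "\<dots> = (\<integral>\<^sup>+x. \<integral>\<^sup>+y. indicator A (f x + y) * indicator B (f x) \<partial>lborel \<partial>lborel)"
      by (rule lborel_pair.Fubini') measurable
    also have "\<dots> = (\<integral>\<^sup>+x. emeasure lborel A * indicator B x \<partial>lborel)"
      by (simp add: nn_integral_multc nn_integral_lborel_translate B)
    also have "\<dots> = emeasure lborel A * emeasure lborel B"
      by (simp add: nn_integral_cmult)
    finally have eq: "(\<integral>\<^sup>+x. indicator A (f x) \<partial>lborel) * emeasure lborel B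
      = emeasure lborel A * emeasure lborel B" .
    have "emeasure lborel B = ennreal (unit_ball_vol DIM('a))"
      unfolding B_def by (subst emeasure_ball) auto
    moreover have "unit_ball_vol (real DIM('a)) > 0" by (rule unit_ball_vol_pos) simp
    ultimately have "emeasure lborel B \<noteq> 0" "emeasure lborel B \<noteq> top"
      by (metis ennreal_eq_0_iff not_le, metis ennreal_neq_top)
    with eq show "(\<integral>\<^sup>+x. indicator A (f x) \<partial>lborel) = emeasure lborel A"
      by (metis ennreal_mult_divide_eq)
  qed
qed

section \<open>Polar coordinates\<close>

definition polar_weight :: "nat \<Rightarrow> real \<Rightarrow> ennreal" where
  "polar_weight n r = indicator {0<..} r * ennreal (r ^ n / r)"

text \<open>For n \<ge> 1 the value is (2^n - 1)/n, the integral of \<open>polar_weight n\<close>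
  over {1..2}; the reciprocal form is the one in which the radial integral appears in
  \<open>nn_integral_polar\<close>. The constant gets cancelled, so it has to be nonzero and
  finite.\<close>

definition polar_const :: "nat \<Rightarrow> ennreal" where
  "polar_const n = (\<integral>\<^sup>+r. indicator {0<..} r * (ennreal (1 / r) * (indicator {1..2} (1 / r)
     * ennreal ((1 / r) ^ n))) \<partial>lborel)"

lemma polar_weight_measurable [measurable]: "polar_weight n \<in> borel_measurable borel"
  unfolding polar_weight_def by measurable

lemma polar_const_nonzero: "polar_const n \<noteq> 0" and polar_const_finite: "polar_const n \<noteq> top"
proof -
  have "ennreal (1/2) = (\<integral>\<^sup>+r. indicator {1/2..1} r \<partial>(lborel::real measure))"
    by simp
  also have "\<dots> \<le> polar_const n"
    unfolding polar_const_def
  proof (rule nn_integral_mono)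
    fix r :: real
    have "ennreal (1 / r) * ennreal ((1 / r) ^ n) \<ge> 1" if "1/2 \<le> r" "r \<le> 1"
    proof -
      have "1 \<le> 1 / r" using that by simp
      then have "1 \<le> (1 / r) * (1 / r) ^ n"
        by (metis one_le_power power_Suc)
      then show ?thesis
        using that by (subst ennreal_mult[symmetric]) auto
    qed
    then show "indicator {1/2..1} r \<le> indicator {0<..} r * (ennreal (1 / r) *
        (indicator {1..2} (1 / r) * ennreal ((1 / r) ^ n)))"
      by (auto simp: indicator_def field_simps)
  qed
  finally show "polar_const n \<noteq> 0" by (auto simp: ennreal_eq_0_iff)
  have "polar_const n \<le> (\<integral>\<^sup>+r. ennreal (2 * 2 ^ n) * indicator {1/2..1} r \<partial>(lborel::real measure))"
    unfolding polar_const_def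
  proof (rule nn_integral_mono)
    fix r :: real
    have "ennreal (1 / r) * ennreal ((1 / r) ^ n) \<le> ennreal (2 * 2 ^ n)" if "1/2 \<le> r" "r \<le> 1"
    proof -
      have "0 \<le> 1 / r" "1 / r \<le> 2" using that by (auto simp: field_simps)
      then have "(1 / r) * (1 / r) ^ n \<le> 2 * 2 ^ n"
        by (intro mult_mono power_mono) auto
      then show ?thesis
        using that by (subst ennreal_mult[symmetric]) (auto simp del: ennreal_numeral)
    qed
    moreover have "1/2 \<le> r \<and> r \<le> 1" if "0 < r" "1 / r \<in> {1..2}"
      using that by (auto simp: field_simps)
    ultimately show "indicator {0<..} r * (ennreal (1 / r) *
        (indicator {1..2} (1 / r) * ennreal ((1 / r) ^ n))) \<le> ennreal (2 * 2 ^ n) * indicator {1/2..1} r"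
      by (auto simp: indicator_def)
  qed
  also have "\<dots> = ennreal (2 * 2 ^ n) * ennreal (1/2)"
    by (subst nn_integral_cmult) auto
  also have "\<dots> < top" by (intro ennreal_mult_less_top[THEN iffD2] disjI2 conjI ennreal_less_top)
  finally show "polar_const n \<noteq> top" by auto
qed

text \<open>Polar coordinates without a surface measure: directions are drawn from the shell
  \<open>1 \<le> |z| \<le> 2\<close>, and the formula follows from Tonelli and scaling alone.\<close>

lemma nn_integral_polar:
  fixes F :: "'a::euclidean_space \<Rightarrow> ennreal"
  assumes [measurable]: "F \<in> borel_measurable borel"
  shows "(\<integral>\<^sup>+r. \<integral>\<^sup>+z. polar_weight DIM('a) r * (indicator {1..2} (norm z) * F (r *\<^sub>R sgn z)) \<partial>lborel \<partial>lborel)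
    = polar_const DIM('a) * (\<integral>\<^sup>+y. F y \<partial>lborel)"
proof -
  let ?n = "DIM('a)" let ?w = "polar_weight DIM('a)"
  let ?\<chi> = "\<lambda>t::real. indicator {1..2} t :: ennreal"
  have [measurable]: "(sgn :: 'a \<Rightarrow> 'a) \<in> borel_measurable borel"
    unfolding sgn_div_norm by measurable
  \<comment> \<open>Rescaling r by \<open>norm z\<close> turns the direction \<open>sgn z\<close>
    into z. After Tonelli, \<open>sph\<close> substitutes y = r z, and the radial integral that
    remains is scale invariant, so \<open>inner\<close> finds the same constant for every y \<noteq>
    0.\<close>
  have rad: "(\<integral>\<^sup>+r. ?w r * F (r *\<^sub>R sgn z) \<partial>lborel)
      = (\<integral>\<^sup>+r. ennreal (norm z ^ ?n) * ?w r * F (r *\<^sub>R z) \<partial>lborel)" if "z \<noteq> 0" for z :: 'a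
  proof -
    have "(\<integral>\<^sup>+r. ?w r * F (r *\<^sub>R sgn z) \<partial>lborel)
        = ennreal (norm z) * (\<integral>\<^sup>+r. ?w (norm z * r) * F ((norm z * r) *\<^sub>R sgn z) \<partial>lborel)"
      using nn_integral_real_affine[of "\<lambda>r. ?w r * F (r *\<^sub>R sgn z)" "norm z" 0] that by simp
    also have "\<dots> = (\<integral>\<^sup>+r. ennreal (norm z) * (?w (norm z * r) * F ((norm z * r) *\<^sub>R sgn z)) \<partial>lborel)"
      by (rule nn_integral_cmult[symmetric]) measurable
    also have "\<dots> = (\<integral>\<^sup>+r. ennreal (norm z ^ ?n) * ?w r * F (r *\<^sub>R z) \<partial>lborel)"
    proof (rule nn_integral_cong)
      fix r :: real
      have "(norm z * r) *\<^sub>R sgn z = r *\<^sub>R z"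
        using that by (simp add: sgn_div_norm)
      moreover have "ennreal (norm z) * ?w (norm z * r) = ennreal (norm z ^ ?n) * ?w r"
      proof (cases "r > 0")
        case True
        then have "ennreal (norm z) * ennreal ((norm z * r) ^ ?n / (norm z * r))
            = ennreal (norm z ^ ?n) * ennreal (r ^ ?n / r)"
          using that by (subst (1 2) ennreal_mult[symmetric])
            (auto simp: power_mult_distrib)
        then show ?thesis using True that by (simp add: polar_weight_def)
      next
        case False
        then show ?thesis using that by (simp add: polar_weight_def zero_less_mult_iff)
      qed
      ultimately show "ennreal (norm z) * (?w (norm z * r) * F ((norm z * r) *\<^sub>R sgn z))
          = ennreal (norm z ^ ?n) * ?w r * F (r *\<^sub>R z)"
        by (simp add: mult.assoc[symmetric])
    qed
    finally show ?thesis .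
  qed
  have sph: "(\<integral>\<^sup>+z. ?\<chi> (norm z) * ennreal (norm z ^ ?n) * F (r *\<^sub>R z) \<partial>lborel) * ?w r
      = (\<integral>\<^sup>+y. F y * (indicator {0<..} r * (ennreal (1 / r) * (?\<chi> (norm y / r) * ennreal ((norm y / r) ^ ?n)))) \<partial>lborel)"
    for r :: real
  proof (cases "r > 0")
    case True
    have "(\<integral>\<^sup>+y. F y * (indicator {0<..} r * (ennreal (1 / r) * (?\<chi> (norm y / r) * ennreal ((norm y / r) ^ ?n)))) \<partial>lborel)
       = ennreal (r ^ ?n) * (\<integral>\<^sup>+z. ?\<chi> (norm z) * ennreal (norm z ^ ?n) * F (r *\<^sub>R z) * ennreal (1 / r) \<partial>lborel)"
      using True by (subst nn_integral_lborel_scaleR[where c = r]) (auto simp: ac_simps)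
    also have "\<dots> = (\<integral>\<^sup>+z. ?\<chi> (norm z) * ennreal (norm z ^ ?n) * F (r *\<^sub>R z) \<partial>lborel) * (ennreal (r ^ ?n) * ennreal (1 / r))"
      by (subst nn_integral_multc) (auto simp: ac_simps)
    also have "ennreal (r ^ ?n) * ennreal (1 / r) = ?w r"
      using True by (subst ennreal_mult[symmetric]) (auto simp: polar_weight_def)
    finally show ?thesis by simp
  qed (simp add: polar_weight_def)
  have inner: "(\<integral>\<^sup>+r. indicator {0<..} r * (ennreal (1 / r) * (?\<chi> (norm y / r) * ennreal ((norm y / r) ^ ?n))) \<partial>lborel)
      = polar_const ?n" if "y \<noteq> 0" for y :: 'a
  proof -
    have "(\<integral>\<^sup>+r. indicator {0<..} r * (ennreal (1 / r) * (?\<chi> (norm y / r) * ennreal ((norm y / r) ^ ?n))) \<partial>lborel)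
      = ennreal (norm y) * (\<integral>\<^sup>+r. indicator {0<..} r * (ennreal (1 / (norm y * r)) * (?\<chi> (1 / r) * ennreal ((1 / r) ^ ?n))) \<partial>lborel)"
      using that nn_integral_real_affine[of "\<lambda>r. indicator {0<..} r * (ennreal (1 / r) * (?\<chi> (norm y / r) * ennreal ((norm y / r) ^ ?n)))" "norm y" 0]
      by (simp add: indicator_def zero_less_mult_iff)
    also have "\<dots> = (\<integral>\<^sup>+r. ennreal (norm y) * (indicator {0<..} r * (ennreal (1 / (norm y * r)) * (?\<chi> (1 / r) * ennreal ((1 / r) ^ ?n)))) \<partial>lborel)"
      by (rule nn_integral_cmult[symmetric]) measurable
    also have "\<dots> = polar_const ?n"
      unfolding polar_const_def
    proof (rule nn_integral_cong)
      fix r :: real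
      have "ennreal (norm y) * ennreal (1 / (norm y * r)) = ennreal (1 / r)" if "r > 0"
        using that \<open>y \<noteq> 0\<close> by (subst ennreal_mult[symmetric]) auto
      then show "ennreal (norm y) * (indicator {0<..} r * (ennreal (1 / (norm y * r)) * (?\<chi> (1 / r) * ennreal ((1 / r) ^ ?n))))
          = indicator {0<..} r * (ennreal (1 / r) * (?\<chi> (1 / r) * ennreal ((1 / r) ^ ?n)))"
        by (auto simp: indicator_def mult.assoc[symmetric])
    qed
    finally show ?thesis .
  qed
  have "(\<integral>\<^sup>+r. \<integral>\<^sup>+z. ?w r * (?\<chi> (norm z) * F (r *\<^sub>R sgn z)) \<partial>lborel \<partial>lborel)
      = (\<integral>\<^sup>+z. \<integral>\<^sup>+r. ?w r * (?\<chi> (norm z) * F (r *\<^sub>R sgn z)) \<partial>lborel \<partial>lborel)"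
    by (rule lborel_pair.Fubini') measurable
  also have "\<dots> = (\<integral>\<^sup>+z. ?\<chi> (norm z) * (\<integral>\<^sup>+r. ?w r * F (r *\<^sub>R sgn z) \<partial>lborel) \<partial>lborel)"
    by (rule nn_integral_cong, subst nn_integral_cmult[symmetric]) (auto simp: ac_simps)
  also have "\<dots> = (\<integral>\<^sup>+z. ?\<chi> (norm z) * (\<integral>\<^sup>+r. ennreal (norm z ^ ?n) * ?w r * F (r *\<^sub>R z) \<partial>lborel) \<partial>lborel)"
  proof (rule nn_integral_cong)
    fix z :: 'a
    show "?\<chi> (norm z) * (\<integral>\<^sup>+r. ?w r * F (r *\<^sub>R sgn z) \<partial>lborel)
      = ?\<chi> (norm z) * (\<integral>\<^sup>+r. ennreal (norm z ^ ?n) * ?w r * F (r *\<^sub>R z) \<partial>lborel)"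
      using rad[of z] by (cases "z = 0") simp_all
  qed
  also have "\<dots> = (\<integral>\<^sup>+z. \<integral>\<^sup>+r. ?\<chi> (norm z) * (ennreal (norm z ^ ?n) * ?w r * F (r *\<^sub>R z)) \<partial>lborel \<partial>lborel)"
    by (rule nn_integral_cong, subst nn_integral_cmult[symmetric]) auto
  also have "\<dots> = (\<integral>\<^sup>+r. \<integral>\<^sup>+z. ?\<chi> (norm z) * (ennreal (norm z ^ ?n) * ?w r * F (r *\<^sub>R z)) \<partial>lborel \<partial>lborel)"
    by (rule lborel_pair.Fubini') measurable
  also have "\<dots> = (\<integral>\<^sup>+r. (\<integral>\<^sup>+z. ?\<chi> (norm z) * ennreal (norm z ^ ?n) * F (r *\<^sub>R z) \<partial>lborel) * ?w r \<partial>lborel)"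
    by (rule nn_integral_cong, subst nn_integral_multc[symmetric]) (auto simp: ac_simps)
  also have "\<dots> = (\<integral>\<^sup>+r. \<integral>\<^sup>+y. F y * (indicator {0<..} r * (ennreal (1 / r) * (?\<chi> (norm y / r) * ennreal ((norm y / r) ^ ?n)))) \<partial>lborel \<partial>lborel)"
    by (simp only: sph)
  also have "\<dots> = (\<integral>\<^sup>+y. \<integral>\<^sup>+r. F y * (indicator {0<..} r * (ennreal (1 / r) * (?\<chi> (norm y / r) * ennreal ((norm y / r) ^ ?n)))) \<partial>lborel \<partial>lborel)"
    by (rule lborel_pair.Fubini') measurable
  also have "\<dots> = (\<integral>\<^sup>+y. F y * (\<integral>\<^sup>+r. indicator {0<..} r * (ennreal (1 / r) * (?\<chi> (norm y / r) * ennreal ((norm y / r) ^ ?n))) \<partial>lborel) \<partial>lborel)"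
    by (rule nn_integral_cong, subst nn_integral_cmult[symmetric]) auto
  also have "\<dots> = (\<integral>\<^sup>+y. F y * polar_const ?n \<partial>lborel)"
    by (intro nn_integral_cong_AE eventually_mono[OF AE_lborel_singleton[of "0::'a"]]) (simp only: inner not_False_eq_True)
  finally show ?thesis by (simp add: nn_integral_multc mult.commute)
qed

section \<open>Maps of a product space and the exchange of directions\<close>

lemma measure_preserving_map_prod:
  fixes f :: "'a::euclidean_space \<Rightarrow> 'a" and g :: "'b::euclidean_space \<Rightarrow> 'b"
  assumes "measure_preserving_map f" "measure_preserving_map g"
  shows "measure_preserving_map (\<lambda>y. (f (fst y), g (snd y)))"
proof -
  note [measurable] = assms[THEN measure_preserving_map_measurable]
  have d: "distr lborel borel f = lborel" "distr lborel borel g = lborel"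
    using assms by (auto simp: measure_preserving_map_def)
  have "lborel = distr lborel borel f \<Otimes>\<^sub>M distr lborel borel g"
    unfolding d by (simp only: lborel_prod)
  also have "\<dots> = distr (lborel \<Otimes>\<^sub>M lborel) (borel \<Otimes>\<^sub>M borel) (\<lambda>(x, y). (f x, g y))"
    by (rule pair_measure_distr) (auto simp: d sigma_finite_lborel)
  also have "\<dots> = distr lborel borel (\<lambda>y. (f (fst y), g (snd y)))"
    by (simp add: lborel_prod borel_prod case_prod_unfold)
  finally have eq: "distr lborel borel (\<lambda>y. (f (fst y), g (snd y))) = lborel" ..
  have "(\<lambda>y. (f (fst y), g (snd y))) \<in> borel_measurable borel"
    unfolding borel_prod[symmetric] by measurable
  with eq show ?thesis by (simp add: measure_preserving_map_def)
qed

lemma measure_preserving_map_swap: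
  "measure_preserving_map (prod.swap :: 'a::euclidean_space \<times> 'a \<Rightarrow> _)"
proof -
  have "lborel = distr (lborel \<Otimes>\<^sub>M lborel) (lborel \<Otimes>\<^sub>M lborel) (\<lambda>(x :: 'a, y :: 'a). (y, x))"
    by (metis lborel_pair.distr_pair_swap lborel_prod)
  also have "\<dots> = distr lborel borel prod.swap"
  proof (rule distr_cong)
    show "sets (lborel \<Otimes>\<^sub>M lborel :: ('a \<times> 'a) measure) = sets borel"
      by (metis lborel_prod sets_lborel)
  qed (auto simp: lborel_prod)
  finally have eq: "distr lborel borel (prod.swap :: 'a \<times> 'a \<Rightarrow> _) = lborel" ..
  have "(prod.swap :: 'a \<times> 'a \<Rightarrow> _) \<in> borel_measurable borel"
    unfolding borel_prod[symmetric] prod.swap_def by measurable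
  with eq show ?thesis by (simp add: measure_preserving_map_def)
qed

text \<open>Radii are placed outermost and directions innermost, so that the two directions can be
  interchanged by Tonelli under fixed radii.\<close>

lemma nn_integral_double_polar:
  fixes G :: "'a::euclidean_space \<times> 'a \<Rightarrow> ennreal"
  defines "w \<equiv> polar_weight DIM('a)"
    and "h \<equiv> \<lambda>z::'a. indicator {1..2} (norm z) :: ennreal"
  assumes [measurable]: "G \<in> borel_measurable borel"
  shows "polar_const DIM('a) * (polar_const DIM('a) * (\<integral>\<^sup>+y. G y \<partial>lborel))
    = (\<integral>\<^sup>+r. \<integral>\<^sup>+q. \<integral>\<^sup>+z. \<integral>\<^sup>+x. w r * w q * (h z * h x * G (r *\<^sub>R sgn z, q *\<^sub>R sgn x))
        \<partial>lborel \<partial>lborel \<partial>lborel \<partial>lborel)" (is "?L = ?R")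
proof -
  let ?c = "polar_const DIM('a)"
  have [measurable]: "G \<in> borel_measurable (borel \<Otimes>\<^sub>M borel)" by (simp add: borel_prod)
  have [measurable]: "(sgn :: 'a \<Rightarrow> 'a) \<in> borel_measurable borel"
    unfolding sgn_div_norm by measurable
  have [measurable]: "w \<in> borel_measurable borel" by (simp add: w_def)
  have [measurable]: "h \<in> borel_measurable borel" unfolding h_def by measurable
  have "(\<integral>\<^sup>+y. G y \<partial>lborel) = (\<integral>\<^sup>+a. \<integral>\<^sup>+b. G (a, b) \<partial>lborel \<partial>lborel)"
    using lborel.nn_integral_fst[of G lborel] by (simp add: lborel_prod)
  then have "?L = ?c * (\<integral>\<^sup>+a. ?c * (\<integral>\<^sup>+b. G (a, b) \<partial>lborel) \<partial>lborel)"
    by (simp add: nn_integral_cmult)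
  also have "\<dots> = ?c * (\<integral>\<^sup>+a. \<integral>\<^sup>+q. \<integral>\<^sup>+x. w q * (h x * G (a, q *\<^sub>R sgn x)) \<partial>lborel \<partial>lborel \<partial>lborel)"
    unfolding w_def h_def by (subst nn_integral_polar) auto
  also have "\<dots> = (\<integral>\<^sup>+r. \<integral>\<^sup>+z. w r * (h z * (\<integral>\<^sup>+q. \<integral>\<^sup>+x. w q * (h x * G (r *\<^sub>R sgn z, q *\<^sub>R sgn x))
        \<partial>lborel \<partial>lborel)) \<partial>lborel \<partial>lborel)"
    unfolding w_def h_def by (subst nn_integral_polar[symmetric]) auto
  also have "\<dots> = (\<integral>\<^sup>+r. \<integral>\<^sup>+z. \<integral>\<^sup>+q. \<integral>\<^sup>+x. w r * w q * (h z * h x * G (r *\<^sub>R sgn z, q *\<^sub>R sgn x))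
        \<partial>lborel \<partial>lborel \<partial>lborel \<partial>lborel)"
    by (simp add: nn_integral_cmult[symmetric] ac_simps)
  also have "\<dots> = ?R"
    by (rule nn_integral_cong, rule lborel_pair.Fubini') measurable
  finally show ?thesis .
qed

definition exchange_directions :: "'a::euclidean_space \<times> 'a \<Rightarrow> 'a \<times> 'a" where
  "exchange_directions y = (norm (fst y) *\<^sub>R sgn (snd y), norm (snd y) *\<^sub>R sgn (fst y))"

text \<open>In polar coordinates of both factors the map interchanges the directions z and x and
  leaves the radii r and q alone. Both directions are drawn from the same shell, so Tonelli in these
  two variables gives the invariance.\<close>

lemma measure_preserving_map_exchange_directions:
  "measure_preserving_map (exchange_directions :: 'a::euclidean_space \<times> 'a \<Rightarrow> _)"
proof (rule measure_preserving_mapI)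
  have [measurable]: "(sgn :: 'a \<Rightarrow> 'a) \<in> borel_measurable borel"
    unfolding sgn_div_norm by measurable
  show T[measurable]: "exchange_directions \<in> borel_measurable (borel :: ('a \<times> 'a) measure)"
    unfolding borel_prod[symmetric] exchange_directions_def by measurable
  fix A :: "('a \<times> 'a) set" assume A[measurable]: "A \<in> sets borel"
  let ?c = "polar_const DIM('a)" let ?w = "polar_weight DIM('a)"
  let ?h = "\<lambda>z::'a. indicator {1..2} (norm z) :: ennreal"
  have [measurable]: "indicator A \<in> borel_measurable (borel \<Otimes>\<^sub>M borel :: ('a \<times> 'a) measure)"
    by (simp add: borel_prod)
  \<comment> \<open>Radii that are not positive carry weight 0 and the zero vector lies outside the
    shell, so the default \<open>sgn 0 = 0\<close> does no harm.\<close>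
  have pt: "?w r * ?w q * (?h z * ?h x * indicator A (exchange_directions (r *\<^sub>R sgn z, q *\<^sub>R sgn x)))
      = ?w r * ?w q * (?h x * ?h z * indicator A (r *\<^sub>R sgn x, q *\<^sub>R sgn z))" for r q and z x :: 'a
  proof (cases "r > 0 \<and> q > 0 \<and> z \<noteq> 0 \<and> x \<noteq> 0")
    case True
    moreover have "sgn (sgn v) = sgn v" for v :: 'a
      unfolding sgn_div_norm by (cases "v = 0") simp_all
    ultimately have "exchange_directions (r *\<^sub>R sgn z, q *\<^sub>R sgn x) = (r *\<^sub>R sgn x, q *\<^sub>R sgn z)"
      by (auto simp: exchange_directions_def norm_sgn sgn_scaleR)
    then show ?thesis by (simp add: mult.commute)
  qed (auto simp: polar_weight_def)
  have "?c * (?c * (\<integral>\<^sup>+y. indicator A (exchange_directions y) \<partial>lborel))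
    = (\<integral>\<^sup>+r. \<integral>\<^sup>+q. \<integral>\<^sup>+z. \<integral>\<^sup>+x. ?w r * ?w q * (?h x * ?h z * indicator A (r *\<^sub>R sgn x, q *\<^sub>R sgn z))
        \<partial>lborel \<partial>lborel \<partial>lborel \<partial>lborel)"
    by (subst nn_integral_double_polar) (simp_all only: pt, measurable)
  also have "\<dots> = (\<integral>\<^sup>+r. \<integral>\<^sup>+q. \<integral>\<^sup>+x. \<integral>\<^sup>+z. ?w r * ?w q * (?h x * ?h z * indicator A (r *\<^sub>R sgn x, q *\<^sub>R sgn z))
        \<partial>lborel \<partial>lborel \<partial>lborel \<partial>lborel)"
    by (intro nn_integral_cong lborel_pair.Fubini') measurable
  also have "\<dots> = ?c * (?c * (\<integral>\<^sup>+y. indicator A y \<partial>lborel))"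
    by (subst nn_integral_double_polar) simp_all
  finally have "(\<integral>\<^sup>+y. indicator A (exchange_directions y) \<partial>lborel) = (\<integral>\<^sup>+y. indicator A y \<partial>lborel)"
    using polar_const_nonzero[of "DIM('a)"] polar_const_finite[of "DIM('a)"]
    by (metis ennreal_mult_divide_eq mult.commute)
  then show "(\<integral>\<^sup>+y. indicator A (exchange_directions y) \<partial>lborel) = emeasure lborel A"
    by simp
qed

section \<open>Convexity inequalities for symmetric sums\<close>

lemma convex_symmetric_pair_mono:
  fixes g :: "real \<Rightarrow> real"
  assumes g: "convex_on {0<..} g" and e: "\<bar>e\<bar> \<le> \<bar>c\<bar>" and a: "\<bar>c\<bar> < a"
  shows "g (a + e) + g (a - e) \<le> g (a + c) + g (a - c)"
proof (cases "c = 0")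
  case False
  \<comment> \<open>With this weight a + e and a - e are convex combinations of a - c and a + c with
    interchanged weights, so adding the two bounds gives each endpoint total weight 1.\<close>
  define t where "t = (1 + e / c) / 2"
  have "\<bar>e / c\<bar> \<le> 1" using e False by simp
  then have "e / c \<le> 1" "- (e / c) \<le> 1"
    by (auto dest: abs_le_D1 abs_le_D2 simp del: abs_divide)
  then have t: "0 \<le> t" "t \<le> 1" by (auto simp: t_def)
  have 1: "a + e = (1 - t) * (a - c) + t * (a + c)" "a - e = (1 - t) * (a + c) + t * (a - c)"
    using False by (auto simp: t_def field_simps)
  have "a + c > 0" "a - c > 0" using a by auto
  then have "g (a + e) \<le> (1 - t) * g (a - c) + t * g (a + c)"
    "g (a - e) \<le> (1 - t) * g (a + c) + t * g (a - c)"
    using convex_onD[OF g t, of "a - c" "a + c"] convex_onD[OF g t, of "a + c" "a - c"]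
    unfolding 1 by auto
  then show ?thesis by (simp add: algebra_simps)
qed (use e in simp)

text \<open>Pair inequalities centred at A + c' and A - c' enlarge d' to d; those centred at A + d
  and A - d then enlarge c' to c. The bound on |c| + |d| keeps every argument positive.\<close>

lemma convex_symmetric_quadruple_mono:
  fixes g :: "real \<Rightarrow> real"
  assumes g: "convex_on {0<..} g" and le: "\<bar>c'\<bar> \<le> \<bar>c\<bar>" "\<bar>d'\<bar> \<le> \<bar>d\<bar>" and A: "\<bar>c\<bar> + \<bar>d\<bar> < A"
  shows "g (A + c' + d') + g (A + c' - d') + g (A - c' + d') + g (A - c' - d')
    \<le> g (A + c + d) + g (A + c - d) + g (A - c + d) + g (A - c - d)"
proof -
  have b: "\<bar>c\<bar> < A + d" "\<bar>c\<bar> < A - d" "\<bar>d\<bar> < A + c'" "\<bar>d\<bar> < A - c'"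
    using A le by auto
  have "g (A + c' + d') + g (A + c' - d') \<le> g (A + c' + d) + g (A + c' - d)"
    "g (A - c' + d') + g (A - c' - d') \<le> g (A - c' + d) + g (A - c' - d)"
    using convex_symmetric_pair_mono[OF g le(2)] b by auto
  moreover have "g (A + c' + d) + g (A - c' + d) \<le> g (A + c + d) + g (A - c + d)"
    "g (A + c' - d) + g (A - c' - d) \<le> g (A + c - d) + g (A - c - d)"
    using convex_symmetric_pair_mono[OF g le(1) b(1)] convex_symmetric_pair_mono[OF g le(1) b(2)]
    by (simp_all add: algebra_simps)
  ultimately show ?thesis by linarith
qed

text \<open>With \<open>c = (s\<sigma> + t\<tau>)(a + b)/2\<close> and \<open>d = (s\<sigma> - t\<tau>)(a - b)/2\<close> one has \<open>c + d = s\<sigma>a + t\<tau>b\<close> and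
  \<open>c - d = s\<sigma>b + t\<tau>a\<close>, so the eight terms on each side are two symmetric quadruples.\<close>

lemma convex_octuple_le:
  fixes g :: "real \<Rightarrow> real"
  assumes g: "convex_on {0<..} g" and st: "0 \<le> t" "t \<le> s" "0 \<le> \<tau>" "\<tau> \<le> \<sigma>"
    and ab: "\<bar>a\<bar> \<le> 1" "\<bar>b\<bar> \<le> 1" and A: "2 * (s * \<sigma> + t * \<tau>) < A"
  defines "G \<equiv> \<lambda>P Q. g (A + 2*(P*a + Q*b)) + g (A + 2*(P*a - Q*b)) + g (A - 2*(P*a - Q*b)) + g (A - 2*(P*a + Q*b))
     + (g (A + 2*(P*b + Q*a)) + g (A + 2*(P*b - Q*a)) + g (A - 2*(P*b - Q*a)) + g (A - 2*(P*b + Q*a)))"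
  shows "G (s * \<tau>) (t * \<sigma>) \<le> G (s * \<sigma>) (t * \<tau>)"
proof -
  define P Q M N where "P = s * \<sigma>" and "Q = t * \<tau>" and "M = s * \<tau>" and "N = t * \<sigma>"
  have nn: "0 \<le> P" "0 \<le> Q" "0 \<le> M" "0 \<le> N"
    using st by (auto simp: P_def Q_def M_def N_def)
  \<comment> \<open>The first product is the rearrangement inequality M + N \<le> P + Q; the other
    two say that |M - N| is at most P - Q.\<close>
  have "0 \<le> (s - t) * (\<sigma> - \<tau>)" "0 \<le> (s + t) * (\<sigma> - \<tau>)" "0 \<le> (s - t) * (\<sigma> + \<tau>)"
    using st by auto
  then have PM: "M + N \<le> P + Q" "M - N \<le> P - Q" "N - M \<le> P - Q"
    by (auto simp: P_def Q_def M_def N_def algebra_simps)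
  have bound: "\<bar>P * x\<bar> + \<bar>Q * y\<bar> < A / 2" if "\<bar>x\<bar> \<le> 1" "\<bar>y\<bar> \<le> 1" for x y
  proof -
    have "\<bar>P * x\<bar> \<le> P" "\<bar>Q * y\<bar> \<le> Q"
      using that nn by (auto simp: abs_mult intro: mult_left_le)
    then show ?thesis using A by (simp add: P_def Q_def)
  qed
  note bd = bound[OF ab] bound[OF ab(2,1)]
  \<comment> \<open>The choice c = (P + Q)(a + b), d = (P - Q)(a - b) collects the terms with Pa +
    Qb and Pb + Qa; the choice c = (P - Q)(a + b), d = (P + Q)(a - b) collects those with Pa - Qb
    and Pb - Qa.\<close>
  have 1: "\<bar>(M + N) * (a + b)\<bar> \<le> \<bar>(P + Q) * (a + b)\<bar>" "\<bar>(M - N) * (a - b)\<bar> \<le> \<bar>(P - Q) * (a - b)\<bar>"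
    and 2: "\<bar>(M - N) * (a + b)\<bar> \<le> \<bar>(P - Q) * (a + b)\<bar>" "\<bar>(M + N) * (a - b)\<bar> \<le> \<bar>(P + Q) * (a - b)\<bar>"
    unfolding abs_mult using PM nn by (auto intro!: mult_right_mono)
  have "\<bar>(P + Q) * (a + b)\<bar> + \<bar>(P - Q) * (a - b)\<bar> < A" "\<bar>(P - Q) * (a + b)\<bar> + \<bar>(P + Q) * (a - b)\<bar> < A"
    using bd by (auto simp: abs_if algebra_simps split: if_splits)
  note 3 = convex_symmetric_quadruple_mono[OF g 1 this(1)] convex_symmetric_quadruple_mono[OF g 2 this(2)]
  show ?thesis
    unfolding G_def P_def[symmetric] Q_def[symmetric] M_def[symmetric] N_def[symmetric]
    using 3 by (simp add: algebra_simps)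
qed

section \<open>The reflected kernel\<close>

lemma measure_preserving_map_uminus_fst:
  "measure_preserving_map (\<lambda>y :: 'a::euclidean_space \<times> 'b::euclidean_space. (- fst y, snd y))"
  and measure_preserving_map_uminus_snd:
  "measure_preserving_map (\<lambda>y :: 'a \<times> 'b. (fst y, - snd y))"
  using measure_preserving_map_prod[OF measure_preserving_map_orthogonal measure_preserving_map_orthogonal,
      of "\<lambda>x. - x" "\<lambda>x. x"]
    measure_preserving_map_prod[OF measure_preserving_map_orthogonal measure_preserving_map_orthogonal,
      of "\<lambda>x. x" "\<lambda>x. - x"]
    orthogonal_transformation_neg[of "\<lambda>x. x"]
  by (simp_all add: orthogonal_transformation_neg)

lemma nn_integral_weight_symmetrize:
  fixes S :: "'a::euclidean_space \<Rightarrow> 'a"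
  assumes "measure_preserving_map S" and [measurable]: "W \<in> borel_measurable lebesgue"
    and "AE y in lborel. W (S y) = W y"
    and [measurable]: "h \<in> borel_measurable borel"
  shows "(\<integral>\<^sup>+y. W y * (h y + h (S y)) \<partial>lebesgue) = 2 * (\<integral>\<^sup>+y. W y * h y \<partial>lebesgue)"
proof -
  have [measurable]: "S \<in> borel_measurable borel"
    by (rule measure_preserving_map_measurable) fact
  have [measurable]: "h \<in> borel_measurable lebesgue" "(\<lambda>y. h (S y)) \<in> borel_measurable lebesgue"
    by (auto intro!: measurable_completion)
  have "(\<integral>\<^sup>+y. W y * (h y + h (S y)) \<partial>lebesgue)
    = (\<integral>\<^sup>+y. W y * h y \<partial>lebesgue) + (\<integral>\<^sup>+y. W y * h (S y) \<partial>lebesgue)"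
    unfolding distrib_left by (rule nn_integral_add) measurable
  then show ?thesis
    using nn_integral_weight_invariant[OF assms] by (simp add: mult_2)
qed

text \<open>Each condition excludes part of a hyperplane or a sphere. With r = norm x, the last one
  keeps every point of norm |y|, hence each of the eight images of y, away from x.\<close>

lemma AE_fst_snd_nonzero:
  "AE y in (lborel :: ('a::euclidean_space \<times> 'a) measure). fst y \<noteq> 0 \<and> snd y \<noteq> 0 \<and> norm y \<noteq> r"
proof -
  obtain b :: 'a where b: "b \<in> Basis" using nonempty_Basis by blast
  have "negligible {y :: 'a \<times> 'a. (b, 0) \<bullet> y = 0}" "negligible {y :: 'a \<times> 'a. (0, b) \<bullet> y = 0}"
    using b by (auto intro!: negligible_hyperplane simp: zero_prod_def)
  then have "negligible ({y :: 'a \<times> 'a. (b, 0) \<bullet> y = 0} \<union> {y. (0, b) \<bullet> y = 0} \<union> sphere 0 r)"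
    by (intro negligible_Un negligible_sphere)
  moreover have "{y :: 'a \<times> 'a. (b, 0) \<bullet> y = 0} \<union> {y. (0, b) \<bullet> y = 0} \<union> sphere 0 r \<in> sets borel"
    by (intro sets.Un borel_closed closed_hyperplane) auto
  ultimately have "{y :: 'a \<times> 'a. (b, 0) \<bullet> y = 0} \<union> {y. (0, b) \<bullet> y = 0} \<union> sphere 0 r \<in> null_sets lborel"
    by (auto simp: negligible_iff_null_sets null_sets_completion_iff)
  then show ?thesis
    by (rule AE_I') (auto simp: inner_prod_def)
qed

locale radial_kernel =
  fixes K :: "(real^'m) \<times> (real^'m) \<Rightarrow> real" and k :: "real \<Rightarrow> real"
  assumes radial: "\<And>z. z \<noteq> 0 \<Longrightarrow> K z = k (norm z)"
    and convex: "convex_on {0<..} (\<lambda>\<tau>. k (sqrt \<tau>))"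
    and nonneg: "\<And>z. z \<noteq> 0 \<Longrightarrow> 0 \<le> K z"
begin

text \<open>Convexity on the open half-line gives continuity of the profile, so K is Borel off the
  origin, and its arbitrary value at the origin concerns a single point.\<close>

lemma K_measurable [measurable]: "K \<in> borel_measurable borel"
proof -
  define g where "g \<tau> = indicator {0<..} \<tau> *\<^sub>R k (sqrt \<tau>)" for \<tau> :: real
  have "continuous_on {0<..} (\<lambda>\<tau>. k (sqrt \<tau>))"
    by (intro convex_on_continuous convex) auto
  then have [measurable]: "g \<in> borel_measurable borel"
    unfolding g_def by (intro borel_measurable_continuous_on_indicator) auto
  have eq: "K = (\<lambda>z. if z = 0 then K 0 else g ((norm z)\<^sup>2))"
    by (auto simp: radial g_def)
  show ?thesis by (subst eq) measurable
qed

text \<open>\<open>W\<close> depends on y only through the norms of its components, so each integral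
  is one eighth of the integral of a sum over eight images of y. For these sums the comparison is
  pointwise: it is \<open>convex_octuple_le\<close>, whose hypotheses t \<le> s and \<tau> \<le>
  \<sigma> say that x and the support of \<open>W\<close> lie on the same side of the cone.\<close>

lemma reflected_integral_le:
  fixes W :: "(real^'m) \<times> (real^'m) \<Rightarrow> ennreal"
  assumes x: "x \<in> cone_side" and W: "W \<in> borel_measurable lebesgue"
    and dr: "\<And>y z. norm (fst y) = norm (fst z) \<Longrightarrow> norm (snd y) = norm (snd z) \<Longrightarrow> W y = W z"
    and supp: "\<And>y. y \<notin> cone_side \<Longrightarrow> W y = 0"
  shows "(\<integral>\<^sup>+y. W y * ennreal (K (x - prod.swap y)) \<partial>lebesgue) \<le> (\<integral>\<^sup>+y. W y * ennreal (K (x - y)) \<partial>lebesgue)"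
proof -
  define s t where "s = norm (fst x)" and "t = norm (snd x)"
  have st: "0 \<le> t" "t < s" using x by (auto simp: s_def t_def cone_side_def)
  define e where "e = sgn (fst x)"
  have e: "norm e = 1" "fst x = s *\<^sub>R e"
    using st by (simp_all add: e_def sgn_div_norm s_def[symmetric])
  have "norm (t *\<^sub>R e) = norm (snd x)" using st e(1) by (simp add: t_def)
  \<comment> \<open>An isometry taking the direction of \<open>fst x\<close> to that of
    \<open>snd x\<close>; for t = 0 any isometry will do.\<close>
  then obtain R where R: "orthogonal_transformation R" "R (t *\<^sub>R e) = snd x"
    by (rule orthogonal_transformation_exists)
  define R' where "R' = inv R"
  have R': "orthogonal_transformation R'"
    unfolding R'_def by (rule orthogonal_transformation_inv) (rule R)
  have RR': "R (R' y) = y" "R' (R y) = y" for y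
    unfolding R'_def using orthogonal_transformation_surj[OF R(1)] orthogonal_transformation_inj[OF R(1)]
    by (simp_all only: surj_f_inv_f inv_f_f)
  have R_scale: "R (c *\<^sub>R y) = c *\<^sub>R R y" "R' (c *\<^sub>R y) = c *\<^sub>R R' y" for c y
    using R R' by (auto simp: orthogonal_transformation_scaleR)
  have R_norm: "norm (R y) = norm y" "norm (R' y) = norm y" for y
    using R R' by (auto simp: orthogonal_transformation_norm)
  have R_inner: "R y \<bullet> R z = y \<bullet> z" "R y \<bullet> z = y \<bullet> R' z" for y z
    using R(1) RR'(1) unfolding orthogonal_transformation_def by metis+
  have snd_x: "snd x = t *\<^sub>R R e" using R(2) by (simp add: R_scale)
  \<comment> \<open>The images of y are generated by the sign changes \<open>S1\<close>,
    \<open>S2\<close> and by \<open>T\<close>, an exchange of directions corrected by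
    \<open>R\<close> because \<open>fst x\<close> and \<open>snd x\<close> may point differently;
    \<open>Q\<close> makes the same correction to the reflection. All inner products with x then
    involve only a = e \<bullet> sgn (fst y) and b = R e \<bullet> sgn (snd y), and \<open>T\<close>
    interchanges a and b.\<close>
  define S1 S2 Q T :: "(real^'m) \<times> (real^'m) \<Rightarrow> _"
    where "S1 = (\<lambda>y. (- fst y, snd y))" and "S2 = (\<lambda>y. (fst y, - snd y))"
      and "Q = (\<lambda>y. (R (fst y), R' (snd y)))"
      and "T = (\<lambda>y. (R' (fst (exchange_directions y)), R (snd (exchange_directions y))))"
  have mp: "measure_preserving_map S1" "measure_preserving_map S2" "measure_preserving_map Q" "measure_preserving_map T"
    unfolding S1_def S2_def Q_def T_def
       apply (rule measure_preserving_map_uminus_fst)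
      apply (rule measure_preserving_map_uminus_snd)
     apply (rule measure_preserving_map_prod[OF R(1)[THEN measure_preserving_map_orthogonal]
          R'[THEN measure_preserving_map_orthogonal]])
    apply (rule measure_preserving_map_compose[OF
          measure_preserving_map_prod[OF R'[THEN measure_preserving_map_orthogonal]
          R(1)[THEN measure_preserving_map_orthogonal]] measure_preserving_map_exchange_directions])
    done
  have WS: "W (S1 y) = W y" "W (S2 y) = W y" "W (Q y) = W y" for y
    by (rule dr, simp_all add: S1_def S2_def Q_def R_norm)+
  have WT: "AE y in lborel. W (T y) = W y"
    using AE_fst_snd_nonzero[of 0]
    by eventually_elim (rule dr, simp_all add: T_def exchange_directions_def R_norm norm_sgn)
  note [measurable] = mp[THEN measure_preserving_map_measurable]
  have [measurable]: "prod.swap \<in> borel_measurable (borel :: ((real^'m) \<times> (real^'m)) measure)"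
    by (rule measure_preserving_map_measurable measure_preserving_map_swap)+
  define h1 h2 h3 where "h1 h = (\<lambda>y. h y + h (S1 y))" and "h2 h = (\<lambda>y. h1 h y + h1 h (S2 y))"
    and "h3 h = (\<lambda>y. h2 h y + h2 h (T y))" for h :: "_ \<Rightarrow> ennreal"
  have oct: "(\<integral>\<^sup>+y. W y * h3 h y \<partial>lebesgue) = 2 * (2 * (2 * (\<integral>\<^sup>+y. W y * h y \<partial>lebesgue)))"
    if [measurable]: "h \<in> borel_measurable borel" for h
  proof -
    have [measurable]: "h1 h \<in> borel_measurable borel" "h2 h \<in> borel_measurable borel"
      unfolding h1_def h2_def by measurable
    show ?thesis
      unfolding h3_def nn_integral_weight_symmetrize[OF mp(4) W WT \<open>h2 h \<in> _\<close>]
      unfolding h2_def nn_integral_weight_symmetrize[OF mp(2) W AE_I2[OF WS(2)] \<open>h1 h \<in> _\<close>]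
      unfolding h1_def nn_integral_weight_symmetrize[OF mp(1) W AE_I2[OF WS(1)] \<open>h \<in> _\<close>] ..
  qed
  define p q where "p y = ennreal (K (x - y))" and "q y = ennreal (K (x - prod.swap (Q y)))" for y
  have [measurable]: "p \<in> borel_measurable borel" "q \<in> borel_measurable borel"
    unfolding p_def q_def by measurable
  have le: "h3 q y \<le> h3 p y" if y: "fst y \<noteq> 0" "snd y \<noteq> 0" "norm y \<noteq> norm x" "y \<in> cone_side" for y
  proof -
    define \<sigma> \<tau> a b where "\<sigma> = norm (fst y)" and "\<tau> = norm (snd y)"
      and "a = e \<bullet> sgn (fst y)" and "b = R e \<bullet> sgn (snd y)"
    have ord: "0 \<le> \<tau>" "\<tau> \<le> \<sigma>" using y by (auto simp: \<sigma>_def \<tau>_def cone_side_def)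
    have y': "fst y = \<sigma> *\<^sub>R sgn (fst y)" "snd y = \<tau> *\<^sub>R sgn (snd y)"
      using y by (auto simp: \<sigma>_def \<tau>_def sgn_div_norm)
    have ab: "\<bar>a\<bar> \<le> 1" "\<bar>b\<bar> \<le> 1"
      using Cauchy_Schwarz_ineq2[of e "sgn (fst y)"] Cauchy_Schwarz_ineq2[of "R e" "sgn (snd y)"] e y
      by (auto simp: a_def b_def R_norm norm_sgn)
    define A where "A = (norm x)\<^sup>2 + (norm y)\<^sup>2"
    have nx: "(norm x)\<^sup>2 = s\<^sup>2 + t\<^sup>2" "(norm y)\<^sup>2 = \<sigma>\<^sup>2 + \<tau>\<^sup>2"
      by (simp_all add: norm_prod_def s_def t_def \<sigma>_def \<tau>_def)
    \<comment> \<open>Different norms make A minus twice s\<sigma> + t\<tau> a positive sum of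
      squares, so all squared distances in both octuples are positive.\<close>
    have "s \<noteq> \<sigma> \<or> t \<noteq> \<tau>"
      using y(3) by (auto simp: norm_prod_def s_def t_def \<sigma>_def \<tau>_def)
    then have "0 < (s - \<sigma>)\<^sup>2 + (t - \<tau>)\<^sup>2"
      by (auto simp: sum_power2_gt_zero_iff)
    then have A: "2 * (s * \<sigma> + t * \<tau>) < A"
      unfolding A_def nx by (simp add: power2_eq_square algebra_simps)
    define g where "g \<tau> = k (sqrt \<tau>)" for \<tau>
    have Kz: "K (x - z) = g (A - 2 * (x \<bullet> z))" "0 \<le> K (x - z)" if "norm z = norm y" for z
    proof -
      have "x \<noteq> z" using that y by auto
      moreover have "(norm (x - z))\<^sup>2 = A - 2 * (x \<bullet> z)"
        by (simp add: A_def power2_norm_eq_inner inner_diff that[symmetric] inner_commute)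
      then have "norm (x - z) = sqrt (A - 2 * (x \<bullet> z))"
        by (metis norm_ge_zero real_sqrt_unique)
      ultimately show "K (x - z) = g (A - 2 * (x \<bullet> z))" "0 \<le> K (x - z)"
        using radial[of "x - z"] nonneg[of "x - z"] by (auto simp: g_def)
    qed
    have T: "T y = (\<sigma> *\<^sub>R R' (sgn (snd y)), \<tau> *\<^sub>R R (sgn (fst y)))"
      by (simp add: T_def exchange_directions_def R_scale \<sigma>_def \<tau>_def)
    have swQ: "prod.swap (Q z) = (R' (snd z), R (fst z))" for z by (simp add: Q_def)
    have nrm: "norm (T y) = norm y" "norm (S1 z) = norm z" "norm (S2 z) = norm z"
      "norm (prod.swap (Q z)) = norm z" for z
      using y unfolding T swQ by (simp_all add: S1_def S2_def R_norm norm_prod_def norm_sgn \<sigma>_def \<tau>_def add.commute)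
    have ip: "x \<bullet> z = s * (e \<bullet> fst z) + t * (R e \<bullet> snd z)" for z
      by (simp add: inner_prod_def e snd_x)
    have ea: "e \<bullet> fst y = \<sigma> * a" "R e \<bullet> snd y = \<tau> * b"
      unfolding a_def b_def inner_scaleR_right[symmetric] y'[symmetric] by (rule refl)+
    have eT: "e \<bullet> fst (T y) = \<sigma> * b" "R e \<bullet> snd (T y) = \<tau> * a"
      unfolding T fst_conv snd_conv inner_scaleR_right R_inner(1) R_inner(2)[symmetric] a_def b_def
      by (rule refl)+
    have ipQ: "x \<bullet> prod.swap (Q z) = s * (R e \<bullet> snd z) + t * (e \<bullet> fst z)" for z
      unfolding ip swQ fst_conv snd_conv R_inner(1) by (simp add: R_inner(2))
    have oct_sum: "h3 (\<lambda>z. ennreal (K (x - F z))) y = ennreal (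
        g (A - 2 * (x \<bullet> F (S1 (S2 y)))) + g (A - 2 * (x \<bullet> F (S1 y)))
        + g (A - 2 * (x \<bullet> F (S2 y))) + g (A - 2 * (x \<bullet> F y))
        + (g (A - 2 * (x \<bullet> F (S1 (S2 (T y))))) + g (A - 2 * (x \<bullet> F (S1 (T y))))
        + g (A - 2 * (x \<bullet> F (S2 (T y)))) + g (A - 2 * (x \<bullet> F (T y)))))"
      if F: "\<And>z. norm (F z) = norm z" for F
    proof -
      have n: "norm (F z) = norm y" if "norm z = norm y" for z using F that by simp
      have "h3 (\<lambda>z. ennreal (K (x - F z))) y = ennreal (
        K (x - F (S1 (S2 y))) + K (x - F (S1 y)) + K (x - F (S2 y)) + K (x - F y)
        + (K (x - F (S1 (S2 (T y)))) + K (x - F (S1 (T y))) + K (x - F (S2 (T y))) + K (x - F (T y))))"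
        unfolding h3_def h2_def h1_def by (simp add: ennreal_plus Kz(2) n nrm ac_simps)
      then show ?thesis by (simp only: Kz(1) n nrm)
    qed
    have P: "h3 p y = ennreal (g (A + 2*(s*\<sigma>*a + t*\<tau>*b)) + g (A + 2*(s*\<sigma>*a - t*\<tau>*b))
      + g (A - 2*(s*\<sigma>*a - t*\<tau>*b)) + g (A - 2*(s*\<sigma>*a + t*\<tau>*b))
      + (g (A + 2*(s*\<sigma>*b + t*\<tau>*a)) + g (A + 2*(s*\<sigma>*b - t*\<tau>*a))
      + g (A - 2*(s*\<sigma>*b - t*\<tau>*a)) + g (A - 2*(s*\<sigma>*b + t*\<tau>*a))))"
      unfolding p_def oct_sum[of "\<lambda>z. z", OF refl] ip
      by (simp add: S1_def S2_def ea eT algebra_simps)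
    have Q': "h3 q y = ennreal (g (A + 2*(s*\<tau>*a + t*\<sigma>*b)) + g (A + 2*(s*\<tau>*a - t*\<sigma>*b))
      + g (A - 2*(s*\<tau>*a - t*\<sigma>*b)) + g (A - 2*(s*\<tau>*a + t*\<sigma>*b))
      + (g (A + 2*(s*\<tau>*b + t*\<sigma>*a)) + g (A + 2*(s*\<tau>*b - t*\<sigma>*a))
      + g (A - 2*(s*\<tau>*b - t*\<sigma>*a)) + g (A - 2*(s*\<tau>*b + t*\<sigma>*a))))"
      unfolding q_def oct_sum[of "\<lambda>z. prod.swap (Q z)", OF nrm(4)] ipQ
      by (simp add: S1_def S2_def ea eT algebra_simps)
    show ?thesis
      unfolding P Q'
      using convex_octuple_le[OF convex st(1) less_imp_le[OF st(2)] ord ab A]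
      by (intro ennreal_leI) (simp only: g_def)
  qed
  have "AE y in lborel. W y * h3 q y \<le> W y * h3 p y"
    using AE_fst_snd_nonzero[of "norm x"]
  proof eventually_elim
    case (elim y)
    then show ?case
      using le[of y] supp[of y] by (cases "y \<in> cone_side") (auto intro: mult_left_mono)
  qed
  then have "(\<integral>\<^sup>+y. W y * h3 q y \<partial>lebesgue) \<le> (\<integral>\<^sup>+y. W y * h3 p y \<partial>lebesgue)"
    unfolding nn_integral_completion by (rule nn_integral_mono_AE)
  then have "(\<integral>\<^sup>+y. W y * q y \<partial>lebesgue) \<le> (\<integral>\<^sup>+y. W y * p y \<partial>lebesgue)"
    by (simp add: oct ennreal_mult_le_mult_iff)
  moreover have "(\<integral>\<^sup>+y. W y * q y \<partial>lebesgue) = (\<integral>\<^sup>+y. W y * ennreal (K (x - prod.swap y)) \<partial>lebesgue)"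
    unfolding q_def
    by (rule nn_integral_weight_invariant[OF mp(3) W AE_I2[OF WS(3)], of "\<lambda>y. ennreal (K (x - prod.swap y))"])
      measurable
  ultimately show ?thesis by (simp add: p_def)
qed

end

section \<open>Integrals of the kernel\<close>

lemma nn_integral_lebesgue_measure_preserving_map:
  fixes S :: "'a::euclidean_space \<Rightarrow> 'a"
  assumes S: "measure_preserving_map S" and H: "H \<in> borel_measurable lebesgue"
  shows "(\<integral>\<^sup>+y. H (S y) \<partial>lebesgue) = (\<integral>\<^sup>+y. H y \<partial>lebesgue)"
proof -
  obtain H0 where [measurable]: "H0 \<in> borel_measurable lborel" and H0: "AE y in lborel. H y = H0 y"
    using completion_ex_borel_measurable[OF H] by blast
  have "(\<integral>\<^sup>+y. H (S y) \<partial>lborel) = (\<integral>\<^sup>+y. H0 (S y) \<partial>lborel)"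
    using AE_measure_preserving_map[OF S H0] by (rule nn_integral_cong_AE)
  also have "\<dots> = (\<integral>\<^sup>+y. H0 y \<partial>lborel)"
    by (rule nn_integral_measure_preserving_map[OF S]) simp
  also have "\<dots> = (\<integral>\<^sup>+y. H y \<partial>lborel)"
    using H0 by (intro nn_integral_cong_AE) auto
  finally show ?thesis by (simp add: nn_integral_completion)
qed

lemma nn_integral_radial:
  fixes f :: "real \<Rightarrow> ennreal"
  assumes [measurable]: "f \<in> borel_measurable borel"
  shows "polar_const DIM('a) * (\<integral>\<^sup>+y. f (norm (y::'a::euclidean_space)) \<partial>lborel)
    = emeasure lborel {z::'a. 1 \<le> norm z \<and> norm z \<le> 2} * (\<integral>\<^sup>+r. polar_weight DIM('a) r * f r \<partial>lborel)"
proof -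
  have "polar_weight DIM('a) r * (indicator {1..2} (norm z) * f (norm (r *\<^sub>R sgn z)))
      = polar_weight DIM('a) r * f r * indicator {z::'a. 1 \<le> norm z \<and> norm z \<le> 2} z" for r and z :: 'a
    by (auto simp: polar_weight_def indicator_def norm_sgn)
  then have "polar_const DIM('a) * (\<integral>\<^sup>+y. f (norm (y::'a)) \<partial>lborel)
    = (\<integral>\<^sup>+r. \<integral>\<^sup>+z. polar_weight DIM('a) r * f r * indicator {z::'a. 1 \<le> norm z \<and> norm z \<le> 2} z \<partial>lborel \<partial>lborel)"
    by (subst nn_integral_polar[symmetric]) simp_all
  also have "\<dots> = (\<integral>\<^sup>+r. emeasure lborel {z::'a. 1 \<le> norm z \<and> norm z \<le> 2} * (polar_weight DIM('a) r * f r) \<partial>lborel)"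
    by (subst nn_integral_cmult) (auto simp: mult.commute)
  also have "\<dots> = emeasure lborel {z::'a. 1 \<le> norm z \<and> norm z \<le> 2} * (\<integral>\<^sup>+r. polar_weight DIM('a) r * f r \<partial>lborel)"
    by (rule nn_integral_cmult) measurable
  finally show ?thesis .
qed

lemma nn_integral_radial_le:
  obtains C where "C > 0" "\<And>f. f \<in> borel_measurable borel \<Longrightarrow>
    (\<integral>\<^sup>+y. f (norm (y::'a::euclidean_space)) \<partial>lborel) \<le> ennreal C * (\<integral>\<^sup>+r. polar_weight DIM('a) r * f r \<partial>lborel)"
proof -
  let ?S = "emeasure lborel {z::'a. 1 \<le> norm z \<and> norm z \<le> 2}"
  let ?c = "polar_const DIM('a)"
  have "?S \<le> emeasure lborel (cball (0::'a) 2)" by (intro emeasure_mono) auto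
  also have "\<dots> < top" using emeasure_lborel_cball_finite[of "0::'a" 2] by (simp add: top.not_eq_extremum)
  finally have "?S / ?c < top"
    using polar_const_nonzero[of "DIM('a)"] by (simp add: ennreal_divide_eq_top_iff less_top[symmetric])
  then obtain C where C: "?S / ?c = ennreal C" "C \<ge> 0" by (cases "?S / ?c") auto
  show thesis
  \<comment> \<open>Adding 1 makes the constant positive whatever the quotient is.\<close>
  proof (rule that[of "C + 1"])
    fix f :: "real \<Rightarrow> ennreal" assume f: "f \<in> borel_measurable borel"
    let ?I = "\<integral>\<^sup>+r. polar_weight DIM('a) r * f r \<partial>lborel" and ?J = "\<integral>\<^sup>+y. f (norm (y::'a)) \<partial>lborel"
    have "?J = ?c * ?J / ?c"
      using polar_const_nonzero polar_const_finite by (metis ennreal_mult_divide_eq mult.commute)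
    also have "\<dots> = ennreal C * ?I"
      unfolding nn_integral_radial[OF f] C(1)[symmetric] by (simp add: divide_ennreal_def ac_simps)
    also have "\<dots> \<le> ennreal (C + 1) * ?I"
      by (intro mult_right_mono ennreal_leI) auto
    finally show "?J \<le> ennreal (C + 1) * ?I" .
  qed (use C in auto)
qed

lemma polar_weight_powr:
  "r > 0 \<Longrightarrow> polar_weight n r * ennreal (r powr (p - real n)) = ennreal (r powr (p - 1))"
  by (simp add: polar_weight_def ennreal_mult[symmetric] powr_diff powr_realpow[symmetric])

text \<open>Polar coordinates leave the integrals of \<rho> powr (-1 - 2\<gamma>) over {r..} and of
  \<rho> powr (1 - 2\<gamma>) over {0..r}. They converge because \<gamma> > 0 and \<gamma> < 1
  respectively, with factors 1/(2\<gamma>) and 1/(2 - 2\<gamma>), whose maximum enters the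
  constant.\<close>

lemma riesz_tail_bounds:
  assumes \<gamma>: "0 < \<gamma>" "\<gamma> < 1"
  obtains C where "C > 0"
    "\<And>r. r > 0 \<Longrightarrow> (\<integral>\<^sup>+z. indicator {z. r \<le> norm z} z * ennreal (norm z powr (- real DIM('a) - 2 * \<gamma>))
      \<partial>(lborel :: 'a::euclidean_space measure)) \<le> ennreal (C * r powr (- 2 * \<gamma>))"
    "\<And>r. r > 0 \<Longrightarrow> (\<integral>\<^sup>+z. indicator {z. norm z \<le> r} z * ennreal ((norm z)\<^sup>2 * norm z powr (- real DIM('a) - 2 * \<gamma>))
      \<partial>(lborel :: 'a measure)) \<le> ennreal (C * r powr (2 - 2 * \<gamma>))"
proof -
  obtain C where C: "C > 0" "\<And>f. f \<in> borel_measurable borel \<Longrightarrow>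
    (\<integral>\<^sup>+y. f (norm (y::'a)) \<partial>lborel) \<le> ennreal C * (\<integral>\<^sup>+r. polar_weight DIM('a) r * f r \<partial>lborel)"
    using nn_integral_radial_le by blast
  define C' where "C' = C * max (1 / (2 * \<gamma>)) (1 / (2 - 2 * \<gamma>))"
  show thesis
  proof (rule that[of C'])
    show "C' > 0" using C(1) \<gamma> by (auto simp: C'_def intro!: mult_pos_pos simp: less_max_iff_disj)
    fix r :: real assume r: "r > 0"
    define f where "f \<rho> = indicator {r..} \<rho> * ennreal (\<rho> powr (- real DIM('a) - 2 * \<gamma>))" for \<rho> :: real
    have e: "- 2 * \<gamma> - real DIM('a) = - real DIM('a) - 2 * \<gamma>" "- 2 * \<gamma> - 1 = - 1 - 2 * \<gamma>" by simp_all
    have "(\<integral>\<^sup>+\<rho>. polar_weight DIM('a) \<rho> * f \<rho> \<partial>lborel) = (\<integral>\<^sup>+\<rho>. ennreal (\<rho> powr (-1 - 2 * \<gamma>)) * indicator {r..} \<rho> \<partial>lborel)"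
    proof (rule nn_integral_cong)
      fix \<rho> :: real
      show "polar_weight DIM('a) \<rho> * f \<rho> = ennreal (\<rho> powr (-1 - 2 * \<gamma>)) * indicator {r..} \<rho>"
        using polar_weight_powr[of \<rho> "DIM('a)" "- 2 * \<gamma>", unfolded e] r
        by (cases "r \<le> \<rho>") (auto simp: f_def)
    qed
    also have "\<dots> = ennreal (- (r powr (-1 - 2 * \<gamma> + 1)) / (-1 - 2 * \<gamma> + 1))"
      using r \<gamma> by (intro nn_integral_has_integral_lebesgue' has_integral_powr_to_inf) auto
    also have "- (r powr (-1 - 2 * \<gamma> + 1)) / (-1 - 2 * \<gamma> + 1) = 1 / (2 * \<gamma>) * r powr (- 2 * \<gamma>)"
      by simp
    finally have I: "(\<integral>\<^sup>+\<rho>. polar_weight DIM('a) \<rho> * f \<rho> \<partial>lborel) = ennreal (1 / (2 * \<gamma>) * r powr (- 2 * \<gamma>))" .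
    have "(\<integral>\<^sup>+z. indicator {z. r \<le> norm z} z * ennreal (norm z powr (- real DIM('a) - 2 * \<gamma>)) \<partial>(lborel :: 'a measure))
      = (\<integral>\<^sup>+z. f (norm (z :: 'a)) \<partial>lborel)"
      by (intro nn_integral_cong) (auto simp: f_def indicator_def)
    also have "\<dots> \<le> ennreal C * ennreal (1 / (2 * \<gamma>) * r powr (- 2 * \<gamma>))"
      unfolding I[symmetric] by (rule C) (unfold f_def, measurable)
    also have "\<dots> \<le> ennreal (C' * r powr (- 2 * \<gamma>))"
      using C(1) \<gamma> unfolding C'_def mult.assoc
      by (subst ennreal_mult[symmetric]) (auto intro!: ennreal_leI mult_left_mono mult_right_mono simp del: times_divide_eq_left times_divide_eq_right)
    finally show "(\<integral>\<^sup>+z. indicator {z. r \<le> norm z} z * ennreal (norm z powr (- real DIM('a) - 2 * \<gamma>)) \<partial>(lborel :: 'a measure))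
      \<le> ennreal (C' * r powr (- 2 * \<gamma>))" .
  next
    fix r :: real assume r: "r > 0"
    define f where "f \<rho> = indicator {..r} \<rho> * ennreal (\<rho>\<^sup>2 * \<rho> powr (- real DIM('a) - 2 * \<gamma>))" for \<rho> :: real
    have "(\<integral>\<^sup>+\<rho>. polar_weight DIM('a) \<rho> * f \<rho> \<partial>lborel) = (\<integral>\<^sup>+\<rho>. ennreal (\<rho> powr (1 - 2 * \<gamma>)) * indicator {0..r} \<rho> \<partial>lborel)"
    proof (rule nn_integral_cong)
      fix \<rho> :: real
      have "\<rho>\<^sup>2 * \<rho> powr (- real DIM('a) - 2 * \<gamma>) = \<rho> powr ((2 - 2 * \<gamma>) - real DIM('a))" if "\<rho> > 0"
      proof -
        have "\<rho>\<^sup>2 = \<rho> powr 2" using that by simp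
        then show ?thesis by (simp only: powr_add[symmetric]) (simp add: algebra_simps)
      qed
      then show "polar_weight DIM('a) \<rho> * f \<rho> = ennreal (\<rho> powr (1 - 2 * \<gamma>)) * indicator {0..r} \<rho>"
        using polar_weight_powr[of \<rho> "DIM('a)" "2 - 2 * \<gamma>"]
        by (cases "0 < \<rho>") (auto simp: f_def indicator_def polar_weight_def algebra_simps)
    qed
    also have "\<dots> = ennreal (r powr (1 - 2 * \<gamma> + 1) / (1 - 2 * \<gamma> + 1))"
      using r \<gamma> by (intro nn_integral_has_integral_lebesgue' has_integral_powr_from_0) auto
    also have "r powr (1 - 2 * \<gamma> + 1) / (1 - 2 * \<gamma> + 1) = 1 / (2 - 2 * \<gamma>) * r powr (2 - 2 * \<gamma>)"
      by simp
    finally have I: "(\<integral>\<^sup>+\<rho>. polar_weight DIM('a) \<rho> * f \<rho> \<partial>lborel) = ennreal (1 / (2 - 2 * \<gamma>) * r powr (2 - 2 * \<gamma>))" .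
    have "(\<integral>\<^sup>+z. indicator {z. norm z \<le> r} z * ennreal ((norm z)\<^sup>2 * norm z powr (- real DIM('a) - 2 * \<gamma>)) \<partial>(lborel :: 'a measure))
      = (\<integral>\<^sup>+z. f (norm (z :: 'a)) \<partial>lborel)"
      by (intro nn_integral_cong) (auto simp: f_def indicator_def)
    also have "\<dots> \<le> ennreal C * ennreal (1 / (2 - 2 * \<gamma>) * r powr (2 - 2 * \<gamma>))"
      unfolding I[symmetric] by (rule C) (unfold f_def, measurable)
    also have "\<dots> \<le> ennreal (C' * r powr (2 - 2 * \<gamma>))"
      using C(1) \<gamma> unfolding C'_def mult.assoc
      by (subst ennreal_mult[symmetric]) (auto intro!: ennreal_leI mult_left_mono mult_right_mono simp del: times_divide_eq_left times_divide_eq_right)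
    finally show "(\<integral>\<^sup>+z. indicator {z. norm z \<le> r} z * ennreal ((norm z)\<^sup>2 * norm z powr (- real DIM('a) - 2 * \<gamma>))
      \<partial>(lborel :: 'a measure)) \<le> ennreal (C' * r powr (2 - 2 * \<gamma>))" .
  qed
qed

section \<open>The signed gap to the Simons cone\<close>

definition cone_gap :: "(real^'m) \<times> (real^'m) \<Rightarrow> real" where
  "cone_gap y = norm (fst y) - norm (snd y)"

lemma cone_side_iff: "y \<in> cone_side \<longleftrightarrow> 0 < cone_gap y"
  by (simp add: cone_side_def cone_gap_def)

lemma cone_gap_swap: "cone_gap (prod.swap y) = - cone_gap y"
  by (simp add: cone_gap_def)

text \<open>The gap is sqrt 2 times the signed distance to the cone; the cruder Lipschitz constant 2
  is the source of the halves in the later distance estimates.\<close>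

lemma cone_gap_diff_le: "\<bar>cone_gap x - cone_gap y\<bar> \<le> 2 * norm (x - y)"
proof -
  have "\<bar>norm (fst x) - norm (fst y)\<bar> \<le> norm (x - y)" "\<bar>norm (snd x) - norm (snd y)\<bar> \<le> norm (x - y)"
  proof -
    have "norm (fst (x - y)) \<le> norm (x - y)" "norm (snd (x - y)) \<le> norm (x - y)"
      using norm_fst_le[of "fst (x - y)" "snd (x - y)"] norm_snd_le[of "snd (x - y)" "fst (x - y)"]
      by (simp_all only: prod.collapse)
    then show "\<bar>norm (fst x) - norm (fst y)\<bar> \<le> norm (x - y)" "\<bar>norm (snd x) - norm (snd y)\<bar> \<le> norm (x - y)"
      using norm_triangle_ineq3[of "fst x" "fst y"] norm_triangle_ineq3[of "snd x" "snd y"] by simp_all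
  qed
  then show ?thesis by (simp add: cone_gap_def)
qed

lemma continuous_on_cone_gap: "continuous_on S cone_gap"
  unfolding cone_gap_def by (intro continuous_intros)

lemma cone_gap_measurable [measurable]: "cone_gap \<in> borel_measurable borel"
  by (intro borel_measurable_continuous_onI continuous_on_cone_gap)

lemma cone_side_borel [measurable]: "cone_side \<in> sets (borel :: ((real^'m) \<times> (real^'m)) measure)"
proof -
  have "cone_side = {y :: (real^'m) \<times> (real^'m). 0 < cone_gap y}" using cone_side_iff by blast
  moreover have "{y :: (real^'m) \<times> (real^'m). 0 < cone_gap y} \<in> sets borel"
    by measurable
  ultimately show ?thesis by simp
qed

lemma cone_odd_doubly_radial_zero:
  assumes "cone_odd w" "doubly_radial w" "cone_gap y = 0"
  shows "w y = 0"
proof -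
  have "w (prod.swap y) = w y"
    using assms(2,3) unfolding doubly_radial_def cone_gap_def
    by (elim allE[of _ "prod.swap y"] allE[of _ y]) simp
  moreover have "w y = - w (prod.swap y)" using assms(1) unfolding cone_odd_def by (rule spec)
  ultimately show ?thesis by simp
qed

text \<open>\<open>\<kappa>1\<close> and \<open>\<kappa>2\<close> stand for \<open>lam\<close> and
  \<open>Lam\<close> times \<open>c_const\<close>, so that the estimates see the bounds on the
  kernel as plain multiples of one power of the norm.\<close>

locale stable_kernel = radial_kernel K k
  for K :: "(real^'m) \<times> (real^'m) \<Rightarrow> real" and k +
  fixes \<gamma> \<kappa>1 \<kappa>2 :: real
  assumes \<gamma>: "0 < \<gamma>" "\<gamma> < 1" and \<kappa>1: "0 < \<kappa>1"
    and lower: "\<And>z. z \<noteq> 0 \<Longrightarrow> \<kappa>1 * norm z powr (- real DIM((real^'m) \<times> (real^'m)) - 2 * \<gamma>) \<le> K z"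
    and upper: "\<And>z. z \<noteq> 0 \<Longrightarrow> K z \<le> \<kappa>2 * norm z powr (- real DIM((real^'m) \<times> (real^'m)) - 2 * \<gamma>)"
begin

lemma \<kappa>2: "0 < \<kappa>2"
proof -
  obtain b :: "(real^'m) \<times> (real^'m)" where "b \<in> Basis" using nonempty_Basis by blast
  then have "b \<noteq> 0" "norm b = 1" by auto
  then show ?thesis using lower[of b] upper[of b] \<kappa>1 by simp
qed

lemma K_minus: "z \<noteq> 0 \<Longrightarrow> K (- z) = K z"
  by (simp add: radial)

lemma tail_bounds:
  obtains C where "C > 0"
    "\<And>r. r > 0 \<Longrightarrow> (\<integral>\<^sup>+z. indicator {z. r \<le> norm z} z * ennreal (K z) \<partial>lborel) \<le> ennreal (C * r powr (- 2 * \<gamma>))"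
    "\<And>r. r > 0 \<Longrightarrow> (\<integral>\<^sup>+z. indicator {z. norm z \<le> r} z * ennreal ((norm z)\<^sup>2 * K z) \<partial>lborel)
      \<le> ennreal (C * r powr (2 - 2 * \<gamma>))"
proof -
  let ?R = "\<lambda>z :: (real^'m) \<times> (real^'m). norm z powr (- real DIM((real^'m) \<times> (real^'m)) - 2 * \<gamma>)"
  obtain C where C: "C > 0"
    "\<And>r. r > 0 \<Longrightarrow> (\<integral>\<^sup>+z. indicator {z. r \<le> norm z} z * ennreal (?R z) \<partial>lborel) \<le> ennreal (C * r powr (- 2 * \<gamma>))"
    "\<And>r. r > 0 \<Longrightarrow> (\<integral>\<^sup>+z. indicator {z. norm z \<le> r} z * ennreal ((norm z)\<^sup>2 * ?R z) \<partial>lborel)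
      \<le> ennreal (C * r powr (2 - 2 * \<gamma>))"
    using riesz_tail_bounds[OF \<gamma>, where 'a = "(real^'m) \<times> (real^'m)"] by blast
  show thesis
  proof (rule that[of "\<kappa>2 * C"])
    show "\<kappa>2 * C > 0" using \<kappa>2 C by simp
    fix r :: real assume r: "r > 0"
    have "(\<integral>\<^sup>+z. indicator {z. r \<le> norm z} z * ennreal (K z) \<partial>lborel)
      \<le> (\<integral>\<^sup>+z. ennreal \<kappa>2 * (indicator {z. r \<le> norm z} z * ennreal (?R z)) \<partial>lborel)"
    proof (rule nn_integral_mono)
      fix z :: "(real^'m) \<times> (real^'m)"
      show "indicator {z. r \<le> norm z} z * ennreal (K z) \<le> ennreal \<kappa>2 * (indicator {z. r \<le> norm z} z * ennreal (?R z))"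
      proof (cases "r \<le> norm z")
        case True
        then have "z \<noteq> 0" using r by auto
        then show ?thesis
          using True \<kappa>2 ennreal_leI[OF upper[of z]] by (simp add: ennreal_mult)
      qed simp
    qed
    also have "\<dots> = ennreal \<kappa>2 * (\<integral>\<^sup>+z. indicator {z. r \<le> norm z} z * ennreal (?R z) \<partial>lborel)"
      by (rule nn_integral_cmult) measurable
    also have "\<dots> \<le> ennreal \<kappa>2 * ennreal (C * r powr (- 2 * \<gamma>))"
      by (intro mult_left_mono C r) auto
    finally show "(\<integral>\<^sup>+z. indicator {z. r \<le> norm z} z * ennreal (K z) \<partial>lborel)
      \<le> ennreal (\<kappa>2 * C * r powr (- 2 * \<gamma>))"
      using C \<kappa>2 by (simp add: ennreal_mult[symmetric] mult.assoc)
  next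
    fix r :: real assume r: "r > 0"
    have "(\<integral>\<^sup>+z. indicator {z. norm z \<le> r} z * ennreal ((norm z)\<^sup>2 * K z) \<partial>lborel)
      \<le> (\<integral>\<^sup>+z. ennreal \<kappa>2 * (indicator {z. norm z \<le> r} z * ennreal ((norm z)\<^sup>2 * ?R z)) \<partial>lborel)"
    proof (rule nn_integral_mono)
      fix z :: "(real^'m) \<times> (real^'m)"
      have "(norm z)\<^sup>2 * K z \<le> \<kappa>2 * ((norm z)\<^sup>2 * ?R z)"
        using mult_left_mono[OF upper[of z], of "(norm z)\<^sup>2"] by (cases "z = 0") (auto simp: ac_simps)
      then have "ennreal ((norm z)\<^sup>2 * K z) \<le> ennreal \<kappa>2 * ennreal ((norm z)\<^sup>2 * ?R z)"
        using \<kappa>2 by (subst ennreal_mult[symmetric]) (auto intro: ennreal_leI)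
      then show "indicator {z. norm z \<le> r} z * ennreal ((norm z)\<^sup>2 * K z)
        \<le> ennreal \<kappa>2 * (indicator {z. norm z \<le> r} z * ennreal ((norm z)\<^sup>2 * ?R z))"
        by (cases "norm z \<le> r") simp_all
    qed
    also have "\<dots> = ennreal \<kappa>2 * (\<integral>\<^sup>+z. indicator {z. norm z \<le> r} z * ennreal ((norm z)\<^sup>2 * ?R z) \<partial>lborel)"
      by (rule nn_integral_cmult) measurable
    also have "\<dots> \<le> ennreal \<kappa>2 * ennreal (C * r powr (2 - 2 * \<gamma>))"
      by (intro mult_left_mono C r) auto
    finally show "(\<integral>\<^sup>+z. indicator {z. norm z \<le> r} z * ennreal ((norm z)\<^sup>2 * K z) \<partial>lborel)
      \<le> ennreal (\<kappa>2 * C * r powr (2 - 2 * \<gamma>))"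
      using C \<kappa>2 by (simp add: ennreal_mult[symmetric] mult.assoc)
  qed
qed

lemma K_diff_measurable_lebesgue [measurable]: "(\<lambda>y. K (x - y)) \<in> borel_measurable lebesgue"
  by (rule measurable_completion) measurable

lemma truncated_set_lebesgue [measurable]:
  fixes x :: "(real^'m) \<times> (real^'m)"
  shows "{y. \<epsilon> < norm (x - y)} \<in> sets lebesgue"
proof -
  have "{y. \<epsilon> < norm (x - y)} \<in> sets borel" by measurable
  then show ?thesis by simp
qed

lemma nn_integral_diff_eq:
  fixes x :: "(real^'m) \<times> (real^'m)"
  assumes [measurable]: "h \<in> borel_measurable borel"
  shows "(\<integral>\<^sup>+y. h (x - y) \<partial>lebesgue) = (\<integral>\<^sup>+y. h y \<partial>lborel)"
  by (simp add: nn_integral_completion nn_integral_lborel_reflect)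

lemma set_integrable_K:
  assumes "\<epsilon> > 0"
  shows "set_integrable lebesgue {y. \<epsilon> < norm (x - y)} (\<lambda>y. K (x - y))"
  unfolding set_integrable_def
proof (rule integrableI_bounded)
  show "(\<lambda>y. indicator {y. \<epsilon> < norm (x - y)} y *\<^sub>R K (x - y)) \<in> borel_measurable lebesgue"
    by (intro measurable_completion) measurable
  obtain C where "C > 0" and C: "\<And>r. r > 0 \<Longrightarrow> (\<integral>\<^sup>+z. indicator {z. r \<le> norm z} z * ennreal (K z) \<partial>lborel) \<le> ennreal (C * r powr (- 2 * \<gamma>))"
    and "\<And>r. r > 0 \<Longrightarrow> (\<integral>\<^sup>+z. indicator {z. norm z \<le> r} z * ennreal ((norm z)\<^sup>2 * K z) \<partial>lborel)
      \<le> ennreal (C * r powr (2 - 2 * \<gamma>))"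
    by (rule tail_bounds) blast
  have "(\<integral>\<^sup>+y. ennreal (norm (indicator {y. \<epsilon> < norm (x - y)} y *\<^sub>R K (x - y))) \<partial>lebesgue)
    \<le> (\<integral>\<^sup>+y. indicator {z. \<epsilon> \<le> norm z} (x - y) * ennreal (K (x - y)) \<partial>lebesgue)"
  proof (rule nn_integral_mono)
    fix y
    show "ennreal (norm (indicator {y. \<epsilon> < norm (x - y)} y *\<^sub>R K (x - y)))
      \<le> indicator {z. \<epsilon> \<le> norm z} (x - y) * ennreal (K (x - y))"
      using assms nonneg[of "x - y"] by (cases "x = y"; cases "\<epsilon> < norm (x - y)") auto
  qed
  also have "\<dots> = (\<integral>\<^sup>+z. indicator {z. \<epsilon> \<le> norm z} z * ennreal (K z) \<partial>lborel)"
    by (rule nn_integral_diff_eq) measurable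
  also have "\<dots> \<le> ennreal (C * \<epsilon> powr (- 2 * \<gamma>))" by (rule C) fact
  also have "\<dots> < \<infinity>" by simp
  finally show "(\<integral>\<^sup>+y. ennreal (norm (indicator {y. \<epsilon> < norm (x - y)} y *\<^sub>R K (x - y))) \<partial>lebesgue) < \<infinity>" .
qed

lemma set_integrable_bounded_times_K:
  fixes h :: "(real^'m) \<times> (real^'m) \<Rightarrow> real"
  assumes \<epsilon>: "\<epsilon> > 0" and [measurable]: "h \<in> borel_measurable lebesgue" and B: "\<And>y. \<bar>h y\<bar> \<le> B"
  shows "set_integrable lebesgue {y. \<epsilon> < norm (x - y)} (\<lambda>y. h y * K (x - y))"
proof -
  have "set_integrable lebesgue {y. \<epsilon> < norm (x - y)} (\<lambda>y. B * K (x - y))"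
    by (intro set_integrable_mult_right set_integrable_K \<epsilon>)
  then show ?thesis
    unfolding set_integrable_def
  proof (rule Bochner_Integration.integrable_bound)
    show "AE y in lebesgue. norm (indicator {y. \<epsilon> < norm (x - y)} y *\<^sub>R (h y * K (x - y)))
      \<le> norm (indicator {y. \<epsilon> < norm (x - y)} y *\<^sub>R (B * K (x - y)))"
    proof (rule AE_I2)
      fix y
      have "\<bar>h y\<bar> \<le> \<bar>B\<bar>" using B[of y] by linarith
      then show "norm (indicator {y. \<epsilon> < norm (x - y)} y *\<^sub>R (h y * K (x - y)))
        \<le> norm (indicator {y. \<epsilon> < norm (x - y)} y *\<^sub>R (B * K (x - y)))"
        by (auto simp: indicator_def abs_mult intro!: mult_right_mono)
    qed
  qed measurable
qed

text \<open>A touching argument without regularity: for an odd, doubly radial function that is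
  nonnegative in \<open>cone_side\<close> the truncated integrals have nonnegative limit inferior, since the
  positive part increases by monotone convergence to something that dominates the reflected part.\<close>

lemma truncated_integral_lower:
  fixes W :: "(real^'m) \<times> (real^'m) \<Rightarrow> real"
  assumes x: "x \<in> cone_side" and W[measurable]: "W \<in> borel_measurable lebesgue"
    and dr: "doubly_radial W" and odd: "cone_odd W" and pos: "\<And>y. y \<in> cone_side \<Longrightarrow> 0 \<le> W y"
    and int: "\<And>\<epsilon>. \<epsilon> > 0 \<Longrightarrow> set_integrable lebesgue {y. \<epsilon> < norm (x - y)} (\<lambda>y. W y * K (x - y))"
    and e: "e > 0"
  shows "\<forall>\<^sub>F \<epsilon> in at_right 0. - e \<le> (LINT y:{y. \<epsilon> < norm (x - y)}|lebesgue. W y * K (x - y))"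
proof -
  define d where "d = cone_gap x / 2"
  have d: "d > 0" using x by (simp add: d_def cone_side_iff)
  have side: "y \<in> cone_side" if "norm (x - y) < d" for y
    using cone_gap_diff_le[of x y] that by (auto simp: d_def cone_side_iff)
  have O[measurable]: "cone_side \<in> sets (borel :: ((real^'m) \<times> (real^'m)) measure)"
    by (rule cone_side_borel)
  then have [measurable]: "cone_side \<in> sets (lebesgue :: ((real^'m) \<times> (real^'m)) measure)" by simp
  \<comment> \<open>\<open>P\<close> is the positive part of \<open>W\<close>, since oddness makes
    \<open>W\<close> nonpositive off \<open>cone_side\<close>. \<open>a \<epsilon>\<close>
    integrates \<open>P\<close> against the truncated kernel; \<open>b\<close> integrates it against
    the reflected kernel and so represents the negative part.\<close>
  define P where "P y = ennreal (W y) * indicator cone_side y" for y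
  have P[measurable]: "P \<in> borel_measurable lebesgue" unfolding P_def by measurable
  define a where "a \<epsilon> = (\<integral>\<^sup>+y. indicator {y. \<epsilon> < norm (x - y)} y * (P y * ennreal (K (x - y))) \<partial>lebesgue)" for \<epsilon>
  define b where "b = (\<integral>\<^sup>+y. P y * ennreal (K (x - prod.swap y)) \<partial>lebesgue)"
  have swapK [measurable]: "(\<lambda>y. ennreal (K (x - prod.swap y))) \<in> borel_measurable lebesgue"
  proof (rule measurable_completion)
    have [measurable]: "prod.swap \<in> borel_measurable (borel :: ((real^'m) \<times> (real^'m)) measure)"
      by (rule measure_preserving_map_measurable measure_preserving_map_swap)+
    show "(\<lambda>y. ennreal (K (x - prod.swap y))) \<in> borel_measurable lborel" by measurable
  qed
  have b_eq: "b = (\<integral>\<^sup>+y. P (prod.swap y) * ennreal (K (x - y)) \<partial>lebesgue)"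
    unfolding b_def
    using nn_integral_lebesgue_measure_preserving_map[OF measure_preserving_map_swap,
        of "\<lambda>y. P y * ennreal (K (x - prod.swap y))"] by simp
  have cone0: "W y = 0" if "cone_gap y = 0" for y
    using cone_odd_doubly_radial_zero[OF odd dr that] .
  have Wswap: "W (prod.swap y) = - W y" for y
  proof -
    have "W y = - W (prod.swap y)" using odd unfolding cone_odd_def by (rule spec)
    then show ?thesis by simp
  qed
  have plus: "ennreal (indicator {y. \<epsilon> < norm (x - y)} y *\<^sub>R (W y * K (x - y)))
      = indicator {y. \<epsilon> < norm (x - y)} y * (P y * ennreal (K (x - y)))" if "\<epsilon> > 0" for \<epsilon> y
  proof (cases "\<epsilon> < norm (x - y)")
    case True
    then have K: "0 \<le> K (x - y)" using that by (intro nonneg) auto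
    show ?thesis
    proof (cases "y \<in> cone_side")
      case False
      then have "W y \<le> 0"
        using pos[of "prod.swap y"] cone0[of y] Wswap[of y]
        by (cases "cone_gap y = 0") (auto simp: cone_side_iff cone_gap_swap)
      then show ?thesis using False K True by (simp add: P_def mult_nonpos_nonneg ennreal_neg)
    qed (use True K in \<open>simp add: P_def pos ennreal_mult\<close>)
  qed simp
  \<comment> \<open>For \<epsilon> < d the removed ball lies inside \<open>cone_side\<close>, so the
    truncation does not touch the negative part and \<open>b\<close> is independent of
    \<epsilon>.\<close>
  have minus: "ennreal (- (indicator {y. \<epsilon> < norm (x - y)} y *\<^sub>R (W y * K (x - y))))
      = P (prod.swap y) * ennreal (K (x - y))" if "\<epsilon> > 0" "\<epsilon> < d" for \<epsilon> y
  proof (cases "prod.swap y \<in> cone_side")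
    case True
    then have "y \<notin> cone_side" by (simp add: cone_side_iff cone_gap_swap)
    then have "\<not> norm (x - y) < d" using side by blast
    then have far: "\<epsilon> < norm (x - y)" using that by linarith
    then have K: "0 \<le> K (x - y)" using that by (intro nonneg) auto
    have "0 \<le> - W y" using pos[OF True] Wswap[of y] by simp
    then show ?thesis
      using True far K by (simp add: P_def Wswap ennreal_mult[symmetric])
  next
    case False
    have "0 \<le> W y"
      using pos[of y] cone0[of y] False
      by (cases "cone_gap y = 0") (auto simp: cone_side_iff cone_gap_swap)
    moreover have "0 \<le> K (x - y)" if "\<epsilon> < norm (x - y)" using \<open>\<epsilon> > 0\<close> that by (intro nonneg) auto
    ultimately show ?thesis using False by (auto simp: P_def indicator_def ennreal_neg)
  qed
  have val: "(LINT y:{y. \<epsilon> < norm (x - y)}|lebesgue. W y * K (x - y)) = enn2real (a \<epsilon>) - enn2real b"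
    and fin: "a \<epsilon> < \<infinity>" "b < \<infinity>" if "\<epsilon> > 0" "\<epsilon> < d" for \<epsilon>
  proof -
    note i = int[OF that(1), unfolded set_integrable_def]
    show "(LINT y:{y. \<epsilon> < norm (x - y)}|lebesgue. W y * K (x - y)) = enn2real (a \<epsilon>) - enn2real b"
      unfolding set_lebesgue_integral_def real_lebesgue_integral_def[OF i] plus[OF that(1)] minus[OF that]
      by (simp add: a_def b_eq)
    show "a \<epsilon> < \<infinity>"
      using i unfolding real_integrable_def plus[OF that(1)] by (simp add: a_def less_top)
    show "b < \<infinity>"
      using i unfolding real_integrable_def minus[OF that] by (simp add: b_eq less_top)
  qed
  have anti: "a \<epsilon>' \<le> a \<epsilon>" if "\<epsilon> \<le> \<epsilon>'" for \<epsilon> \<epsilon>'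
    unfolding a_def using that by (intro nn_integral_mono mult_right_mono) (auto simp: indicator_def)
  \<comment> \<open>The untruncated positive part may be infinite; the comparison is made in
    \<open>ennreal\<close> and handed to the truncations by monotone convergence.\<close>
  have "b \<le> (\<integral>\<^sup>+y. P y * ennreal (K (x - y)) \<partial>lebesgue)"
    unfolding b_def
  proof (rule reflected_integral_le[OF x P])
    fix y z :: "(real^'m) \<times> (real^'m)"
    assume n: "norm (fst y) = norm (fst z)" "norm (snd y) = norm (snd z)"
    then have "W y = W z" using dr unfolding doubly_radial_def by blast
    moreover have "y \<in> cone_side \<longleftrightarrow> z \<in> cone_side" using n by (simp add: cone_side_iff cone_gap_def)
    ultimately show "P y = P z" by (simp add: P_def indicator_def)
  qed (simp add: P_def)
  also have "\<dots> = (\<integral>\<^sup>+y. (SUP n. indicator {y. 1 / real (Suc n) < norm (x - y)} y * (P y * ennreal (K (x - y)))) \<partial>lebesgue)"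
  proof (rule nn_integral_cong_AE)
    have "AE y in lebesgue. y \<noteq> x"
      by (rule AE_completion) (rule AE_lborel_singleton)
    then show "AE y in lebesgue. P y * ennreal (K (x - y))
      = (SUP n. indicator {y. 1 / real (Suc n) < norm (x - y)} y * (P y * ennreal (K (x - y))))"
    proof eventually_elim
      case (elim y)
      then obtain n where n: "1 / real (Suc n) < norm (x - y)"
        by (metis nat_approx_posE right_minus_eq zero_less_norm_iff)
      show ?case
      proof (rule antisym)
        show "P y * ennreal (K (x - y)) \<le> (SUP n. indicator {y. 1 / real (Suc n) < norm (x - y)} y * (P y * ennreal (K (x - y))))"
          using n by (intro SUP_upper2[of n]) auto
        show "(SUP n. indicator {y. 1 / real (Suc n) < norm (x - y)} y * (P y * ennreal (K (x - y)))) \<le> P y * ennreal (K (x - y))"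
          by (intro SUP_least) (auto simp: indicator_def)
      qed
    qed
  qed
  also have "\<dots> = (SUP n. a (1 / real (Suc n)))"
    unfolding a_def
  proof (rule nn_integral_monotone_convergence_SUP)
    have "1 / real (Suc n) \<le> 1 / real (Suc m)" if "m \<le> n" for m n :: nat
      using that by (simp add: field_simps)
    then show "incseq (\<lambda>n y. indicator {y. 1 / real (Suc n) < norm (x - y)} y * (P y * ennreal (K (x - y))))"
      by (auto simp: incseq_def le_fun_def indicator_def) (meson le_less_trans)
  qed measurable
  finally have b_le: "b \<le> (SUP n. a (1 / real (Suc n)))" .
  show ?thesis
  \<comment> \<open>\<open>ennreal\<close> sends negative numbers to 0, so a level strictly below
    \<open>b\<close> is formed only when \<open>enn2real b - e\<close> is positive; otherwise
    nonnegativity of \<open>a\<close> is enough.\<close>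
  proof (cases "enn2real b \<le> e")
    case True
    have "\<forall>\<^sub>F \<epsilon> in at_right 0. \<epsilon> \<in> {0<..<d}" using d by (rule eventually_at_right_real)
    then show ?thesis
    proof eventually_elim
      case (elim \<epsilon>)
      then have v: "(LINT y:{y. \<epsilon> < norm (x - y)}|lebesgue. W y * K (x - y)) = enn2real (a \<epsilon>) - enn2real b"
        by (intro val) auto
      show ?case unfolding v using True enn2real_nonneg[of "a \<epsilon>"] by linarith
    qed
  next
    case False
    have "b < \<infinity>" using fin(2)[of "d / 2"] d by simp
    then have "ennreal (enn2real b - e) < b"
      using False e by (cases b) (auto simp: ennreal_less_iff)
    then have "ennreal (enn2real b - e) < (SUP n. a (1 / real (Suc n)))"
      using b_le by (rule less_le_trans)
    then obtain n where n: "ennreal (enn2real b - e) < a (1 / real (Suc n))"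
      unfolding less_SUP_iff by blast
    have "\<forall>\<^sub>F \<epsilon> in at_right 0. \<epsilon> \<in> {0<..<min d (1 / real (Suc n))}"
      using d by (intro eventually_at_right_real) auto
    then show ?thesis
    proof eventually_elim
      case (elim \<epsilon>)
      then have "ennreal (enn2real b - e) < a \<epsilon>"
        using n anti[of \<epsilon> "1 / real (Suc n)"] by (auto intro: less_le_trans)
      then have "enn2real b - e < enn2real (a \<epsilon>)"
        using fin(1)[of \<epsilon>] elim False by (cases "a \<epsilon>") (auto simp: ennreal_less_iff)
      then show ?case using val[of \<epsilon>] elim by simp
    qed
  qed
qed

end

section \<open>Truncated integrals of bumps and masses of balls\<close>

lemma measure_preserving_map_reflect: "measure_preserving_map (\<lambda>y. t - y :: 'a::euclidean_space)"
  by (rule measure_preserving_mapI) (auto simp: nn_integral_lborel_reflect)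

lemma integral_measure_preserving_map:
  fixes h :: "'a::euclidean_space \<Rightarrow> real"
  assumes "measure_preserving_map S" and [measurable]: "h \<in> borel_measurable borel"
  shows "(\<integral>y. h (S y) \<partial>lebesgue) = (\<integral>y. h y \<partial>lebesgue)"
proof -
  from assms have [measurable]: "S \<in> borel_measurable borel" and d: "distr lborel borel S = lborel"
    by (auto simp: measure_preserving_map_def)
  have "(\<integral>y. h y \<partial>lborel) = (\<integral>y. h y \<partial>distr lborel borel S)" unfolding d ..
  also have "\<dots> = (\<integral>y. h (S y) \<partial>lborel)" by (rule integral_distr) auto
  finally show ?thesis by (simp add: integral_completion)
qed

lemma set_integrable_lebesgue_subset:
  "set_integrable lebesgue B g \<Longrightarrow> A \<in> sets borel \<Longrightarrow> A \<subseteq> B \<Longrightarrow> set_integrable lebesgue A (g :: 'a::euclidean_space \<Rightarrow> real)"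
  by (erule set_integrable_subset) auto

text \<open>A truncated paraboloid: its kink at the rim is convex, so truncation can only lower the
  operator at points where the bump is positive.\<close>

definition bump :: "'a::real_normed_vector \<Rightarrow> real \<Rightarrow> 'a \<Rightarrow> real" where
  "bump p \<rho> y = max 0 (1 - (norm (y - p) / \<rho>)\<^sup>2)"

lemma bump_nonneg: "0 \<le> bump p \<rho> y" and bump_le_1: "bump p \<rho> y \<le> 1" and bump_center: "bump p \<rho> p = 1"
  by (auto simp: bump_def)

lemma continuous_on_bump: "continuous_on S (bump p \<rho>)"
  unfolding bump_def by (cases "\<rho> = 0") (auto intro!: continuous_intros)

lemma bump_measurable [measurable]: "bump p \<rho> \<in> borel_measurable (borel :: 'a::euclidean_space measure)"
  by (intro borel_measurable_continuous_onI continuous_on_bump)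

lemma bump_pos_iff:
  assumes "\<rho> > 0"
  shows "0 < bump p \<rho> y \<longleftrightarrow> y \<in> ball p \<rho>"
proof -
  have "(norm (y - p) / \<rho>)\<^sup>2 < 1 \<longleftrightarrow> norm (y - p) < \<rho>"
    using assms abs_square_less_1[of "norm (y - p) / \<rho>"] by simp
  then show ?thesis by (auto simp: bump_def dist_norm norm_minus_commute less_max_iff_disj)
qed

text \<open>The bump dominates the quadratic \<open>1 - |y - p|\<^sup>2/\<rho>\<^sup>2\<close>, with equality where it is positive; the
  second difference of the quadratic is constant.\<close>

lemma bump_second_difference:
  fixes x :: "'a::real_inner"
  assumes "\<rho> > 0" "0 < bump p \<rho> x"
  shows "bump p \<rho> x - (bump p \<rho> y + bump p \<rho> (2 *\<^sub>R x - y)) / 2 \<le> min ((norm (x - y) / \<rho>)\<^sup>2) (bump p \<rho> x)"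
proof -
  have x: "bump p \<rho> x = 1 - (norm (x - p) / \<rho>)\<^sup>2" using assms by (auto simp: bump_def)
  have "(norm (y - p))\<^sup>2 + (norm (2 *\<^sub>R x - y - p))\<^sup>2 = 2 * (norm (x - p))\<^sup>2 + 2 * (norm (x - y))\<^sup>2"
    by (simp add: power2_norm_eq_inner inner_diff inner_commute algebra_simps)
  then have "(norm (y - p) / \<rho>)\<^sup>2 + (norm (2 *\<^sub>R x - y - p) / \<rho>)\<^sup>2
      = 2 * (norm (x - p) / \<rho>)\<^sup>2 + 2 * (norm (x - y) / \<rho>)\<^sup>2"
    unfolding power_divide by (simp add: add_divide_distrib[symmetric])
  moreover have "1 - (norm (z - p) / \<rho>)\<^sup>2 \<le> bump p \<rho> z" for z by (simp add: bump_def)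
  note this[of y] this[of "2 *\<^sub>R x - y"]
  ultimately have "bump p \<rho> x - (bump p \<rho> y + bump p \<rho> (2 *\<^sub>R x - y)) / 2 \<le> (norm (x - y) / \<rho>)\<^sup>2"
    unfolding x by argo
  moreover have "bump p \<rho> x - (bump p \<rho> y + bump p \<rho> (2 *\<^sub>R x - y)) / 2 \<le> bump p \<rho> x"
    using bump_nonneg[of p \<rho> y] bump_nonneg[of p \<rho> "2 *\<^sub>R x - y"] by argo
  ultimately show ?thesis by simp
qed

context stable_kernel
begin

definition kernel_mass :: "((real^'m) \<times> (real^'m)) set \<Rightarrow> (real^'m) \<times> (real^'m) \<Rightarrow> real" where
  "kernel_mass A x = (LINT y:A|lebesgue. K (x - y))"

definition truncated :: "((real^'m) \<times> (real^'m) \<Rightarrow> real) \<Rightarrow> (real^'m) \<times> (real^'m) \<Rightarrow> real \<Rightarrow> real" where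
  "truncated w x \<epsilon> = (LINT y:{y. \<epsilon> < norm (x - y)}|lebesgue. (w x - w y) * K (x - y))"

lemma set_integrable_kernel_mass:
  assumes "A \<in> sets borel" "r > 0" "\<And>y. y \<in> A \<Longrightarrow> r \<le> norm (x - y)"
  shows "set_integrable lebesgue A (\<lambda>y. K (x - y))"
proof (rule set_integrable_lebesgue_subset)
  show "set_integrable lebesgue {y. r / 2 < norm (x - y)} (\<lambda>y. K (x - y))"
    using assms by (intro set_integrable_K) auto
  show "A \<subseteq> {y. r / 2 < norm (x - y)}" using assms by fastforce
qed fact

lemma kernel_mass_eq_truncated:
  assumes "\<And>y. y \<in> A \<Longrightarrow> \<epsilon> < norm (x - y)"
  shows "(LINT y:{y. \<epsilon> < norm (x - y)}|lebesgue. indicator A y * K (x - y)) = kernel_mass A x"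
  unfolding kernel_mass_def set_lebesgue_integral_def
  using assms by (intro Bochner_Integration.integral_cong) (auto simp: indicator_def)

lemma kernel_mass_eq_nn_integral:
  assumes "x \<notin> A" "A \<in> sets borel"
  shows "kernel_mass A x = enn2real (\<integral>\<^sup>+y. indicator A y * ennreal (K (x - y)) \<partial>lebesgue)"
proof -
  have [measurable]: "A \<in> sets borel" by fact
  have nn: "0 \<le> indicator A y *\<^sub>R K (x - y)" for y
    using assms nonneg[of "x - y"] by (auto simp: indicator_def)
  have "(\<lambda>y. indicator A y *\<^sub>R K (x - y)) \<in> borel_measurable lebesgue"
    by (intro measurable_completion) measurable
  then have "kernel_mass A x = enn2real (\<integral>\<^sup>+y. ennreal (indicator A y *\<^sub>R K (x - y)) \<partial>lebesgue)"
    unfolding kernel_mass_def set_lebesgue_integral_def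
    using nn by (intro integral_eq_nn_integral) auto
  also have "(\<integral>\<^sup>+y. ennreal (indicator A y *\<^sub>R K (x - y)) \<partial>lebesgue) = (\<integral>\<^sup>+y. indicator A y * ennreal (K (x - y)) \<partial>lebesgue)"
    by (intro nn_integral_cong) (simp add: indicator_def)
  finally show ?thesis .
qed

lemma kernel_mass_mono:
  assumes A: "A \<in> sets borel" "B \<in> sets borel" "A \<subseteq> B" and r: "r > 0" "\<And>y. y \<in> B \<Longrightarrow> r \<le> norm (x - y)"
  shows "kernel_mass A x \<le> kernel_mass B x"
  unfolding kernel_mass_def
  set_lebesgue_integral_def
proof (rule integral_mono_AE)
  show "integrable lebesgue (\<lambda>y. indicator A y *\<^sub>R K (x - y))" "integrable lebesgue (\<lambda>y. indicator B y *\<^sub>R K (x - y))"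
    using A r set_integrable_kernel_mass[of A r x] set_integrable_kernel_mass[of B r x]
    by (auto simp: set_integrable_def)
  have "AE y in lebesgue. y \<noteq> x"
    by (rule AE_completion) (rule AE_lborel_singleton)
  then show "AE y in lebesgue. indicator A y *\<^sub>R K (x - y) \<le> indicator B y *\<^sub>R K (x - y)"
  proof eventually_elim
    case (elim y)
    then show ?case using nonneg[of "x - y"] A(3) by (auto simp: indicator_def)
  qed
qed

lemma kernel_mass_upper:
  obtains C where "C > 0" "\<And>A r x. A \<in> sets borel \<Longrightarrow> r > 0 \<Longrightarrow> (\<And>y. y \<in> A \<Longrightarrow> r \<le> norm (x - y)) \<Longrightarrow>
    kernel_mass A x \<le> C * r powr (- 2 * \<gamma>)"
proof -
  obtain C where C0: "C > 0" and C: "\<And>r. r > 0 \<Longrightarrow> (\<integral>\<^sup>+z. indicator {z. r \<le> norm z} z * ennreal (K z) \<partial>lborel) \<le> ennreal (C * r powr (- 2 * \<gamma>))"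
    and "\<And>r. r > 0 \<Longrightarrow> (\<integral>\<^sup>+z. indicator {z. norm z \<le> r} z * ennreal ((norm z)\<^sup>2 * K z) \<partial>lborel)
      \<le> ennreal (C * r powr (2 - 2 * \<gamma>))"
    by (rule tail_bounds) blast
  show thesis
  proof (rule that[OF C0])
    fix A and r :: real and x :: "(real^'m) \<times> (real^'m)" assume A: "A \<in> sets borel" and r: "r > 0" "\<And>y. y \<in> A \<Longrightarrow> r \<le> norm (x - y)"
    have "x \<notin> A" using r by fastforce
    have "(\<integral>\<^sup>+y. indicator A y * ennreal (K (x - y)) \<partial>lebesgue)
      \<le> (\<integral>\<^sup>+y. indicator {z. r \<le> norm z} (x - y) * ennreal (K (x - y)) \<partial>lebesgue)"
    proof (rule nn_integral_mono)
      fix y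
      show "indicator A y * ennreal (K (x - y)) \<le> indicator {z. r \<le> norm z} (x - y) * ennreal (K (x - y))"
        using r(2)[of y] by (cases "y \<in> A") simp_all
    qed
    also have "\<dots> = (\<integral>\<^sup>+z. indicator {z. r \<le> norm z} z * ennreal (K z) \<partial>lborel)"
      by (rule nn_integral_diff_eq) measurable
    also have "\<dots> \<le> ennreal (C * r powr (- 2 * \<gamma>))" by (rule C) fact
    finally show "kernel_mass A x \<le> C * r powr (- 2 * \<gamma>)"
      unfolding kernel_mass_eq_nn_integral[OF \<open>x \<notin> A\<close> A] using C0
      by (intro enn2real_leI) auto
  qed
qed

text \<open>Within distance Nr the kernel is at least \<kappa>1 (Nr)^(-n - 2\<gamma>), and a ball of
  radius r has r^n times the volume of the unit ball; this is the product of both with the factor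
  r^(-2\<gamma>) removed.\<close>

definition ball_mass_const :: "real \<Rightarrow> real" where
  "ball_mass_const N = \<kappa>1 * N powr (- real DIM((real^'m) \<times> (real^'m)) - 2 * \<gamma>) * unit_ball_vol (real DIM((real^'m) \<times> (real^'m)))"

lemma ball_mass_const_pos: "N > 0 \<Longrightarrow> 0 < ball_mass_const N"
  using \<kappa>1 by (simp add: ball_mass_const_def)

lemma kernel_mass_ball_lower:
  assumes r: "r > 0" and N: "N > 0" and \<delta>: "\<delta> > 0" and y: "\<And>y. y \<in> ball c r \<Longrightarrow> \<delta> \<le> norm (x - y) \<and> norm (x - y) \<le> N * r"
  shows "ball_mass_const N * r powr (- 2 * \<gamma>) \<le> kernel_mass (ball c r) x"
proof -
  let ?n = "real DIM((real^'m) \<times> (real^'m))"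
  let ?L = "\<kappa>1 * (N * r) powr (- ?n - 2 * \<gamma>)"
  have "(N * r) powr (- ?n - 2 * \<gamma>) * r ^ DIM((real^'m) \<times> (real^'m)) = N powr (- ?n - 2 * \<gamma>) * r powr (- 2 * \<gamma>)"
    using r N by (simp add: powr_mult powr_realpow[symmetric] powr_add[symmetric])
  then have "ball_mass_const N * r powr (- 2 * \<gamma>) = ?L * measure lebesgue (ball c r)"
    using r by (simp add: ball_mass_const_def content_ball ac_simps)
  also have "\<dots> = (LINT y:ball c r|lebesgue. ?L)"
    by (simp add: set_lebesgue_integral_def mult.commute)
  also have "\<dots> \<le> kernel_mass (ball c r) x"
    unfolding kernel_mass_def
  proof (rule set_integral_mono)
    show "set_integrable lebesgue (ball c r) (\<lambda>y. ?L)"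
      unfolding set_integrable_def
      by (intro integrable_scaleR_left lmeasurable_iff_integrable[THEN iffD1, OF lmeasurable_ball])
    show "set_integrable lebesgue (ball c r) (\<lambda>y. K (x - y))"
      using \<delta> y by (intro set_integrable_kernel_mass[of _ \<delta>]) auto
    fix y assume yb: "y \<in> ball c r"
    then have "x - y \<noteq> 0" "0 < norm (x - y)" "norm (x - y) \<le> N * r" using y[OF yb] \<delta> by auto
    then have "(N * r) powr (- ?n - 2 * \<gamma>) \<le> norm (x - y) powr (- ?n - 2 * \<gamma>)"
      using \<gamma> by (intro powr_mono2') auto
    then have "?L \<le> \<kappa>1 * norm (x - y) powr (- ?n - 2 * \<gamma>)" using \<kappa>1 by simp
    also have "\<dots> \<le> K (x - y)" by (rule lower) fact
    finally show "?L \<le> K (x - y)" .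
  qed
  finally show ?thesis .
qed

text \<open>The two arguments of \<open>min\<close> coincide at norm z = \<rho> sqrt q. Inside that
  radius the quadratic is used, outside it the constant q, and each part contributes C
  \<rho>^(-2\<gamma>) q^(1 - \<gamma>). The positive power of q makes the bound small where a bump
  is small.\<close>

lemma quadratic_integral_bound:
  obtains C where "C > 0" "\<And>\<rho> q. \<rho> > 0 \<Longrightarrow> q > 0 \<Longrightarrow>
    (\<integral>\<^sup>+z. ennreal (min ((norm z / \<rho>)\<^sup>2) q * K z) \<partial>lborel) \<le> ennreal (C * (\<rho> powr (- 2 * \<gamma>) * q powr (1 - \<gamma>)))"
proof -
  obtain C where C0: "C > 0" and C1: "\<And>r. r > 0 \<Longrightarrow> (\<integral>\<^sup>+z. indicator {z. r \<le> norm z} z * ennreal (K z) \<partial>lborel) \<le> ennreal (C * r powr (- 2 * \<gamma>))"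
    and C2: "\<And>r. r > 0 \<Longrightarrow> (\<integral>\<^sup>+z. indicator {z. norm z \<le> r} z * ennreal ((norm z)\<^sup>2 * K z) \<partial>lborel)
      \<le> ennreal (C * r powr (2 - 2 * \<gamma>))"
    by (rule tail_bounds) blast
  show thesis
  proof (rule that[of "2 * C"])
    fix \<rho> q :: real assume \<rho>: "\<rho> > 0" and q: "q > 0"
    define r where "r = \<rho> * sqrt q"
    have r: "r > 0" using \<rho> q by (simp add: r_def)
    have "(\<integral>\<^sup>+z. ennreal (min ((norm z / \<rho>)\<^sup>2) q * K z) \<partial>lborel)
      \<le> (\<integral>\<^sup>+z. ennreal (1 / \<rho>\<^sup>2) * (indicator {z. norm z \<le> r} z * ennreal ((norm z)\<^sup>2 * K z))
          + ennreal q * (indicator {z. r \<le> norm z} z * ennreal (K z)) \<partial>lborel)"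
    proof (rule nn_integral_mono)
      fix z
      show "ennreal (min ((norm z / \<rho>)\<^sup>2) q * K z) \<le> ennreal (1 / \<rho>\<^sup>2) * (indicator {z. norm z \<le> r} z * ennreal ((norm z)\<^sup>2 * K z))
          + ennreal q * (indicator {z. r \<le> norm z} z * ennreal (K z))"
      proof (cases "z = 0")
        case False
        then have K: "0 \<le> K z" by (rule nonneg)
        show ?thesis
        proof (cases "norm z \<le> r")
          case True
          have "min ((norm z / \<rho>)\<^sup>2) q * K z \<le> (norm z / \<rho>)\<^sup>2 * K z"
            using K by (intro mult_right_mono) auto
          also have "\<dots> = 1 / \<rho>\<^sup>2 * ((norm z)\<^sup>2 * K z)" by (simp add: power_divide)
          finally have "ennreal (min ((norm z / \<rho>)\<^sup>2) q * K z) \<le> ennreal (1 / \<rho>\<^sup>2) * ennreal ((norm z)\<^sup>2 * K z)"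
            using K by (subst ennreal_mult[symmetric]) (auto intro: ennreal_leI)
          then show ?thesis using True by (simp add: add_increasing2)
        next
          case F: False
          have "min ((norm z / \<rho>)\<^sup>2) q * K z \<le> q * K z"
            using K by (intro mult_right_mono) auto
          then have "ennreal (min ((norm z / \<rho>)\<^sup>2) q * K z) \<le> ennreal q * ennreal (K z)"
            using K q by (subst ennreal_mult[symmetric]) (auto intro: ennreal_leI)
          then show ?thesis using F by simp
        qed
      qed (use q in simp)
    qed
    also have "\<dots> = ennreal (1 / \<rho>\<^sup>2) * (\<integral>\<^sup>+z. indicator {z. norm z \<le> r} z * ennreal ((norm z)\<^sup>2 * K z) \<partial>lborel)
      + ennreal q * (\<integral>\<^sup>+z. indicator {z. r \<le> norm z} z * ennreal (K z) \<partial>lborel)"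
      by (subst nn_integral_add) (auto simp: nn_integral_cmult)
    also have "\<dots> \<le> ennreal (1 / \<rho>\<^sup>2) * ennreal (C * r powr (2 - 2 * \<gamma>)) + ennreal q * ennreal (C * r powr (- 2 * \<gamma>))"
      by (intro add_mono mult_left_mono C1 C2 r) auto
    also have "\<dots> = ennreal (1 / \<rho>\<^sup>2 * (C * r powr (2 - 2 * \<gamma>)) + q * (C * r powr (- 2 * \<gamma>)))"
      using C0 q by (simp add: ennreal_mult[symmetric] ennreal_plus[symmetric] del: ennreal_plus)
    also have "1 / \<rho>\<^sup>2 * (C * r powr (2 - 2 * \<gamma>)) + q * (C * r powr (- 2 * \<gamma>)) = 2 * C * (\<rho> powr (- 2 * \<gamma>) * q powr (1 - \<gamma>))"
    proof -
      have "sqrt q powr (2 - 2 * \<gamma>) = q powr (1 - \<gamma>)" "sqrt q powr (- 2 * \<gamma>) = q powr (- \<gamma>)"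
        using q by (simp_all add: powr_half_sqrt[symmetric] powr_powr algebra_simps diff_divide_distrib)
      then have "r powr (2 - 2 * \<gamma>) = \<rho> powr (2 - 2 * \<gamma>) * q powr (1 - \<gamma>)"
        "r powr (- 2 * \<gamma>) = \<rho> powr (- 2 * \<gamma>) * q powr (- \<gamma>)"
        using \<rho> q by (simp_all add: r_def powr_mult)
      moreover have "\<rho> powr (2 - 2 * \<gamma>) = \<rho>\<^sup>2 * \<rho> powr (- 2 * \<gamma>)"
      proof -
        have "\<rho>\<^sup>2 = \<rho> powr 2" using \<rho> by simp
        then show ?thesis by (simp only: powr_add[symmetric]) simp
      qed
      moreover have "q * q powr (- \<gamma>) = q powr (1 - \<gamma>)"
        using q by (simp add: powr_mult_base)
      ultimately show ?thesis using \<rho> by (simp add: field_simps)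
    qed
    finally show "(\<integral>\<^sup>+z. ennreal (min ((norm z / \<rho>)\<^sup>2) q * K z) \<partial>lborel) \<le> ennreal (2 * C * (\<rho> powr (- 2 * \<gamma>) * q powr (1 - \<gamma>)))" .
  qed (use C0 in simp)
qed

end

context stable_kernel
begin

text \<open>K is even, so averaging with the reflection of y in x replaces first differences by
  second differences, whose integrals are bounded uniformly in \<epsilon>. On \<open>S\<close> the
  second difference is at most -\<beta>, and this gain is kept as a multiple of the mass of
  \<open>S\<close>.\<close>

lemma truncated_bump_le:
  obtains C where "C > 0" "\<And>p \<rho> x \<epsilon> \<beta> S. \<rho> > 0 \<Longrightarrow> 0 < bump p \<rho> x \<Longrightarrow> \<epsilon> > 0 \<Longrightarrow> S \<in> sets borel \<Longrightarrow>
    (\<And>y. y \<in> S \<Longrightarrow> \<epsilon> < norm (x - y)) \<Longrightarrow>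
    (\<And>y. y \<in> S \<Longrightarrow> bump p \<rho> x - (bump p \<rho> y + bump p \<rho> (2 *\<^sub>R x - y)) / 2 \<le> - \<beta>) \<Longrightarrow>
    truncated (bump p \<rho>) x \<epsilon> \<le> C * (\<rho> powr (- 2 * \<gamma>) * bump p \<rho> x powr (1 - \<gamma>)) - \<beta> * kernel_mass S x"
proof -
  obtain C where C0: "C > 0" and C: "\<And>\<rho> q. \<rho> > 0 \<Longrightarrow> q > 0 \<Longrightarrow>
    (\<integral>\<^sup>+z. ennreal (min ((norm z / \<rho>)\<^sup>2) q * K z) \<partial>lborel) \<le> ennreal (C * (\<rho> powr (- 2 * \<gamma>) * q powr (1 - \<gamma>)))"
    by (rule quadratic_integral_bound) blast
  show thesis
  proof (rule that[OF C0])
    fix p x :: "(real^'m) \<times> (real^'m)" and \<rho> \<epsilon> \<beta> :: real and S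
    assume \<rho>: "\<rho> > 0" and q: "0 < bump p \<rho> x" and \<epsilon>: "\<epsilon> > 0" and S[measurable]: "S \<in> sets borel"
      and far: "\<And>y. y \<in> S \<Longrightarrow> \<epsilon> < norm (x - y)"
      and gain: "\<And>y. y \<in> S \<Longrightarrow> bump p \<rho> x - (bump p \<rho> y + bump p \<rho> (2 *\<^sub>R x - y)) / 2 \<le> - \<beta>"
    define \<phi> where "\<phi> = bump p \<rho>"
    define D where "D = {y. \<epsilon> < norm (x - y)}"
    have [measurable]: "\<phi> \<in> borel_measurable borel" by (simp add: \<phi>_def)
    have [measurable]: "D \<in> sets borel" unfolding D_def by measurable
    have \<phi>: "0 \<le> \<phi> y" "\<phi> y \<le> 1" for y by (simp_all add: \<phi>_def bump_nonneg bump_le_1)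
    define m where "m y = min ((norm (x - y) / \<rho>)\<^sup>2) (\<phi> x)" for y
    have m: "0 \<le> m y" "m y \<le> 1" for y using \<phi>[of x] by (auto simp: m_def)
    have [measurable]: "m \<in> borel_measurable borel" unfolding m_def by measurable
    have KD: "0 \<le> K (x - y)" if "y \<in> D" for y using that \<epsilon> by (intro nonneg) (auto simp: D_def)
    have int: "set_integrable lebesgue D (\<lambda>y. h y * K (x - y))"
      if [measurable]: "h \<in> borel_measurable borel" and "\<And>y. \<bar>h y\<bar> \<le> 2" for h
      unfolding D_def using that \<epsilon> by (intro set_integrable_bounded_times_K[of _ _ 2]) (auto intro: measurable_completion)
    have i1: "set_integrable lebesgue D (\<lambda>y. (\<phi> x - \<phi> y) * K (x - y))"
    proof (rule int)
      show "\<bar>\<phi> x - \<phi> y\<bar> \<le> 2" for y using \<phi>[of x] \<phi>[of y] by linarith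
    qed measurable
    have i2: "set_integrable lebesgue D (\<lambda>y. (\<phi> x - \<phi> (2 *\<^sub>R x - y)) * K (x - y))"
    proof (rule int)
      show "\<bar>\<phi> x - \<phi> (2 *\<^sub>R x - y)\<bar> \<le> 2" for y using \<phi>[of x] \<phi>[of "2 *\<^sub>R x - y"] by linarith
    qed measurable
    have i3: "set_integrable lebesgue D (\<lambda>y. m y * K (x - y))"
    proof (rule int)
      show "\<bar>m y\<bar> \<le> 2" for y using m[of y] by linarith
    qed measurable
    have i4: "set_integrable lebesgue D (\<lambda>y. indicator S y * K (x - y))"
      by (intro int) (auto simp: indicator_def)
    \<comment> \<open>The point reflection in x preserves Lebesgue measure, the truncated set and
      the kernel.\<close>
    have refl: "truncated \<phi> x \<epsilon> = (LINT y:D|lebesgue. (\<phi> x - \<phi> (2 *\<^sub>R x - y)) * K (x - y))"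
    proof -
      define h where "h y = indicator D y *\<^sub>R ((\<phi> x - \<phi> y) * K (x - y))" for y
      have [measurable]: "h \<in> borel_measurable borel" unfolding h_def by measurable
      have "h (2 *\<^sub>R x - y) = indicator D y *\<^sub>R ((\<phi> x - \<phi> (2 *\<^sub>R x - y)) * K (x - y))" for y
      proof -
        have e: "x - (2 *\<^sub>R x - y) = - (x - y)" by (simp add: scaleR_2)
        have "norm (x - (2 *\<^sub>R x - y)) = norm (x - y)" unfolding e by (rule norm_minus_cancel)
        then have "2 *\<^sub>R x - y \<in> D \<longleftrightarrow> y \<in> D" by (simp add: D_def)
        moreover have "K (x - (2 *\<^sub>R x - y)) = K (x - y)" if "y \<in> D"
          unfolding e using that \<epsilon> by (intro K_minus) (auto simp: D_def)
        ultimately show ?thesis by (simp add: h_def indicator_def)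
      qed
      moreover have "truncated \<phi> x \<epsilon> = (\<integral>y. h y \<partial>lebesgue)"
        by (simp add: truncated_def set_lebesgue_integral_def h_def D_def)
      ultimately show ?thesis
        using integral_measure_preserving_map[OF measure_preserving_map_reflect[of "2 *\<^sub>R x"], of h]
        by (simp add: set_lebesgue_integral_def)
    qed
    have "2 * truncated \<phi> x \<epsilon> = (LINT y:D|lebesgue. (\<phi> x - \<phi> y) * K (x - y) + (\<phi> x - \<phi> (2 *\<^sub>R x - y)) * K (x - y))"
      using set_integral_add(2)[OF i1 i2] refl by (simp add: truncated_def D_def)
    also have "\<dots> \<le> (LINT y:D|lebesgue. 2 * (m y * K (x - y) - \<beta> * (indicator S y * K (x - y))))"
    proof (rule set_integral_mono)
      show "set_integrable lebesgue D (\<lambda>y. (\<phi> x - \<phi> y) * K (x - y) + (\<phi> x - \<phi> (2 *\<^sub>R x - y)) * K (x - y))"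
        by (intro set_integral_add i1 i2)
      show "set_integrable lebesgue D (\<lambda>y. 2 * (m y * K (x - y) - \<beta> * (indicator S y * K (x - y))))"
        by (intro set_integrable_mult_right set_integral_diff i3 i4)
      fix y assume "y \<in> D"
      have 1: "\<phi> x - (\<phi> y + \<phi> (2 *\<^sub>R x - y)) / 2 \<le> m y"
        unfolding \<phi>_def m_def by (rule bump_second_difference[OF \<rho> q])
      have "\<phi> x - (\<phi> y + \<phi> (2 *\<^sub>R x - y)) / 2 \<le> m y - \<beta> * indicator S y"
      proof (cases "y \<in> S")
        case True
        then show ?thesis using gain[OF True] m(1)[of y] by (simp add: \<phi>_def)
      qed (use 1 in simp)
      then have "2 * \<phi> x - \<phi> y - \<phi> (2 *\<^sub>R x - y) \<le> 2 * (m y - \<beta> * indicator S y)"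
        by argo
      then have "(2 * \<phi> x - \<phi> y - \<phi> (2 *\<^sub>R x - y)) * K (x - y) \<le> 2 * (m y - \<beta> * indicator S y) * K (x - y)"
        by (rule mult_right_mono) (rule KD, fact)
      then show "(\<phi> x - \<phi> y) * K (x - y) + (\<phi> x - \<phi> (2 *\<^sub>R x - y)) * K (x - y)
        \<le> 2 * (m y * K (x - y) - \<beta> * (indicator S y * K (x - y)))"
        by (simp add: algebra_simps)
    qed
    also have "\<dots> = 2 * ((LINT y:D|lebesgue. m y * K (x - y)) - \<beta> * (LINT y:D|lebesgue. indicator S y * K (x - y)))"
      by (simp only: set_integral_mult_right set_integral_diff(2)[OF i3 set_integrable_mult_right[OF i4]])
    also have "(LINT y:D|lebesgue. indicator S y * K (x - y)) = kernel_mass S x"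
      unfolding D_def by (rule kernel_mass_eq_truncated) (rule far)
    finally have le: "truncated \<phi> x \<epsilon> \<le> (LINT y:D|lebesgue. m y * K (x - y)) - \<beta> * kernel_mass S x" by simp
    have "(LINT y:D|lebesgue. m y * K (x - y)) = enn2real (\<integral>\<^sup>+y. ennreal (indicator D y *\<^sub>R (m y * K (x - y))) \<partial>lebesgue)"
      unfolding set_lebesgue_integral_def using i3 m(1) KD
      by (intro integral_eq_nn_integral) (auto simp: set_integrable_def indicator_def)
    also have "\<dots> \<le> C * (\<rho> powr (- 2 * \<gamma>) * \<phi> x powr (1 - \<gamma>))"
    proof (rule enn2real_leI)
      have "(\<integral>\<^sup>+y. ennreal (indicator D y *\<^sub>R (m y * K (x - y))) \<partial>lebesgue)
        \<le> (\<integral>\<^sup>+y. ennreal (min ((norm (x - y) / \<rho>)\<^sup>2) (\<phi> x) * K (x - y)) \<partial>lebesgue)"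
        by (intro nn_integral_mono) (auto simp: m_def indicator_def)
      also have "\<dots> = (\<integral>\<^sup>+z. ennreal (min ((norm z / \<rho>)\<^sup>2) (\<phi> x) * K z) \<partial>lborel)"
        by (rule nn_integral_diff_eq) measurable
      also have "\<dots> \<le> ennreal (C * (\<rho> powr (- 2 * \<gamma>) * \<phi> x powr (1 - \<gamma>)))"
        using \<rho> q by (intro C) (auto simp: \<phi>_def)
      finally show "(\<integral>\<^sup>+y. ennreal (indicator D y *\<^sub>R (m y * K (x - y))) \<partial>lebesgue)
        \<le> ennreal (C * (\<rho> powr (- 2 * \<gamma>) * \<phi> x powr (1 - \<gamma>)))" .
    qed (use C0 in simp)
    finally show "truncated (bump p \<rho>) x \<epsilon> \<le> C * (\<rho> powr (- 2 * \<gamma>) * bump p \<rho> x powr (1 - \<gamma>)) - \<beta> * kernel_mass S x"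
      using le by (simp add: \<phi>_def)
  qed
qed

definition reflected_side :: "((real^'m) \<times> (real^'m)) set" where
  "reflected_side = {y. cone_gap y < 0}"

lemma reflected_side_borel [measurable]: "reflected_side \<in> sets borel"
  unfolding reflected_side_def by measurable

lemma reflected_side_far: "y \<in> reflected_side \<Longrightarrow> cone_gap x / 2 \<le> norm (x - y)"
  using cone_gap_diff_le[of x y] by (simp add: reflected_side_def)

end

lemma eventually_at_right_less: "0 < d \<Longrightarrow> \<forall>\<^sub>F \<epsilon> in at_right 0. 0 < \<epsilon> \<and> \<epsilon> < (d::real)"
  using eventually_at_right_real[of 0 d] by simp

text \<open>The bound \<open>f_linear\<close> is a consequence of concavity: on {0..1/2} f lies
  above its chord from the origin, which makes 2 f(1/2) an admissible \<mu>.\<close>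

locale saddle_solution = stable_kernel K k \<gamma> \<kappa>1 \<kappa>2
  for K :: "(real^'m) \<times> (real^'m) \<Rightarrow> real" and k \<gamma> \<kappa>1 \<kappa>2 +
  fixes f :: "real \<Rightarrow> real" and u :: "(real^'m) \<times> (real^'m) \<Rightarrow> real" and \<mu> :: real
  assumes u_continuous: "continuous_on UNIV u"
    and u_bound: "\<And>x. \<bar>u x\<bar> \<le> 1"
    and u_radial: "doubly_radial u" and u_odd: "cone_odd u"
    and u_pos: "\<And>x. x \<in> cone_side \<Longrightarrow> 0 < u x"
    and u_eq: "\<And>x. has_LK K u x (f (u x))"
    and f_nonneg: "\<And>t. 0 \<le> t \<Longrightarrow> t \<le> 1 \<Longrightarrow> 0 \<le> f t"
    and \<mu>: "0 < \<mu>" and f_linear: "\<And>t. 0 \<le> t \<Longrightarrow> t \<le> 1/2 \<Longrightarrow> \<mu> * t \<le> f t"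
begin

lemma u_measurable [measurable]: "u \<in> borel_measurable borel"
  by (intro borel_measurable_continuous_onI u_continuous)

lemma u_swap: "u (prod.swap y) = - u y"
proof -
  have "u y = - u (prod.swap y)" using u_odd unfolding cone_odd_def by (rule spec)
  then show ?thesis by simp
qed

lemma u_sign: "cone_gap y < 0 \<Longrightarrow> u y < 0" "cone_gap y = 0 \<Longrightarrow> u y = 0"
  using u_pos[of "prod.swap y"] cone_odd_doubly_radial_zero[OF u_odd u_radial, of y]
  by (auto simp: cone_side_iff cone_gap_swap u_swap)

text \<open>Comparison with a barrier \<open>b\<close> touching \<open>u\<close> from below at \<open>x\<close>. The barrier need not be doubly
  radial: the odd, doubly radial function to which the kernel inequality applies is the excess of
  \<open>u\<close> over its truncation at height \<open>M\<close>.\<close>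

lemma touching_barrier:
  fixes b :: "(real^'m) \<times> (real^'m) \<Rightarrow> real"
  assumes x: "x \<in> cone_side" and M: "0 < M" "u x \<le> M"
    and [measurable]: "b \<in> borel_measurable borel" and B: "\<And>y. \<bar>b y\<bar> \<le> B"
    and le: "\<And>y. y \<in> cone_side \<Longrightarrow> b y \<le> u y" "\<And>y. y \<in> cone_side \<Longrightarrow> b y \<le> M"
    and out: "\<And>y. y \<notin> cone_side \<Longrightarrow> b y \<le> 0" and touch: "b x = u x" and e: "e > 0"
  shows "\<forall>\<^sub>F \<epsilon> in at_right 0. f (u x) \<le> truncated b x \<epsilon> + M * kernel_mass reflected_side x + e"
proof -
  \<comment> \<open>Clipping at -M as well as at M keeps \<open>w\<close>, and with it the excess
    \<open>W\<close>, odd.\<close>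
  define w where "w y = max (- M) (min M (u y))" for y
  define W where "W y = u y - w y" for y
  have [measurable]: "w \<in> borel_measurable borel" unfolding w_def by measurable
  have W_meas[measurable]: "W \<in> borel_measurable borel" unfolding W_def by measurable
  have W_bound: "\<bar>W y\<bar> \<le> 1" for y using u_bound[of y] M by (auto simp: W_def w_def)
  have W_dr: "doubly_radial W"
    using u_radial unfolding doubly_radial_def W_def w_def by metis
  have W_odd: "cone_odd W"
    unfolding cone_odd_def W_def w_def u_swap using M(1) by (auto simp: max_def min_def)
  have W_pos: "0 \<le> W y" if "y \<in> cone_side" for y
    using u_pos[OF that] M by (auto simp: W_def w_def)
  have W_int: "set_integrable lebesgue {y. \<epsilon> < norm (x - y)} (\<lambda>y. W y * K (x - y))" if "\<epsilon> > 0" for \<epsilon>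
    by (rule set_integrable_bounded_times_K[OF that _ W_bound]) (auto intro: measurable_completion)
  have e3: "e / 3 > 0" using e by simp
  have ev1: "\<forall>\<^sub>F \<epsilon> in at_right 0. - (e / 3) \<le> (LINT y:{y. \<epsilon> < norm (x - y)}|lebesgue. W y * K (x - y))"
    by (rule truncated_integral_lower[OF x _ W_dr W_odd W_pos W_int e3]) (auto intro: measurable_completion)
  have "((\<lambda>\<epsilon>. truncated u x \<epsilon>) \<longlongrightarrow> f (u x)) (at_right 0)"
    using u_eq[of x] by (simp add: has_LK_def truncated_def)
  then have ev2: "\<forall>\<^sub>F \<epsilon> in at_right 0. f (u x) - e / 3 < truncated u x \<epsilon>"
    by (rule order_tendstoD) (use e in simp)
  define d where "d = cone_gap x / 2"
  have d: "d > 0" using x by (simp add: d_def cone_side_iff)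
  show ?thesis
    using ev1 ev2 eventually_at_right_less[OF d]
  proof eventually_elim
    case (elim \<epsilon>)
    let ?D = "{y. \<epsilon> < norm (x - y)}"
    have int: "set_integrable lebesgue ?D (\<lambda>y. h y * K (x - y))"
      if "h \<in> borel_measurable borel" and "\<And>y. \<bar>h y\<bar> \<le> A" for h A
      using that elim by (intro set_integrable_bounded_times_K[of _ _ A]) (auto intro: measurable_completion)
    have i1: "set_integrable lebesgue ?D (\<lambda>y. (b x - b y) * K (x - y))"
    proof (rule int[of _ "2 * B"])
      show "\<bar>b x - b y\<bar> \<le> 2 * B" for y using B[of x] B[of y] by linarith
    qed measurable
    have i2: "set_integrable lebesgue ?D (\<lambda>y. indicator reflected_side y * K (x - y))"
      by (rule int[of _ 1]) (auto simp: indicator_def)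
    have i3: "set_integrable lebesgue ?D (\<lambda>y. W y * K (x - y))" using elim by (intro W_int) simp
    have i4: "set_integrable lebesgue ?D (\<lambda>y. (u x - u y) * K (x - y))"
    proof (rule int[of _ 2])
      show "\<bar>u x - u y\<bar> \<le> 2" for y using u_bound[of x] u_bound[of y] by linarith
    qed measurable
    have "truncated u x \<epsilon> \<le> (LINT y:?D|lebesgue. (b x - b y) * K (x - y) + M * (indicator reflected_side y * K (x - y)) - W y * K (x - y))"
      unfolding truncated_def
    proof (rule set_integral_mono)
      show "set_integrable lebesgue ?D (\<lambda>y. (b x - b y) * K (x - y) + M * (indicator reflected_side y * K (x - y)) - W y * K (x - y))"
        by (intro set_integral_diff set_integral_add set_integrable_mult_right i1 i2 i3)
      fix y assume "y \<in> ?D"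
      then have "x - y \<noteq> 0" using elim by auto
      then have K: "0 \<le> K (x - y)" by (rule nonneg)
      \<comment> \<open>In \<open>cone_side\<close>, u - W = min M u lies above b. Beyond the cone W
        - u is at most M and b \<le> 0, which costs M there; on the cone u and W vanish.\<close>
      have "u x - u y \<le> b x - b y + M * indicator reflected_side y - W y"
      proof (cases "y \<in> cone_side")
        case True
        then have "u y - W y \<ge> b y" using le[OF True] M by (auto simp: W_def w_def)
        moreover have "y \<notin> reflected_side" using True by (simp add: reflected_side_def cone_side_iff)
        ultimately show ?thesis using touch by simp
      next
        case False
        have "b y \<le> 0" using out False by simp
        show ?thesis
        proof (cases "cone_gap y = 0")
          case True
          then have "W y = 0" using M u_sign[of y] by (simp add: W_def w_def)
          then show ?thesis using True touch u_sign[of y] \<open>b y \<le> 0\<close> by (simp add: reflected_side_def)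
        next
          case neq: False
          then have "y \<in> reflected_side" using False by (simp add: reflected_side_def cone_side_iff)
          moreover have "W y - u y \<le> M" by (simp add: W_def w_def)
          ultimately show ?thesis using touch \<open>b y \<le> 0\<close> by simp
        qed
      qed
      then have "(u x - u y) * K (x - y) \<le> (b x - b y + M * indicator reflected_side y - W y) * K (x - y)"
        using K by (rule mult_right_mono)
      then show "(u x - u y) * K (x - y) \<le> (b x - b y) * K (x - y) + M * (indicator reflected_side y * K (x - y)) - W y * K (x - y)"
        by (simp add: algebra_simps)
    qed (rule i4)
    also have "\<dots> = truncated b x \<epsilon> + M * (LINT y:?D|lebesgue. indicator reflected_side y * K (x - y)) - (LINT y:?D|lebesgue. W y * K (x - y))"
      by (simp add: truncated_def set_integral_diff(2)[OF set_integral_add(1)[OF i1 set_integrable_mult_right[OF i2]] i3]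
          set_integral_add(2)[OF i1 set_integrable_mult_right[OF i2]])
    also have "(LINT y:?D|lebesgue. indicator reflected_side y * K (x - y)) = kernel_mass reflected_side x"
    proof (rule kernel_mass_eq_truncated)
      fix y assume "y \<in> reflected_side"
      then show "\<epsilon> < norm (x - y)" using reflected_side_far[of y x] elim by (simp add: d_def)
    qed
    finally show ?case using elim e by linarith
  qed
qed

text \<open>The multiple t is the minimum of u / bump, taken as the reciprocal of the maximum of
  bump / u because the bump vanishes on the rim while u is positive on the closed ball. The value 1
  at the centre gives t < \<kappa>.\<close>

lemma bump_touches_below:
  assumes \<rho>: "\<rho> > 0" and sub: "cball p \<rho> \<subseteq> cone_side" and \<kappa>: "0 < \<kappa>" and less: "u p < \<kappa>"
  obtains t x where "0 < t" "t < \<kappa>" "0 < bump p \<rho> x" "x \<in> cball p \<rho>" "u x = t * bump p \<rho> x"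
    "\<And>y. y \<in> cone_side \<Longrightarrow> t * bump p \<rho> y \<le> u y"
proof -
  have up: "0 < u y" if "y \<in> cball p \<rho>" for y using that sub u_pos by blast
  have "continuous_on (cball p \<rho>) (\<lambda>y. bump p \<rho> y / u y)"
    using up by (intro continuous_intros continuous_on_bump continuous_on_subset[OF u_continuous]) force+
  then obtain x where x: "x \<in> cball p \<rho>" "\<And>y. y \<in> cball p \<rho> \<Longrightarrow> bump p \<rho> y / u y \<le> bump p \<rho> x / u x"
    using continuous_attains_sup[of "cball p \<rho>" "\<lambda>y. bump p \<rho> y / u y"] \<rho> by auto
  define s where "s = bump p \<rho> x / u x"
  have p: "p \<in> cball p \<rho>" using \<rho> by simp
  have "1 / \<kappa> < 1 / u p" using less up[OF p] \<kappa> by (intro divide_strict_left_mono) auto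
  also have "\<dots> \<le> s" using x(2)[OF p] by (simp add: s_def bump_center)
  finally have s: "1 / \<kappa> < s" .
  then have s0: "0 < s" using \<kappa> by (meson less_trans zero_less_divide_1_iff)
  show thesis
  proof (rule that[of "1 / s" x])
    show "0 < 1 / s" using s0 by simp
    show "1 / s < \<kappa>" using s s0 \<kappa> by (simp add: field_simps)
    show "0 < bump p \<rho> x" using s0 up[OF x(1)] by (simp add: s_def zero_less_divide_iff)
    show "x \<in> cball p \<rho>" by fact
    show "u x = 1 / s * bump p \<rho> x"
      using \<open>0 < bump p \<rho> x\<close> up[OF x(1)] by (simp add: s_def)
    fix y :: "(real^'m) \<times> (real^'m)" assume y: "y \<in> cone_side"
    show "1 / s * bump p \<rho> y \<le> u y"
    proof (cases "y \<in> cball p \<rho>")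
      case True
      then have "bump p \<rho> y \<le> s * u y" using x(2)[OF True] up[OF True] by (simp add: s_def field_simps)
      then show ?thesis using s0 by (simp add: field_simps)
    next
      case False
      then have "y \<notin> ball p \<rho>" by auto
      then have "bump p \<rho> y = 0" using bump_pos_iff[OF \<rho>, of p y] bump_nonneg[of p \<rho> y] by linarith
      then show ?thesis using u_pos[OF y] by simp
    qed
  qed
qed

end

section \<open>Lower bounds for the saddle solution\<close>

lemma ex_powr_eq:
  fixes a c :: real
  assumes "a \<noteq> 0" "c > 0"
  obtains s where "s > 0" "s powr a = c"
proof (rule that[of "c powr (1 / a)"])
  show "(c powr (1 / a)) powr a = c" using assms by (simp add: powr_powr)
qed (use assms in simp)

text \<open>Moving \<open>fst x\<close> outward along its own ray raises the gap by exactly the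
  distance travelled; any unit vector serves if \<open>fst x\<close> is 0.\<close>

lemma cone_gap_shift_up:
  fixes x :: "(real^'m) \<times> (real^'m)"
  assumes "h \<ge> 0"
  obtains c where "cone_gap c = cone_gap x + h" "norm (x - c) = h"
proof -
  obtain e :: "real^'m" where e: "norm e = 1" "fst x = norm (fst x) *\<^sub>R e"
  proof (cases "fst x = 0")
    case True
    obtain b :: "real^'m" where "b \<in> Basis" using nonempty_Basis by blast
    then show ?thesis using that[of b] True by simp
  next
    case False
    then show ?thesis using that[of "sgn (fst x)"] by (simp add: norm_sgn sgn_div_norm)
  qed
  have "fst x + h *\<^sub>R e = (norm (fst x) + h) *\<^sub>R e"
    using e(2) by (simp add: scaleR_add_left)
  then have "norm (fst x + h *\<^sub>R e) = norm (fst x) + h" using e(1) assms by simp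
  moreover have "norm (x - (fst x + h *\<^sub>R e, snd x)) = h"
    using e(1) assms by (simp add: norm_prod_def)
  ultimately show thesis
    by (intro that[of "(fst x + h *\<^sub>R e, snd x)"]) (simp_all add: cone_gap_def)
qed

lemma cone_gap_shift_down:
  fixes x :: "(real^'m) \<times> (real^'m)"
  assumes "h \<ge> 0"
  obtains c where "cone_gap c = cone_gap x - h" "norm (x - c) = h"
proof -
  obtain c where c: "cone_gap c = cone_gap (prod.swap x) + h" "norm (prod.swap x - c) = h"
    using cone_gap_shift_up[OF assms] .
  have "norm (x - prod.swap c) = h"
    using c(2) by (simp add: norm_prod_def add.commute)
  then show thesis using c(1) by (intro that[of "prod.swap c"]) (simp_all add: cone_gap_swap)
qed

text \<open>Let d be the gap of x. A ball of radius d/2 about a point at distance 3d with gap -2d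
  stays beyond the cone, and its points are within 7d/2 of x, seven times the radius.\<close>

lemma (in stable_kernel) reflected_mass_lower:
  assumes x: "x \<in> cone_side"
  shows "ball_mass_const 7 * (cone_gap x / 2) powr (- 2 * \<gamma>) \<le> kernel_mass reflected_side x"
proof -
  have d: "cone_gap x > 0" using x by (simp add: cone_side_iff)
  obtain c where c: "cone_gap c = cone_gap x - 3 * cone_gap x" "norm (x - c) = 3 * cone_gap x"
    using cone_gap_shift_down[of "3 * cone_gap x" x] d by auto
  have near: "norm (c - y) < cone_gap x / 2" if "y \<in> ball c (cone_gap x / 2)" for y
    using that by (simp add: dist_norm)
  have "ball_mass_const 7 * (cone_gap x / 2) powr (- 2 * \<gamma>) \<le> kernel_mass (ball c (cone_gap x / 2)) x"
  proof (rule kernel_mass_ball_lower[of _ _ "cone_gap x"])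
    fix y assume y: "y \<in> ball c (cone_gap x / 2)"
    show "cone_gap x \<le> norm (x - y) \<and> norm (x - y) \<le> 7 * (cone_gap x / 2)"
      using norm_triangle_ineq[of "x - c" "c - y"] norm_triangle_ineq2[of "x - c" "y - c"] near[OF y] c(2)
      by (simp add: norm_minus_commute)
  qed (use d in auto)
  also have "\<dots> \<le> kernel_mass reflected_side x"
  proof (rule kernel_mass_mono)
    show "ball c (cone_gap x / 2) \<subseteq> reflected_side"
    proof
      fix y assume "y \<in> ball c (cone_gap x / 2)"
      then show "y \<in> reflected_side"
        using near[of y] cone_gap_diff_le[of c y] c(1) by (simp add: reflected_side_def)
    qed
    show "cone_gap x / 2 > 0" using d by simp
    show "cone_gap x / 2 \<le> norm (x - y)" if "y \<in> reflected_side" for y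
      using that by (rule reflected_side_far)
  qed simp_all
  finally show ?thesis .
qed

context saddle_solution
begin

lemma touching_barrier_le:
  fixes b :: "(real^'m) \<times> (real^'m) \<Rightarrow> real"
  assumes "x \<in> cone_side" "0 < M" "u x \<le> M" "b \<in> borel_measurable borel" "\<And>y. \<bar>b y\<bar> \<le> B"
    and "\<And>y. y \<in> cone_side \<Longrightarrow> b y \<le> u y" "\<And>y. y \<in> cone_side \<Longrightarrow> b y \<le> M"
    and "\<And>y. y \<notin> cone_side \<Longrightarrow> b y \<le> 0" "b x = u x"
    and d: "d > 0" and T: "\<And>\<epsilon>. 0 < \<epsilon> \<Longrightarrow> \<epsilon> < d \<Longrightarrow> truncated b x \<epsilon> \<le> T"
  shows "f (u x) \<le> T + M * kernel_mass reflected_side x"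
proof (rule field_le_epsilon)
  fix e :: real assume e: "e > 0"
  have "\<forall>\<^sub>F \<epsilon> in at_right 0. f (u x) \<le> truncated b x \<epsilon> + M * kernel_mass reflected_side x + e"
    by (rule touching_barrier[OF assms(1-9) e])
  then have "\<forall>\<^sub>F \<epsilon> in at_right (0::real). f (u x) \<le> T + M * kernel_mass reflected_side x + e"
    using eventually_at_right_less[OF d]
  proof eventually_elim
    case (elim \<epsilon>)
    then show ?case using T[of \<epsilon>] by simp
  qed
  then show "f (u x) \<le> T + M * kernel_mass reflected_side x + e"
    by simp
qed

text \<open>A bump of radius \<open>\<rho>\<close> at distance \<open>N\<rho>\<close> from the cone: where the bump is small the mass of its core
  makes the operator negative, elsewhere the operator is at most of order \<open>\<rho> powr (- 2 * \<gamma>)\<close>, which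
  is below \<open>\<mu>\<close> for large \<open>\<rho>\<close>.\<close>

lemma saddle_far_lower:
  obtains R where "R > 0" "\<And>p. R \<le> cone_gap p \<Longrightarrow> 1/2 \<le> u p"
proof -
  obtain C1 where C1: "C1 > 0" "\<And>p \<rho> x \<epsilon> \<beta> S. \<rho> > 0 \<Longrightarrow> 0 < bump p \<rho> x \<Longrightarrow> \<epsilon> > 0 \<Longrightarrow> S \<in> sets borel \<Longrightarrow>
    (\<And>y. y \<in> S \<Longrightarrow> \<epsilon> < norm (x - y)) \<Longrightarrow>
    (\<And>y. y \<in> S \<Longrightarrow> bump p \<rho> x - (bump p \<rho> y + bump p \<rho> (2 *\<^sub>R x - y)) / 2 \<le> - \<beta>) \<Longrightarrow>
    truncated (bump p \<rho>) x \<epsilon> \<le> C1 * (\<rho> powr (- 2 * \<gamma>) * bump p \<rho> x powr (1 - \<gamma>)) - \<beta> * kernel_mass S x"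
    by (rule truncated_bump_le) blast
  obtain C2 where C2: "C2 > 0" "\<And>A r x. A \<in> sets borel \<Longrightarrow> r > 0 \<Longrightarrow> (\<And>y. y \<in> A \<Longrightarrow> r \<le> norm (x - y)) \<Longrightarrow>
    kernel_mass A x \<le> C2 * r powr (- 2 * \<gamma>)"
    by (rule kernel_mass_upper) blast
  \<comment> \<open>A lower bound, in units of \<rho>^(-2\<gamma>), for the kernel mass of the core
    of radius \<rho>/2 seen from a point within 3\<rho>/2 of it all.\<close>
  define g where "g = ball_mass_const 3 * (1/2) powr (- 2 * \<gamma>)"
  have g: "g > 0" by (simp add: g_def ball_mass_const_pos)
  obtain s where s: "s > 0" "s powr (1 - \<gamma>) = g / 16 / C1"
    using ex_powr_eq[of "1 - \<gamma>" "g / 16 / C1"] \<gamma> g C1(1) by auto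
  \<comment> \<open>Threshold between rim and interior: up to it the cost C1 q^(1 - \<gamma>) is at
    most g/16, and 1/8 is small enough to keep x away from the core.\<close>
  define q1 where "q1 = min (1/8) s"
  have q1: "0 < q1" "q1 \<le> 1/8" "C1 * q1 powr (1 - \<gamma>) \<le> g / 16"
  proof -
    show "0 < q1" "q1 \<le> 1/8" using s by (auto simp: q1_def)
    have "q1 powr (1 - \<gamma>) \<le> s powr (1 - \<gamma>)"
      using \<open>0 < q1\<close> \<gamma> by (intro powr_mono2) (auto simp: q1_def)
    then show "C1 * q1 powr (1 - \<gamma>) \<le> g / 16" using s(2) C1(1) by (simp add: field_simps)
  qed
  \<comment> \<open>Makes the loss from beyond the cone at most g/16 in the same units.\<close>
  obtain N where N: "N > 0" "N powr (- 2 * \<gamma>) = g / 16 / C2"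
    using ex_powr_eq[of "- 2 * \<gamma>" "g / 16 / C2"] \<gamma> g C2(1) by auto
  \<comment> \<open>Makes the total cost half of \<mu> q1, so that the linear growth of f wins where
    the bump exceeds q1.\<close>
  obtain \<rho> where \<rho>: "\<rho> > 0" "\<rho> powr (- 2 * \<gamma>) = \<mu> * q1 / (2 * (C1 + g / 16))"
    using ex_powr_eq[of "- 2 * \<gamma>" "\<mu> * q1 / (2 * (C1 + g / 16))"] \<gamma> g C1(1) \<mu> q1 by auto
  define X where "X = \<rho> powr (- 2 * \<gamma>)"
  have X: "X > 0" "X * (C1 + g / 16) < \<mu> * q1"
  proof -
    show "X > 0" using \<rho>(1) by (simp add: X_def)
    have "X * (C1 + g / 16) = \<mu> * q1 / 2"
      unfolding X_def \<rho>(2) using C1(1) g by (simp add: field_simps)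
    moreover have "0 < \<mu> * q1" using \<mu> q1(1) by simp
    ultimately show "X * (C1 + g / 16) < \<mu> * q1" by linarith
  qed
  show thesis
  \<comment> \<open>The gap is 2-Lipschitz: a ball of radius \<rho> loses 2\<rho> and keeps gap
    2N\<rho>, hence distance at least N\<rho> to the other side.\<close>
  proof (rule that[of "2 * N * \<rho> + 2 * \<rho>"])
    show "2 * N * \<rho> + 2 * \<rho> > 0" using N \<rho>(1) by (simp add: add_pos_pos)
    fix p :: "(real^'m) \<times> (real^'m)" assume p: "2 * N * \<rho> + 2 * \<rho> \<le> cone_gap p"
    have gap: "2 * N * \<rho> \<le> cone_gap y" if "y \<in> cball p \<rho>" for y
      using cone_gap_diff_le[of p y] that p by (simp add: dist_norm)
    have sub: "cball p \<rho> \<subseteq> cone_side"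
    proof
      fix y assume "y \<in> cball p \<rho>"
      moreover have "0 < 2 * N * \<rho>" using N \<rho>(1) by simp
      ultimately show "y \<in> cone_side" using gap[of y] by (simp add: cone_side_iff)
    qed
    show "1/2 \<le> u p"
    proof (rule ccontr)
      assume "\<not> 1/2 \<le> u p"
      then obtain t x where t: "0 < t" "t < 1/2" and x: "0 < bump p \<rho> x" "x \<in> cball p \<rho>" "u x = t * bump p \<rho> x"
        and below: "\<And>y. y \<in> cone_side \<Longrightarrow> t * bump p \<rho> y \<le> u y"
        using bump_touches_below[OF \<rho>(1) sub, of "1/2"] by auto
      define q where "q = bump p \<rho> x"
      have q: "0 < q" "q \<le> 1" using x(1) by (auto simp: q_def bump_le_1)
      have xO: "x \<in> cone_side" using x(2) sub by blast
      have tq: "0 \<le> t * q" "t * q \<le> t" using t q by (auto simp: mult_left_le)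
      have outside: "bump p \<rho> y = 0" if "y \<notin> cone_side" for y
      proof -
        have "y \<notin> ball p \<rho>" using that sub ball_subset_cball by blast
        then show ?thesis using bump_pos_iff[OF \<rho>(1), of p y] bump_nonneg[of p \<rho> y] by linarith
      qed
      have loss: "kernel_mass reflected_side x \<le> g / 16 * X"
      proof -
        have "kernel_mass reflected_side x \<le> C2 * (N * \<rho>) powr (- 2 * \<gamma>)"
        proof (rule C2(2))
          fix y assume "y \<in> reflected_side"
          then show "N * \<rho> \<le> norm (x - y)" using reflected_side_far[of y x] gap[OF x(2)] by simp
        qed (use N \<rho>(1) in auto)
        also have "\<dots> = g / 16 * X"
          using N \<rho>(1) C2(1) by (simp only: X_def powr_mult N(2)) simp
        finally show ?thesis .
      qed
      have trunc: "truncated (\<lambda>y. t * bump p \<rho> y) x \<epsilon> = t * truncated (bump p \<rho>) x \<epsilon>" for \<epsilon>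
        unfolding truncated_def set_integral_mult_right[symmetric] by (simp add: algebra_simps)
      have touch: "f (u x) \<le> t * T + t * (g / 16 * X)"
        if d: "d > 0" and T: "\<And>\<epsilon>. 0 < \<epsilon> \<Longrightarrow> \<epsilon> < d \<Longrightarrow> truncated (bump p \<rho>) x \<epsilon> \<le> T" for d T
      proof -
        have "f (u x) \<le> t * T + t * kernel_mass reflected_side x"
        proof (rule touching_barrier_le[of x t "\<lambda>y. t * bump p \<rho> y" 1, OF xO t(1)])
          show "\<bar>t * bump p \<rho> y\<bar> \<le> 1" for y
            using t bump_nonneg[of p \<rho> y] bump_le_1[of p \<rho> y] by (simp add: abs_mult mult_le_one)
          show "t * bump p \<rho> y \<le> t" for y using t bump_le_1[of p \<rho> y] by (simp add: mult_left_le)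
          show "d > 0" by fact
          show "truncated (\<lambda>y. t * bump p \<rho> y) x \<epsilon> \<le> t * T" if "0 < \<epsilon>" "\<epsilon> < d" for \<epsilon>
            unfolding trunc using T[OF that] t by simp
        qed (use x(3) tq below outside in \<open>auto simp: q_def\<close>)
        then show ?thesis using mult_left_mono[OF loss, of t] t by linarith
      qed
      show False
      proof (cases "q \<le> q1")
        case False
        have "f (u x) \<le> t * (C1 * X) + t * (g / 16 * X)"
        proof (rule touch[of 1])
          fix \<epsilon> :: real assume "0 < \<epsilon>" "\<epsilon> < 1"
          then have "truncated (bump p \<rho>) x \<epsilon> \<le> C1 * (X * q powr (1 - \<gamma>))"
            using C1(2)[of \<rho> p x \<epsilon> "{}" 0] \<rho> x by (simp add: X_def q_def)
          also have "\<dots> \<le> C1 * X"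
            using C1(1) X(1) q \<gamma> powr_mono2[of "1 - \<gamma>" q 1] by (simp add: mult_left_le)
          finally show "truncated (bump p \<rho>) x \<epsilon> \<le> C1 * X" .
        qed simp
        moreover have "\<mu> * (t * q) \<le> f (u x)"
          unfolding x(3) q_def[symmetric] using tq t by (intro f_linear) linarith+
        moreover have "\<mu> * (t * q1) \<le> \<mu> * (t * q)" using False \<mu> t by simp
        moreover have "t * (X * (C1 + g / 16)) < t * (\<mu> * q1)" using X(2) t by simp
        ultimately show False by (simp add: algebra_simps)
      next
        case True
        \<comment> \<open>A small bump value puts x in the rim, at least 3\<rho>/4 from p. On the
          core the bump is at least 3/4, so the second difference there is at most 1/8 - 3/8 =
          -1/4.\<close>
        then have q8: "q \<le> 1/8" using q1 by simp
        have qx: "q = 1 - (norm (x - p) / \<rho>)\<^sup>2" using x(1) by (auto simp: q_def bump_def)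
        have "(3/4::real)\<^sup>2 \<le> 7/8" by (simp add: power2_eq_square)
        then have "(3/4)\<^sup>2 \<le> (norm (x - p) / \<rho>)\<^sup>2" using q8 qx by linarith
        then have "3/4 \<le> norm (x - p) / \<rho>" by (rule power2_le_imp_le) (use \<rho>(1) in simp)
        then have lo: "3/4 * \<rho> \<le> norm (x - p)" using \<rho>(1) by (simp add: field_simps)
        have hi: "norm (x - p) \<le> \<rho>" using x(2) by (simp add: dist_norm norm_minus_commute)
        have ball: "\<rho> / 4 \<le> norm (x - y) \<and> norm (x - y) \<le> 3 * (\<rho> / 2)" if "y \<in> ball p (\<rho> / 2)" for y
          using that lo hi norm_triangle_ineq[of "x - p" "p - y"] norm_triangle_ineq2[of "x - p" "y - p"]
          by (simp add: dist_norm norm_minus_commute)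
        have mass: "g * X \<le> kernel_mass (ball p (\<rho> / 2)) x"
        proof -
          have "g * X = ball_mass_const 3 * (\<rho> / 2) powr (- 2 * \<gamma>)"
            using \<rho>(1) by (simp add: g_def X_def powr_mult[symmetric])
          also have "\<dots> \<le> kernel_mass (ball p (\<rho> / 2)) x"
            using \<rho>(1) ball by (intro kernel_mass_ball_lower[of _ _ "\<rho> / 4"]) auto
          finally show ?thesis .
        qed
        \<comment> \<open>The gain g/4 outweighs two costs of g/16 and leaves -g/8, against f \<ge>
          0.\<close>
        have "f (u x) \<le> t * (g / 16 * X - 1/4 * (g * X)) + t * (g / 16 * X)"
        proof (rule touch[of "\<rho> / 4"])
          fix \<epsilon> :: real assume \<epsilon>: "0 < \<epsilon>" "\<epsilon> < \<rho> / 4"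
          have "truncated (bump p \<rho>) x \<epsilon> \<le> C1 * (X * q powr (1 - \<gamma>)) - 1/4 * kernel_mass (ball p (\<rho> / 2)) x"
            unfolding X_def q_def
          proof (rule C1(2))
            fix y assume y: "y \<in> ball p (\<rho> / 2)"
            show "\<epsilon> < norm (x - y)" using ball[OF y] \<epsilon> by simp
            have "norm (y - p) / \<rho> \<le> 1/2" using y \<rho>(1) by (simp add: dist_norm norm_minus_commute field_simps)
            then have "(norm (y - p) / \<rho>)\<^sup>2 \<le> (1/2)\<^sup>2" using \<rho>(1) by (intro power_mono) auto
            moreover have "(1/2::real)\<^sup>2 = 1/4" by (simp add: power2_eq_square)
            moreover have "1 - (norm (y - p) / \<rho>)\<^sup>2 \<le> bump p \<rho> y" by (simp add: bump_def)
            ultimately have "3/4 \<le> bump p \<rho> y" by linarith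
            then show "bump p \<rho> x - (bump p \<rho> y + bump p \<rho> (2 *\<^sub>R x - y)) / 2 \<le> - (1/4)"
              using q8 bump_nonneg[of p \<rho> "2 *\<^sub>R x - y"] unfolding q_def by argo
          qed (use \<rho>(1) x \<epsilon> in auto)
          also have "C1 * (X * q powr (1 - \<gamma>)) \<le> g / 16 * X"
          proof -
            have "q powr (1 - \<gamma>) \<le> q1 powr (1 - \<gamma>)" using True q \<gamma> by (intro powr_mono2) auto
            then have "C1 * q powr (1 - \<gamma>) \<le> C1 * q1 powr (1 - \<gamma>)" using C1(1) by simp
            then have "C1 * q powr (1 - \<gamma>) \<le> g / 16" using q1(3) by simp
            then show ?thesis using mult_right_mono[of "C1 * q powr (1 - \<gamma>)" "g / 16" X] X(1) by (simp add: ac_simps)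
          qed
          finally show "truncated (bump p \<rho>) x \<epsilon> \<le> g / 16 * X - 1/4 * (g * X)" using mass by (simp add: algebra_simps)
        qed (use \<rho>(1) in simp)
        also have "\<dots> < 0"
        proof -
          have "t * (g / 16 * X - 1/4 * (g * X)) + t * (g / 16 * X) = - (t * (g * X)) / 8"
            by (simp add: algebra_simps)
          then show ?thesis using t g X(1) by simp
        qed
        finally have "f (u x) < 0" .
        moreover have "0 \<le> f (u x)"
          using tq t unfolding x(3) q_def[symmetric] by (intro f_nonneg) linarith+
        ultimately show False by simp
      qed
    qed
  qed
qed

text \<open>At distance \<open>\<theta>R\<close> from the region where the bound is known, the contribution of that region is of
  order \<open>(\<theta>R) powr (- 2 * \<gamma>)\<close>, whereas the other side of the cone only costs \<open>R powr (- 2 * \<gamma>)\<close>.\<close>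

lemma saddle_lower_step:
  obtains \<theta> \<kappa> where "0 < \<theta>" "\<theta> < 1" "0 < \<kappa>"
    "\<And>R \<eta> p. 0 < R \<Longrightarrow> 0 < \<eta> \<Longrightarrow> (\<And>y. R \<le> cone_gap y \<Longrightarrow> \<eta> \<le> u y) \<Longrightarrow>
      (1 - \<theta>) * R \<le> cone_gap p \<Longrightarrow> \<kappa> * \<eta> \<le> u p"
proof -
  obtain C1 where C1: "C1 > 0" "\<And>p \<rho> x \<epsilon> \<beta> S. \<rho> > 0 \<Longrightarrow> 0 < bump p \<rho> x \<Longrightarrow> \<epsilon> > 0 \<Longrightarrow> S \<in> sets borel \<Longrightarrow>
    (\<And>y. y \<in> S \<Longrightarrow> \<epsilon> < norm (x - y)) \<Longrightarrow>
    (\<And>y. y \<in> S \<Longrightarrow> bump p \<rho> x - (bump p \<rho> y + bump p \<rho> (2 *\<^sub>R x - y)) / 2 \<le> - \<beta>) \<Longrightarrow>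
    truncated (bump p \<rho>) x \<epsilon> \<le> C1 * (\<rho> powr (- 2 * \<gamma>) * bump p \<rho> x powr (1 - \<gamma>)) - \<beta> * kernel_mass S x"
    by (rule truncated_bump_le) blast
  obtain C2 where C2: "C2 > 0" "\<And>A r x. A \<in> sets borel \<Longrightarrow> r > 0 \<Longrightarrow> (\<And>y. y \<in> A \<Longrightarrow> r \<le> norm (x - y)) \<Longrightarrow>
    kernel_mass A x \<le> C2 * r powr (- 2 * \<gamma>)"
    by (rule kernel_mass_upper) blast
  \<comment> \<open>The ball \<open>B\<close> below has radius \<theta>R and centre at distance
    4\<theta>R from x, so its points are within five radii of x.\<close>
  define g where "g = ball_mass_const 5"
  have g: "g > 0" by (simp add: g_def ball_mass_const_pos)
  \<comment> \<open>Limits \<theta> so that the loss C2 (R/4)^(-2\<gamma>) is at most g/8 times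
    (\<theta>R)^(-2\<gamma>).\<close>
  obtain s where s: "s > 0" "s powr (2 * \<gamma>) = g / (8 * C2)"
    using ex_powr_eq[of "2 * \<gamma>" "g / (8 * C2)"] \<gamma> g C2(1) by auto
  define \<theta> where "\<theta> = min (1/4) (s / 4)"
  have \<theta>: "0 < \<theta>" "\<theta> \<le> 1/4" "4 * \<theta> \<le> s" using s(1) by (auto simp: \<theta>_def)
  \<comment> \<open>The bound 1/2 leaves room for adding \<eta>/2 on \<open>B\<close> without
    exceeding \<eta>; the other bound keeps the cost of the bump at most g/8, in units of \<eta>
    (\<theta>R)^(-2\<gamma>).\<close>
  define \<kappa> where "\<kappa> = min (1/2) (g / (32 * C1))"
  have \<kappa>: "0 < \<kappa>" "\<kappa> \<le> 1/2" "4 * C1 * \<kappa> \<le> g / 8"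
  proof -
    show "0 < \<kappa>" "\<kappa> \<le> 1/2" using g C1(1) by (auto simp: \<kappa>_def)
    have "\<kappa> \<le> g / (32 * C1)" by (simp add: \<kappa>_def)
    then show "4 * C1 * \<kappa> \<le> g / 8" using C1(1) by (simp add: field_simps)
  qed
  show thesis
  proof (rule that[OF \<theta>(1) _ \<kappa>(1)])
    show "\<theta> < 1" using \<theta> by simp
    fix R \<eta> :: real and p :: "(real^'m) \<times> (real^'m)" assume R: "0 < R" and \<eta>: "0 < \<eta>" and lower: "\<And>y. R \<le> cone_gap y \<Longrightarrow> \<eta> \<le> u y"
      and p: "(1 - \<theta>) * R \<le> cone_gap p"
    define \<rho> where "\<rho> = \<theta> * R / 2"
    have \<rho>: "\<rho> > 0" using \<theta> R by (simp add: \<rho>_def)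
    have \<theta>R: "0 < \<theta> * R" "\<theta> * R \<le> R / 4" using \<theta> R mult_right_mono[OF \<theta>(2), of R] by auto
    have gap: "R / 2 \<le> cone_gap y" if "y \<in> cball p \<rho>" for y
      using cone_gap_diff_le[of p y] that p \<theta>R by (simp add: dist_norm \<rho>_def algebra_simps)
    have sub: "cball p \<rho> \<subseteq> cone_side"
    proof
      fix y assume "y \<in> cball p \<rho>"
      then show "y \<in> cone_side" using gap[of y] R by (simp add: cone_side_iff)
    qed
    show "\<kappa> * \<eta> \<le> u p"
    proof (rule ccontr)
      assume "\<not> \<kappa> * \<eta> \<le> u p"
      then obtain t x where t: "0 < t" "t < \<kappa> * \<eta>" and x: "0 < bump p \<rho> x" "x \<in> cball p \<rho>" "u x = t * bump p \<rho> x"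
        and below: "\<And>y. y \<in> cone_side \<Longrightarrow> t * bump p \<rho> y \<le> u y"
        using bump_touches_below[OF \<rho>(1) sub, of "\<kappa> * \<eta>"] \<kappa> \<eta> by auto
      define q where "q = bump p \<rho> x"
      have q: "0 < q" "q \<le> 1" using x(1) by (auto simp: q_def bump_le_1)
      have xO: "x \<in> cone_side" using x(2) sub by blast
      have "\<kappa> * \<eta> \<le> \<eta> / 2" using mult_right_mono[OF \<kappa>(2), of \<eta>] \<eta> by simp
      then have t2: "t < \<eta> / 2" using t by simp
      have tb: "0 \<le> t * bump p \<rho> y" "t * bump p \<rho> y \<le> t" for y
        using t bump_nonneg[of p \<rho> y] bump_le_1[of p \<rho> y] by (auto simp: mult_left_le)
      have "u x < \<eta>" using tb[of x] x(3) t2 \<eta> by simp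
      then have xR: "cone_gap x < R" using lower[of x] by linarith
      \<comment> \<open>The gap of x is at least R - 2\<theta>R. The shift by 4\<theta>R raises it
        to at least R + 2\<theta>R, and the radius \<theta>R costs at most 2\<theta>R, so
        \<open>B\<close> lies where u \<ge> \<eta> is known.\<close>
      obtain c where c: "cone_gap c = cone_gap x + 4 * (\<theta> * R)" "norm (x - c) = 4 * (\<theta> * R)"
      proof (rule cone_gap_shift_up[of "4 * (\<theta> * R)" x])
        show "0 \<le> 4 * (\<theta> * R)" using \<theta>R by linarith
      qed
      have pR: "R - 2 * (\<theta> * R) \<le> cone_gap y" if "y \<in> cball p \<rho>" for y
        using cone_gap_diff_le[of p y] that p by (simp add: dist_norm \<rho>_def algebra_simps)
      define B where "B = ball c (\<theta> * R)"
      have BR: "R \<le> cone_gap y" if "y \<in> B" for y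
        using that cone_gap_diff_le[of c y] c(1) pR[OF x(2)] by (simp add: B_def dist_norm)
      have B_dist: "\<theta> * R \<le> norm (x - y) \<and> norm (x - y) \<le> 5 * (\<theta> * R)" if "y \<in> B" for y
        using that c(2) \<theta>R norm_triangle_ineq[of "x - c" "c - y"] norm_triangle_ineq2[of "x - c" "y - c"]
        by (simp add: B_def dist_norm norm_minus_commute)
      have BO: "y \<in> cone_side" if "y \<in> B" for y using BR[OF that] R by (simp add: cone_side_iff)
      have [measurable]: "B \<in> sets borel" by (simp add: B_def)
      have xB: "x \<notin> B" using BR[of x] xR by auto
      define X where "X = (\<theta> * R) powr (- 2 * \<gamma>)"
      have X: "X > 0" using \<theta>(1) R by (simp add: X_def)
      have mass: "g * X \<le> kernel_mass B x"
        unfolding g_def X_def B_def using \<theta>R B_dist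
        by (intro kernel_mass_ball_lower[of _ _ "\<theta> * R"]) (auto simp: B_def)
      have loss: "kernel_mass reflected_side x \<le> g / 8 * X"
      proof -
        have "kernel_mass reflected_side x \<le> C2 * (R / 4) powr (- 2 * \<gamma>)"
        proof (rule C2(2))
          fix y assume "y \<in> reflected_side"
          then show "R / 4 \<le> norm (x - y)" using reflected_side_far[of y x] gap[OF x(2)] by simp
        qed (use R in auto)
        also have "(R / 4) powr (- 2 * \<gamma>) = X * (4 * \<theta>) powr (2 * \<gamma>)"
        proof -
          have "X = (R / 4 * (4 * \<theta>)) powr (- 2 * \<gamma>)" by (simp add: X_def mult.commute)
          also have "\<dots> = (R / 4) powr (- 2 * \<gamma>) * (4 * \<theta>) powr (- 2 * \<gamma>)"
            using R \<theta> by (subst powr_mult) auto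
          finally show ?thesis using \<theta> by (simp add: powr_minus)
        qed
        also have "C2 * (X * (4 * \<theta>) powr (2 * \<gamma>)) \<le> C2 * (X * s powr (2 * \<gamma>))"
          using C2(1) X \<theta> \<gamma> by (intro mult_left_mono powr_mono2) auto
        also have "\<dots> = g / 8 * X" using s(2) C2(1) by simp
        finally show ?thesis .
      qed
      have \<rho>X: "\<rho> powr (- 2 * \<gamma>) \<le> 4 * X"
      proof -
        have "\<rho> powr (- 2 * \<gamma>) = X * (1/2) powr (- 2 * \<gamma>)"
          using \<theta>R unfolding \<rho>_def X_def by (subst powr_mult[symmetric]) auto
        also have "(1/2) powr (- 2 * \<gamma>) = 2 powr (2 * \<gamma>)" by (simp add: powr_minus powr_divide)
        also have "2 powr (2 * \<gamma>) \<le> 2 powr (2::real)" using \<gamma> by (intro powr_mono) auto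
        also have "\<dots> = 4" by simp
        finally show ?thesis using X by (simp add: mult.commute)
      qed
      \<comment> \<open>The indicator of \<open>B\<close> imports the known bound; x lies outside
        \<open>B\<close>, so at x only the bump counts.\<close>
      define b where "b y = t * bump p \<rho> y + \<eta> / 2 * indicator B y" for y
      have [measurable]: "b \<in> borel_measurable borel" unfolding b_def by measurable
      have "f (u x) \<le> (\<kappa> * \<eta> * (C1 * (4 * X)) - \<eta> / 2 * (g * X)) + \<eta> * kernel_mass reflected_side x"
      proof (rule touching_barrier_le[of x \<eta> b "\<eta>", OF xO \<eta>])
        show "u x \<le> \<eta>" using \<open>u x < \<eta>\<close> by simp
        show "\<bar>b y\<bar> \<le> \<eta>" "b y \<le> \<eta>" for y
          using tb[of y] t2 \<eta> by (auto simp: b_def indicator_def)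
        show "b y \<le> u y" if "y \<in> cone_side" for y
          using below[OF that] lower[OF BR, of y] tb[of y] t2 by (cases "y \<in> B") (auto simp: b_def)
        show "b y \<le> 0" if "y \<notin> cone_side" for y
        proof -
          have "y \<notin> ball p \<rho>" using that sub ball_subset_cball by blast
          then have "bump p \<rho> y = 0" using bump_pos_iff[OF \<rho>(1), of p y] bump_nonneg[of p \<rho> y] by linarith
          moreover have "y \<notin> B" using that BO by blast
          ultimately show ?thesis by (simp add: b_def)
        qed
        show "b x = u x" using xB x(3) by (simp add: b_def)
        show "0 < \<theta> * R" using \<theta>R by simp
        fix \<epsilon> :: real assume \<epsilon>: "0 < \<epsilon>" "\<epsilon> < \<theta> * R"
        let ?D = "{y. \<epsilon> < norm (x - y)}"
        have i1: "set_integrable lebesgue ?D (\<lambda>y. (bump p \<rho> x - bump p \<rho> y) * K (x - y))"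
        proof (rule set_integrable_bounded_times_K[OF \<epsilon>(1), of _ 1])
          show "\<bar>bump p \<rho> x - bump p \<rho> y\<bar> \<le> 1" for y
            using bump_nonneg[of p \<rho> x] bump_nonneg[of p \<rho> y] bump_le_1[of p \<rho> x] bump_le_1[of p \<rho> y] by linarith
        qed (auto intro!: measurable_completion)
        have i2: "set_integrable lebesgue ?D (\<lambda>y. indicator B y * K (x - y))"
          by (rule set_integrable_bounded_times_K[OF \<epsilon>(1), of _ 1]) (auto simp: indicator_def intro!: measurable_completion)
        have "(b x - b y) * K (x - y) = t * ((bump p \<rho> x - bump p \<rho> y) * K (x - y)) - \<eta> / 2 * (indicator B y * K (x - y))" for y
          using xB by (simp add: b_def algebra_simps)
        then have "truncated b x \<epsilon> = t * truncated (bump p \<rho>) x \<epsilon> - \<eta> / 2 * (LINT y:?D|lebesgue. indicator B y * K (x - y))"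
          unfolding truncated_def
          by (simp only: set_integral_diff(2)[OF set_integrable_mult_right[OF i1] set_integrable_mult_right[OF i2]] set_integral_mult_right)
        also have "(LINT y:?D|lebesgue. indicator B y * K (x - y)) = kernel_mass B x"
          using B_dist \<epsilon> by (intro kernel_mass_eq_truncated) fastforce
        also have "truncated (bump p \<rho>) x \<epsilon> \<le> C1 * (\<rho> powr (- 2 * \<gamma>) * q powr (1 - \<gamma>))"
          using C1(2)[of \<rho> p x \<epsilon> "{}" 0] \<rho> x \<epsilon> by (simp add: q_def)
        also have "\<rho> powr (- 2 * \<gamma>) * q powr (1 - \<gamma>) \<le> 4 * X"
          using \<rho>X q \<gamma> powr_mono2[of "1 - \<gamma>" q 1] mult_left_le[of "q powr (1 - \<gamma>)" "\<rho> powr (- 2 * \<gamma>)"] by auto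
        finally have "truncated b x \<epsilon> \<le> t * (C1 * (4 * X)) - \<eta> / 2 * kernel_mass B x"
          using t C1(1) by simp
        moreover have "t * (C1 * (4 * X)) \<le> \<kappa> * \<eta> * (C1 * (4 * X))" using t X C1(1) by (intro mult_right_mono) auto
        moreover have "\<eta> / 2 * (g * X) \<le> \<eta> / 2 * kernel_mass B x" using mass \<eta> by simp
        ultimately show "truncated b x \<epsilon> \<le> \<kappa> * \<eta> * (C1 * (4 * X)) - \<eta> / 2 * (g * X)" by linarith
      qed (auto intro!: measurable_completion)
      also have "\<dots> \<le> \<eta> * X * (4 * C1 * \<kappa>) - \<eta> * X * g / 2 + \<eta> * (g / 8 * X)"
      proof -
        have "\<eta> * kernel_mass reflected_side x \<le> \<eta> * (g / 8 * X)"
          by (rule mult_left_mono[OF loss]) (use \<eta> in simp)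
        moreover have "\<kappa> * \<eta> * (C1 * (4 * X)) = \<eta> * X * (4 * C1 * \<kappa>)" "\<eta> / 2 * (g * X) = \<eta> * X * g / 2"
          by simp_all
        ultimately show ?thesis by linarith
      qed
      also have "\<dots> \<le> \<eta> * X * (g / 8) - \<eta> * X * g / 2 + \<eta> * (g / 8 * X)"
      proof -
        have "\<eta> * X * (4 * C1 * \<kappa>) \<le> \<eta> * X * (g / 8)"
          by (rule mult_left_mono[OF \<kappa>(3)]) (use \<eta> X in simp)
        then show ?thesis by linarith
      qed
      \<comment> \<open>Cost and loss of g/8 each against a gain of g/2.\<close>
      also have "\<dots> = - (\<eta> * X * g / 4)" by (simp add: field_simps)
      also have "\<dots> < 0" using \<eta> X g by simp
      finally have "f (u x) < 0" .
      moreover have "0 \<le> f (u x)"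
        using u_pos[OF xO] u_bound[of x] by (intro f_nonneg) auto
      ultimately show False by simp
    qed
  qed
qed

text \<open>Each step multiplies the gap reached by 1 - \<theta> and the bound by \<kappa>, so
  finitely many steps from the far region reach any positive gap, with a bound independent of the
  point.\<close>

lemma saddle_lower:
  assumes "\<epsilon> > 0"
  obtains \<eta> where "\<eta> > 0" "\<And>y. \<epsilon> \<le> cone_gap y \<Longrightarrow> \<eta> \<le> u y"
proof -
  obtain R where R: "R > 0" "\<And>p. R \<le> cone_gap p \<Longrightarrow> 1/2 \<le> u p"
    by (rule saddle_far_lower) blast
  obtain \<theta> \<kappa> where \<theta>: "0 < \<theta>" "\<theta> < 1" and \<kappa>: "0 < \<kappa>"
    and step: "\<And>R \<eta> p. 0 < R \<Longrightarrow> 0 < \<eta> \<Longrightarrow> (\<And>y. R \<le> cone_gap y \<Longrightarrow> \<eta> \<le> u y) \<Longrightarrow>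
      (1 - \<theta>) * R \<le> cone_gap p \<Longrightarrow> \<kappa> * \<eta> \<le> u p"
    by (rule saddle_lower_step) blast
  have iter: "(1 - \<theta>) ^ n * R \<le> cone_gap p \<Longrightarrow> \<kappa> ^ n * (1/2) \<le> u p" for n p
  proof (induction n arbitrary: p)
    case (Suc n)
    have "\<kappa> * (\<kappa> ^ n * (1/2)) \<le> u p"
      using Suc.prems \<theta> \<kappa> R(1) by (intro step[of "(1 - \<theta>) ^ n * R"] Suc.IH) (auto simp: mult.assoc)
    then show ?case by simp
  qed (use R(2) in simp)
  obtain n where "(1 - \<theta>) ^ n < \<epsilon> / R"
    using real_arch_pow_inv[of "\<epsilon> / R" "1 - \<theta>"] assms R \<theta> by auto
  then have "(1 - \<theta>) ^ n * R \<le> \<epsilon>" using R(1) by (simp add: field_simps)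
  then show thesis using iter[of n] \<kappa> by (intro that[of "\<kappa> ^ n * (1/2)"]) auto
qed

end

section \<open>The maximum principle\<close>

lemma strictly_convex_on_imp_convex_on:
  assumes "strictly_convex_on S g"
  shows "convex_on S g"
proof (rule convex_onI)
  show "convex S" using assms by (simp add: strictly_convex_on_def)
  fix t x y :: real assume "0 < t" "t < 1" "x \<in> S" "y \<in> S"
  then have "x \<noteq> y \<Longrightarrow> g ((1 - t) * x + t * y) < (1 - t) * g x + t * g y"
    using assms unfolding strictly_convex_on_def by blast
  then show "g ((1 - t) *\<^sub>R x + t *\<^sub>R y) \<le> (1 - t) * g x + t * g y"
    by (cases "x = y") (simp_all add: algebra_simps)
qed

text \<open>The last claim makes \<open>u\<close> a strict supersolution of its linearised equation.\<close>

lemma bistable_nonlinearity: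
  fixes f :: "real \<Rightarrow> real"
  assumes C1: "f C1_differentiable_on UNIV" and odd: "\<And>t. f (- t) = - f t" and f1: "f 1 = 0"
    and conc: "strictly_concave_on {0<..<1} f"
  shows "continuous_on UNIV f" and "continuous_on UNIV (deriv f)"
    and "\<And>t. 0 \<le> t \<Longrightarrow> t \<le> 1 \<Longrightarrow> 0 \<le> f t"
    and "0 < f (1/2)"
    and "\<And>t. 0 \<le> t \<Longrightarrow> t \<le> 1/2 \<Longrightarrow> 2 * f (1/2) * t \<le> f t"
    and "\<And>t. 0 < t \<Longrightarrow> t \<le> 1 \<Longrightarrow> deriv f t * t < f t"
proof -
  obtain D where D: "\<And>x. (f has_vector_derivative D x) (at x)" "continuous_on UNIV D"
    using C1 by (auto simp: C1_differentiable_on_def)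
  then have fD: "(f has_real_derivative D x) (at x)" for x
    by (simp add: has_real_derivative_iff_has_vector_derivative)
  then have dD: "deriv f = D" by (auto intro!: DERIV_imp_deriv)
  show "continuous_on UNIV (deriv f)" using D(2) by (simp add: dD)
  have cont: "isCont f x" for x using fD by (rule DERIV_isCont)
  then show "continuous_on UNIV f" by (simp add: continuous_at_imp_continuous_on)
  have contD: "isCont D x" for x using D(2) by (simp add: continuous_on_eq_continuous_at)
  have f0: "f 0 = 0" using odd[of 0] by simp
  have cvx: "convex_on {0<..<1} (\<lambda>x. - f x)"
    using conc unfolding strictly_concave_on_def by (rule strictly_convex_on_imp_convex_on)
  have strict: "(1 - r) * f x + r * f y < f ((1 - r) * x + r * y)"
    if "0 < x" "x < 1" "0 < y" "y < 1" "x \<noteq> y" "0 < r" "r < 1" for x y r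
  proof -
    have "- f ((1 - r) * x + r * y) < (1 - r) * (- f x) + r * (- f y)"
      using conc that unfolding strictly_concave_on_def strictly_convex_on_def by auto
    then show ?thesis by (simp add: algebra_simps)
  qed
  \<comment> \<open>Concavity is given on the open interval only: the end 0 of the chord is reached
    by a limit here, the value t = 1 by another limit in \<open>lin\<close>. Such limits keep weak
    inequalities only.\<close>
  have lin0: "s * f t \<le> f (s * t)" if s: "0 \<le> s" "s \<le> 1" and t: "0 < t" "t < 1" for s t
  proof (cases "0 < s \<and> s < 1")
    case True
    have "((\<lambda>x. (1 - s) * f x + s * f t) \<longlongrightarrow> (1 - s) * f 0 + s * f t) (at_right 0)"
      by (intro tendsto_intros isCont_tendsto_compose[OF cont])
    moreover have "((\<lambda>x. f ((1 - s) * x + s * t)) \<longlongrightarrow> f ((1 - s) * 0 + s * t)) (at_right 0)"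
      by (intro isCont_tendsto_compose[OF cont] tendsto_intros)
    moreover have "\<forall>\<^sub>F x in at_right 0. (1 - s) * f x + s * f t \<le> f ((1 - s) * x + s * t)"
      using eventually_at_right_less[OF t(1)]
    proof eventually_elim
      case (elim x)
      then show ?case using strict[of x t s] True t by simp
    qed
    ultimately have "(1 - s) * f 0 + s * f t \<le> f ((1 - s) * 0 + s * t)"
      by (intro tendsto_le[OF _ _ ]) auto
    then show ?thesis by (simp add: f0)
  next
    case False
    then have "s = 0 \<or> s = 1" using s by linarith
    then show ?thesis by (auto simp: f0)
  qed
  have lin: "s * f t \<le> f (s * t)" if s: "0 \<le> s" "s \<le> 1" and t: "0 < t" "t \<le> 1" for s t
  proof (cases "t = 1")
    case True
    have "((\<lambda>x. s * f x) \<longlongrightarrow> s * f 1) (at_left 1)" "((\<lambda>x. f (s * x)) \<longlongrightarrow> f (s * 1)) (at_left 1)"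
      by (intro isCont_tendsto_compose[OF cont] tendsto_intros)+
    moreover have "\<forall>\<^sub>F x in at_left 1. s * f x \<le> f (s * x)"
      using eventually_at_left_real[OF zero_less_one]
    proof eventually_elim
      case (elim x)
      then show ?case using lin0[OF s, of x] by simp
    qed
    ultimately have "s * f 1 \<le> f (s * 1)"
      by (intro tendsto_le[of "at_left (1::real)"]) auto
    then show ?thesis using True by simp
  qed (use lin0[OF s] t in simp)
  show nn: "0 \<le> f t" if "0 \<le> t" "t \<le> 1" for t
    using lin[of t 1] that by (simp add: f1)
  \<comment> \<open>Strictness is recovered between t/4 and 3t/4, which stay inside the open
    interval even for t = 1 and have midpoint t/2.\<close>
  have mid: "f t / 2 < f (t / 2)" if "0 < t" "t \<le> 1" for t
  proof -
    have "(1 - 1/2) * f (1/4 * t) + 1/2 * f (3/4 * t) < f ((1 - 1/2) * (1/4 * t) + 1/2 * (3/4 * t))"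
      using that by (intro strict) auto
    moreover have "1/4 * f t \<le> f (1/4 * t)" "3/4 * f t \<le> f (3/4 * t)"
      using lin[of "1/4" t] lin[of "3/4" t] that by auto
    moreover have "(1 - 1/2) * (1/4 * t) + 1/2 * (3/4 * t) = t / 2" by simp
    ultimately show ?thesis by simp
  qed
  show "0 < f (1/2)" using mid[of 1] by (simp add: f1)
  show "2 * f (1/2) * t \<le> f t" if "0 \<le> t" "t \<le> 1/2" for t
    using lin[of "2 * t" "1/2"] that by (simp add: ac_simps)
  have tangent0: "f (t / 2) \<le> f t - D t * t / 2" if "0 < t" "t < 1" for t
  proof -
    have "(- f (t / 2)) - (- f t) \<ge> (- D t) * (t / 2 - t)"
    proof (rule convex_on_imp_above_tangent[OF cvx])
      show "((\<lambda>x. - f x) has_real_derivative - D t) (at t within {0<..<1})"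
        by (rule has_field_derivative_at_within) (rule DERIV_minus[OF fD])
    qed (use that in \<open>auto simp: interior_open\<close>)
    then show ?thesis by (simp add: field_simps)
  qed
  have tangent: "f (t / 2) \<le> f t - D t * t / 2" if "0 < t" "t \<le> 1" for t
  proof (cases "t = 1")
    case True
    have "((\<lambda>x. f (x / 2)) \<longlongrightarrow> f (1 / 2)) (at_left 1)" "((\<lambda>x. f x - D x * x / 2) \<longlongrightarrow> f 1 - D 1 * 1 / 2) (at_left 1)"
      by (intro isCont_tendsto_compose[OF cont] isCont_tendsto_compose[OF contD] tendsto_intros; simp)+
    moreover have "\<forall>\<^sub>F x in at_left 1. f (x / 2) \<le> f x - D x * x / 2"
      using eventually_at_left_real[OF zero_less_one]
    proof eventually_elim
      case (elim x)
      then show ?case using tangent0[of x] by simp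
    qed
    ultimately have "f (1 / 2) \<le> f 1 - D 1 * 1 / 2"
      by (intro tendsto_le[of "at_left (1::real)"]) auto
    then show ?thesis using True by simp
  qed (use tangent0 that in simp)
  \<comment> \<open>At t/2 the tangent at t lies above f(t/2), which exceeds f(t)/2.\<close>
  show "deriv f t * t < f t" if "0 < t" "t \<le> 1" for t
    using tangent[OF that] mid[OF that] by (simp add: dD)
qed

lemma c_const_pos:
  assumes "0 < \<gamma>" "\<gamma> < 1"
  shows "0 < c_const n \<gamma>"
  using assms unfolding c_const_def
  by (intro divide_pos_pos mult_pos_pos Gamma_real_pos) (auto intro: add_nonneg_pos)

context saddle_solution
begin

text \<open>With \<open>s\<close> the sign of \<open>cone_gap\<close>, the function \<open>u + \<delta> s\<close> is a strict supersolution that is bounded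
  below by \<open>\<delta>\<close>: near the cone the jump of \<open>s\<close> contributes a large positive term, and away from the
  cone \<open>u\<close> itself is a uniformly strict supersolution.\<close>

lemma strict_supersolution:
  assumes f_cont: "continuous_on UNIV f" and cont: "continuous_on UNIV (deriv f)"
    and strict: "\<And>t. 0 < t \<Longrightarrow> t \<le> 1 \<Longrightarrow> deriv f t * t < f t"
  obtains \<delta> where "0 < \<delta>" "\<And>x. x \<in> cone_side \<Longrightarrow>
    0 < f (u x) - deriv f (u x) * u x + \<delta> * (2 * kernel_mass reflected_side x - deriv f (u x))"
proof -
  have "continuous_on {0..1} (\<lambda>t. \<bar>deriv f t\<bar>)"
    by (intro continuous_intros continuous_on_subset[OF cont]) auto
  then obtain t0 where t0: "\<forall>t\<in>{0..1}. \<bar>deriv f t\<bar> \<le> \<bar>deriv f t0\<bar>"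
    using continuous_attains_sup[of "{0..1::real}" "\<lambda>t. \<bar>deriv f t\<bar>"] by force
  define L where "L = \<bar>deriv f t0\<bar> + 1"
  have L: "L > 0" "\<And>t. 0 \<le> t \<Longrightarrow> t \<le> 1 \<Longrightarrow> \<bar>deriv f t\<bar> \<le> L"
    using t0 by (force simp: L_def)+
  \<comment> \<open>For gaps below 2s the ball bound already makes the mass beyond the cone at least
    L.\<close>
  obtain s where s: "s > 0" "s powr (- 2 * \<gamma>) = L / ball_mass_const 7"
    using ex_powr_eq[of "- 2 * \<gamma>" "L / ball_mass_const 7"] \<gamma> L(1) ball_mass_const_pos[of 7] by auto
  obtain \<eta> where \<eta>: "\<eta> > 0" "\<And>y. 2 * s \<le> cone_gap y \<Longrightarrow> \<eta> \<le> u y"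
    using saddle_lower[of "2 * s"] s(1) by auto
  \<comment> \<open>Capped at 1 so that {\<eta>'..1} is nonempty and the minimum m exists.\<close>
  define \<eta>' where "\<eta>' = min \<eta> 1"
  have "continuous_on {\<eta>'..1} (\<lambda>t. f t - deriv f t * t)"
    by (intro continuous_intros continuous_on_subset[OF cont] continuous_on_subset[OF f_cont]) auto
  then obtain t1 where t1: "t1 \<in> {\<eta>'..1}" "\<And>t. t \<in> {\<eta>'..1} \<Longrightarrow> f t1 - deriv f t1 * t1 \<le> f t - deriv f t * t"
    using continuous_attains_inf[of "{\<eta>'..1}" "\<lambda>t. f t - deriv f t * t"] by (auto simp: \<eta>'_def)
  define m where "m = f t1 - deriv f t1 * t1"
  have m: "m > 0" using strict[of t1] t1(1) \<eta>(1) by (auto simp: m_def \<eta>'_def)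
  show thesis
  \<comment> \<open>Away from the cone the \<delta> term can lose at most \<delta>L = m/2 of the
    margin m.\<close>
  proof (rule that[of "m / (2 * L)"])
    show \<delta>: "0 < m / (2 * L)" using m L by simp
    fix x :: "(real^'m) \<times> (real^'m)" assume x: "x \<in> cone_side"
    have ux: "0 < u x" "u x \<le> 1" using u_pos[OF x] u_bound[of x] by auto
    have d: "0 < cone_gap x" using x by (simp add: cone_side_iff)
    have mass: "ball_mass_const 7 * (cone_gap x / 2) powr (- 2 * \<gamma>) \<le> kernel_mass reflected_side x"
      by (rule reflected_mass_lower[OF x])
    have dL: "deriv f (u x) \<le> L" using L(2)[of "u x"] ux by auto
    show "0 < f (u x) - deriv f (u x) * u x + m / (2 * L) * (2 * kernel_mass reflected_side x - deriv f (u x))"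
    proof (cases "cone_gap x < 2 * s")
      case True
      have "s powr (- 2 * \<gamma>) \<le> (cone_gap x / 2) powr (- 2 * \<gamma>)"
        using True d \<gamma> by (intro powr_mono2') auto
      then have "L \<le> ball_mass_const 7 * (cone_gap x / 2) powr (- 2 * \<gamma>)"
        unfolding s(2) using ball_mass_const_pos[of 7] by (simp add: field_simps)
      then have "0 \<le> 2 * kernel_mass reflected_side x - deriv f (u x)" using mass dL L(1) by linarith
      then have "0 \<le> m / (2 * L) * (2 * kernel_mass reflected_side x - deriv f (u x))"
        using \<delta> by (intro mult_nonneg_nonneg) simp_all
      then show ?thesis using strict[OF ux] by linarith
    next
      case False
      then have "u x \<in> {\<eta>'..1}" using \<eta>(2)[of x] ux by (auto simp: \<eta>'_def)
      then have 1: "m \<le> f (u x) - deriv f (u x) * u x" using t1(2) by (simp add: m_def)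
      have "0 \<le> ball_mass_const 7 * (cone_gap x / 2) powr (- 2 * \<gamma>)"
        using ball_mass_const_pos[of 7] by simp
      then have "- L \<le> 2 * kernel_mass reflected_side x - deriv f (u x)" using mass dL by linarith
      then have "m / (2 * L) * (- L) \<le> m / (2 * L) * (2 * kernel_mass reflected_side x - deriv f (u x))"
        using \<delta> by (intro mult_left_mono) auto
      moreover have "m / (2 * L) * (- L) = - m / 2" using L(1) by simp
      ultimately show ?thesis using 1 m by linarith
    qed
  qed
qed

lemma linearized_maximum_principle:
  fixes v c :: "(real^'m) \<times> (real^'m) \<Rightarrow> real"
  assumes f_cont: "continuous_on UNIV f" and cont: "continuous_on UNIV (deriv f)"
    and strict: "\<And>t. 0 < t \<Longrightarrow> t \<le> 1 \<Longrightarrow> deriv f t * t < f t"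
    and \<Omega>: "\<Omega> \<subseteq> cone_side"
    and v: "v \<in> borel_measurable lebesgue" "doubly_radial v" "cone_odd v" "continuous_on (closure \<Omega>) v"
    and c: "\<And>x. x \<in> \<Omega> \<Longrightarrow> c x \<le> 0"
    and eq: "\<And>x. x \<in> \<Omega> \<Longrightarrow> \<exists>l. has_LK K v x l \<and> l - deriv f (u x) * v x - c x * v x \<le> 0"
    and out: "\<And>x. x \<in> cone_side - \<Omega> \<Longrightarrow> v x \<le> 0"
    and inf: "Limsup (inf at_infinity (principal \<Omega>)) (\<lambda>x. ereal (v x)) \<le> 0"
    and x0: "x0 \<in> \<Omega>"
  shows "v x0 \<le> 0"
proof (rule ccontr)
  assume "\<not> v x0 \<le> 0"
  then have v0: "0 < v x0" by simp
  obtain \<delta> where \<delta>: "0 < \<delta>" and super: "\<And>x. x \<in> cone_side \<Longrightarrow>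
    0 < f (u x) - deriv f (u x) * u x + \<delta> * (2 * kernel_mass reflected_side x - deriv f (u x))"
    by (rule strict_supersolution[OF f_cont cont strict]) blast+
  have u_cl: "0 \<le> u x" if "x \<in> closure \<Omega>" for x
  proof -
    have "closure \<Omega> \<subseteq> {x. 0 \<le> cone_gap x}"
    proof (rule closure_minimal)
      show "\<Omega> \<subseteq> {x. 0 \<le> cone_gap x}" using \<Omega> by (auto simp: cone_side_iff less_imp_le)
      show "closed {x :: (real^'m) \<times> (real^'m). 0 \<le> cone_gap x}"
        by (intro closed_Collect_le continuous_on_cone_gap continuous_on_const)
    qed
    then have "0 \<le> cone_gap x" using that by blast
    then show ?thesis using u_pos[of x] u_sign(2)[of x] by (cases "cone_gap x = 0") (auto simp: cone_side_iff)
  qed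
  define h where "h x = v x / (u x + \<delta>)" for x
  have h0: "0 < h x0" using v0 \<delta> u_cl[of x0] x0 closure_subset[of \<Omega>] by (auto simp: h_def intro!: divide_pos_pos)
  have "\<forall>\<^sub>F x in inf at_infinity (principal \<Omega>). ereal (v x) < ereal (h x0 * \<delta>)"
    by (rule Limsup_lessD) (use inf h0 \<delta> in \<open>auto intro: le_less_trans\<close>)
  \<comment> \<open>Since u + \<delta> \<ge> \<delta> in \<Omega>, the level h x0 \<delta> for v
    forces the quotient below h x0 outside radius R, so its supremum is sought on a compact
    set.\<close>
  then obtain R where R: "\<And>x. R \<le> norm x \<Longrightarrow> x \<in> \<Omega> \<Longrightarrow> v x < h x0 * \<delta>"
    by (auto simp: eventually_inf_principal eventually_at_infinity)
  have far: "h x < h x0" if "R \<le> norm x" "x \<in> \<Omega>" for x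
  proof -
    have u: "0 < u x" using that \<Omega> u_pos by blast
    have "v x < h x0 * (u x + \<delta>)" using R[OF that] h0 u by (simp add: distrib_left add_pos_pos less_trans)
    then show ?thesis using u \<delta> by (simp add: h_def pos_divide_less_eq)
  qed
  then have x0R: "norm x0 \<le> R" using x0 by (metis less_irrefl linear)
  define C where "C = closure \<Omega> \<inter> cball 0 R"
  have "compact C" unfolding C_def by (intro closed_Int_compact) auto
  moreover have "x0 \<in> C" using x0 x0R closure_subset by (auto simp: C_def)
  moreover have "continuous_on C h"
    unfolding h_def using u_cl \<delta>
    by (intro continuous_intros continuous_on_subset[OF v(4)] continuous_on_subset[OF u_continuous])
      (fastforce simp: C_def)+
  ultimately obtain x where x: "x \<in> C" "\<And>y. y \<in> C \<Longrightarrow> h y \<le> h x"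
    using continuous_attains_sup[of C h] by blast
  define \<tau> where "\<tau> = h x"
  have \<tau>: "0 < \<tau>" using x(2)[OF \<open>x0 \<in> C\<close>] h0 by (simp add: \<tau>_def)
  have "x \<in> closure \<Omega>" using x(1) by (simp add: C_def)
  have vx: "0 < v x"
    using \<tau> u_cl[OF \<open>x \<in> closure \<Omega>\<close>] \<delta> by (simp add: \<tau>_def h_def zero_less_divide_iff)
  \<comment> \<open>The maximum point lies in \<Omega> and not merely in its closure: v vanishes on
    the cone by oddness and is nonpositive in \<open>cone_side - \<Omega>\<close>, while v x >
    0.\<close>
  have "cone_gap x \<noteq> 0"
    using cone_odd_doubly_radial_zero[OF v(3,2)] vx by fastforce
  moreover have "0 \<le> cone_gap x"
    using u_cl[OF \<open>x \<in> closure \<Omega>\<close>] u_sign(1)[of x] by linarith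
  ultimately have xO: "x \<in> cone_side" by (simp add: cone_side_iff)
  then have x\<Omega>: "x \<in> \<Omega>" using out[of x] vx by force
  have below: "v y \<le> \<tau> * (u y + \<delta>)" if y: "y \<in> cone_side" for y
  proof (cases "y \<in> \<Omega>")
    case True
    have "h y \<le> \<tau>"
    proof (cases "norm y \<le> R")
      case True
      then have "y \<in> C" using \<open>y \<in> \<Omega>\<close> closure_subset by (auto simp: C_def)
      then show ?thesis using x(2) by (simp add: \<tau>_def)
    next
      case False
      then show ?thesis using far[of y] \<open>y \<in> \<Omega>\<close> x(2)[OF \<open>x0 \<in> C\<close>] by (simp add: \<tau>_def)
    qed
    then show ?thesis using u_pos[OF y] \<delta> by (simp add: h_def pos_divide_le_eq)
  next
    case False
    then have "v y \<le> 0" using out y by blast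
    also have "0 \<le> \<tau> * (u y + \<delta>)" using \<tau> u_pos[OF y] \<delta> by simp
    finally show ?thesis .
  qed
  have touch: "v x = \<tau> * (u x + \<delta>)"
    using u_pos[OF xO] \<delta> by (simp add: \<tau>_def h_def)
  define s :: "(real^'m) \<times> (real^'m) \<Rightarrow> real" where "s y = sgn (cone_gap y)" for y
  have s1: "s y = 1" if "y \<in> cone_side" for y using that by (simp add: s_def cone_side_iff)
  have [measurable]: "s \<in> borel_measurable borel" unfolding s_def by measurable
  have [measurable]: "v \<in> borel_measurable lebesgue" by (rule v)
  have [measurable]: "u \<in> borel_measurable lebesgue" "s \<in> borel_measurable lebesgue"
    by (auto intro: measurable_completion)
  \<comment> \<open>The factor \<open>s\<close> in front of \<delta> makes \<open>W\<close> odd; in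
    \<open>cone_side\<close>, where v was compared, it equals 1.\<close>
  define W where "W y = \<tau> * (u y + \<delta> * s y) - v y" for y
  have W_meas: "W \<in> borel_measurable lebesgue" unfolding W_def by measurable
  have W_dr: "doubly_radial W"
    using u_radial v(2) unfolding doubly_radial_def W_def s_def cone_gap_def by metis
  have W_odd: "cone_odd W"
    unfolding cone_odd_def
  proof
    fix y
    have "v y = - v (prod.swap y)" using v(3) unfolding cone_odd_def by (rule spec)
    then show "W y = - W (prod.swap y)"
      by (simp add: W_def s_def u_swap cone_gap_swap sgn_minus algebra_simps)
  qed
  have W_pos: "0 \<le> W y" if "y \<in> cone_side" for y using below[OF that] s1[OF that] by (simp add: W_def)
  obtain l where l: "has_LK K v x l" "l - deriv f (u x) * v x - c x * v x \<le> 0"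
    using eq[OF x\<Omega>] by blast
  define J where "J \<epsilon> = {y. \<epsilon> < norm (x - y)}" for \<epsilon> :: real
  have iv: "set_integrable lebesgue (J \<epsilon>) (\<lambda>y. (v x - v y) * K (x - y))" if "\<epsilon> > 0" for \<epsilon>
    using l(1) that by (simp add: has_LK_def J_def)
  have iu: "set_integrable lebesgue (J \<epsilon>) (\<lambda>y. (u x - u y) * K (x - y))" if "\<epsilon> > 0" for \<epsilon>
    using u_eq[of x] that by (simp add: has_LK_def J_def)
  have ik: "set_integrable lebesgue (J \<epsilon>) (\<lambda>y. (1 - s y) * K (x - y))" if "\<epsilon> > 0" for \<epsilon>
    unfolding J_def
  proof (rule set_integrable_bounded_times_K[OF that, of _ 2])
    show "\<bar>1 - s y\<bar> \<le> 2" for y by (simp add: s_def sgn_if)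
  qed measurable
  have W_split: "W y * K (x - y) = (v x - v y) * K (x - y) - \<tau> * ((u x - u y) * K (x - y)) - \<tau> * \<delta> * ((1 - s y) * K (x - y))" for y
    by (simp add: W_def touch algebra_simps)
  have W_int: "set_integrable lebesgue (J \<epsilon>) (\<lambda>y. W y * K (x - y))" if "\<epsilon> > 0" for \<epsilon>
    unfolding W_split using that by (intro set_integral_diff set_integrable_mult_right iv iu ik)
  define d where "d = cone_gap x / 2"
  have d: "d > 0" using xO by (simp add: d_def cone_side_iff)
  have W_le: "(LINT y:J \<epsilon>|lebesgue. W y * K (x - y))
      \<le> truncated v x \<epsilon> - \<tau> * truncated u x \<epsilon> - \<tau> * \<delta> * (2 * kernel_mass reflected_side x)"
    if \<epsilon>: "0 < \<epsilon>" "\<epsilon> < d" for \<epsilon>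
  proof -
    have "2 * kernel_mass reflected_side x = (LINT y:J \<epsilon>|lebesgue. 2 * (indicator reflected_side y * K (x - y)))"
      unfolding J_def set_integral_mult_right
    proof (subst kernel_mass_eq_truncated)
      fix y assume "y \<in> reflected_side"
      then show "\<epsilon> < norm (x - y)" using reflected_side_far[of y x] \<epsilon> by (simp add: d_def)
    qed simp
    \<comment> \<open>\<open>1 - s y\<close> is 0 in front of the cone, 1 on it and 2 beyond it, so
      a pointwise inequality suffices and the measure of the cone does not enter.\<close>
    also have "\<dots> \<le> (LINT y:J \<epsilon>|lebesgue. (1 - s y) * K (x - y))"
    proof (rule set_integral_mono)
      show "set_integrable lebesgue (J \<epsilon>) (\<lambda>y. 2 * (indicator reflected_side y * K (x - y)))"
        unfolding J_def
        by (intro set_integrable_mult_right set_integrable_bounded_times_K[OF \<epsilon>(1), of _ 1])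
          (auto simp: indicator_def intro!: measurable_completion)
      fix y assume "y \<in> J \<epsilon>"
      then have "x - y \<noteq> 0" using \<epsilon> by (auto simp: J_def)
      then have "0 \<le> K (x - y)" by (rule nonneg)
      moreover have "2 * indicator reflected_side y \<le> 1 - s y"
        by (auto simp: s_def reflected_side_def sgn_if indicator_def)
      ultimately have "2 * indicator reflected_side y * K (x - y) \<le> (1 - s y) * K (x - y)"
        by (rule mult_right_mono[rotated])
      then show "2 * (indicator reflected_side y * K (x - y)) \<le> (1 - s y) * K (x - y)" by simp
    qed (rule ik[OF \<epsilon>(1)])
    finally have "\<tau> * \<delta> * (2 * kernel_mass reflected_side x) \<le> \<tau> * \<delta> * (LINT y:J \<epsilon>|lebesgue. (1 - s y) * K (x - y))"
      using \<tau> \<delta> by (intro mult_left_mono) auto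
    moreover have "(LINT y:J \<epsilon>|lebesgue. W y * K (x - y))
      = truncated v x \<epsilon> - \<tau> * truncated u x \<epsilon> - \<tau> * \<delta> * (LINT y:J \<epsilon>|lebesgue. (1 - s y) * K (x - y))"
      unfolding W_split truncated_def J_def[symmetric]
      by (simp only: set_integral_mult_right
          set_integral_diff(2)[OF set_integral_diff(1)[OF iv[OF \<epsilon>(1)] set_integrable_mult_right[OF iu[OF \<epsilon>(1)]]]
            set_integrable_mult_right[OF ik[OF \<epsilon>(1)]]]
          set_integral_diff(2)[OF iv[OF \<epsilon>(1)] set_integrable_mult_right[OF iu[OF \<epsilon>(1)]]])
    ultimately show ?thesis by linarith
  qed
  have lim: "((\<lambda>\<epsilon>. truncated v x \<epsilon> - \<tau> * truncated u x \<epsilon> - \<tau> * \<delta> * (2 * kernel_mass reflected_side x))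
      \<longlongrightarrow> l - \<tau> * f (u x) - \<tau> * \<delta> * (2 * kernel_mass reflected_side x)) (at_right 0)"
    using l(1) u_eq[of x] by (intro tendsto_intros) (simp_all add: has_LK_def truncated_def)
  \<comment> \<open>The truncated operators of v and u converge, the jump term is constant in
    \<epsilon>, and the integrals of \<open>W\<close> have nonnegative limit inferior.\<close>
  have "0 \<le> l - \<tau> * f (u x) - \<tau> * \<delta> * (2 * kernel_mass reflected_side x)"
  proof (rule field_le_epsilon)
    fix e :: real assume e: "e > 0"
    have "\<forall>\<^sub>F \<epsilon> in at_right 0. - e \<le> (LINT y:J \<epsilon>|lebesgue. W y * K (x - y))"
      unfolding J_def
      by (rule truncated_integral_lower[OF xO W_meas W_dr W_odd W_pos W_int[unfolded J_def] e])
    then have "\<forall>\<^sub>F \<epsilon> in at_right 0. - e \<le> truncated v x \<epsilon> - \<tau> * truncated u x \<epsilon> - \<tau> * \<delta> * (2 * kernel_mass reflected_side x)"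
      using eventually_at_right_less[OF d]
    proof eventually_elim
      case (elim \<epsilon>)
      then show ?case using W_le[of \<epsilon>] by simp
    qed
    then have "- e \<le> l - \<tau> * f (u x) - \<tau> * \<delta> * (2 * kernel_mass reflected_side x)"
      by (rule tendsto_lowerbound[OF lim]) simp
    then show "0 \<le> l - \<tau> * f (u x) - \<tau> * \<delta> * (2 * kernel_mass reflected_side x) + e" by simp
  qed
  moreover have "l \<le> deriv f (u x) * (\<tau> * (u x + \<delta>))"
  proof -
    have "c x * v x \<le> 0" using c[OF x\<Omega>] vx by (simp add: mult_nonpos_nonneg)
    then have "l \<le> deriv f (u x) * v x" using l(2) by linarith
    then show ?thesis by (simp only: touch)
  qed
  ultimately have "\<tau> * (f (u x) - deriv f (u x) * u x + \<delta> * (2 * kernel_mass reflected_side x - deriv f (u x))) \<le> 0"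
    by (simp add: algebra_simps)
  then show False using super[OF xO] \<tau> by (simp add: mult_le_0_iff)
qed

end

theorem proposition1p4:
  fixes f :: "real \<Rightarrow> real"
    and \<gamma> lam Lam \<alpha> :: real
    and \<Omega> :: "((real^'m) \<times> (real^'m)) set"
    and K u v c :: "(real^'m) \<times> (real^'m) \<Rightarrow> real"
    and k :: "real \<Rightarrow> real"
  assumes "f C1_differentiable_on UNIV"
    and "\<And>t. f (- t) = - f t"
    and "f 1 = 0" and "f (- 1) = 0"
    and "strictly_concave_on {0<..<1} f"
    and "0 < \<gamma>" and "\<gamma> < 1"
    and "0 < lam" and "lam \<le> Lam"
    and "open \<Omega>" and "\<Omega> \<subseteq> cone_side"
    and "\<And>z. z \<noteq> 0 \<Longrightarrow> K z = k (norm z)"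
    and "strictly_convex_on {0<..} (\<lambda>\<tau>. k (sqrt \<tau>))"
    and "L0_class \<gamma> lam Lam K"
    and "saddle_shaped_solution K f u"
    and "\<And>x. \<bar>u x\<bar> \<le> 1"
    and "v \<in> L1_gamma \<gamma>"
    and "doubly_radial v"
    and "\<alpha> > 2 * \<gamma>" and "C_alpha_on \<alpha> \<Omega> v"
    and "continuous_on (closure \<Omega>) v"
    and "\<And>x. x \<in> \<Omega> \<Longrightarrow> c x \<le> 0"
    and "\<And>x. x \<in> \<Omega> \<Longrightarrow>
           \<exists>l. has_LK K v x l \<and> l - deriv f (u x) * v x - c x * v x \<le> 0"
    and "\<And>x. x \<in> cone_side - \<Omega> \<Longrightarrow> v x \<le> 0"
    and "\<And>x. - v (prod.swap x) = v x"
    and "Limsup (inf at_infinity (principal \<Omega>)) (\<lambda>x. ereal (v x)) \<le> 0"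
  shows "\<forall>x\<in>\<Omega>. v x \<le> 0"
proof
  fix x assume x: "x \<in> \<Omega>"
  let ?n = "DIM((real^'m) \<times> (real^'m))"
  note f = bistable_nonlinearity[OF assms(1-3,5)]
  note u = assms(15)[unfolded saddle_shaped_solution_def]
  have c: "0 < c_const ?n \<gamma>" by (rule c_const_pos) fact+
  have low: "lam * c_const ?n \<gamma> * norm z powr (- real ?n - 2 * \<gamma>) \<le> K z"
    and up: "K z \<le> Lam * c_const ?n \<gamma> * norm z powr (- real ?n - 2 * \<gamma>)" if "z \<noteq> 0" for z
    using assms(14) that unfolding L0_class_def by blast+
  interpret saddle_solution K k \<gamma> "lam * c_const ?n \<gamma>" "Lam * c_const ?n \<gamma>" f u "2 * f (1/2)"
  proof
    show "convex_on {0<..} (\<lambda>\<tau>. k (sqrt \<tau>))"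
      by (rule strictly_convex_on_imp_convex_on) fact
    show "0 \<le> K z" if "z \<noteq> 0" for z
    proof -
      have "0 \<le> lam * c_const ?n \<gamma> * norm z powr (- real ?n - 2 * \<gamma>)"
        using assms(8) c by simp
      then show ?thesis using low[OF that] by linarith
    qed
  qed (use assms(6-8,12,16) u c low up f in auto)
  have odd: "cone_odd v"
    unfolding cone_odd_def
  proof
    show "v y = - v (prod.swap y)" for y using assms(25)[of y] by simp
  qed
  have meas: "v \<in> borel_measurable lebesgue"
    using assms(17) by (simp add: L1_gamma_def)
  show "v x \<le> 0"
    by (rule linearized_maximum_principle[OF f(1,2,6) assms(11) meas assms(18) odd assms(21-24,26) x])
qed

end
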